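(* Let $(J^s)_{s\in(1/2,1)}$ satisfy Hypotheses (H1) and (H2) below with constant $\delta>0$ and limit kernel $J^1$. For $\varepsilon>0$, $s\in(1/2,1)$ let $F^s_\varepsilon$ be the probability equilibrium of $\partial_tu=\varepsilon^{-2s}(J^s_\varepsilon*u-u)+\mathrm{div}(xu)$ and $F_\varepsilon$ the probability equilibrium of $\partial_tu=\varepsilon^{-2}(J^1_\varepsilon*u-u)+\mathrm{div}(xu)$. Let $0\le k<m<1$ and $\theta=\frac{m-k}{m+d/2}$. Then there is a constant $C$ such that for all $s\in(1/2,1)$ and all $\varepsilon\in\Big(0,\sqrt{\tfrac{2}{4+2\delta+d}}\Big)$, $$\|F^s_\varepsilon-F_\varepsilon\|_{L^1_k}\le C(1-s)^\theta\big(1+\varepsilon^{\delta\theta}|\log\varepsilon|\big).$$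
   Context: $\langle x\rangle=(1+|x|^2)^{1/2}$; $\|f\|_{L^1_k}=\int\langle x\rangle^k|f|$; $\hat f(\xi)=\int e^{-ix\cdot\xi}f$; $J_\varepsilon(x)=\varepsilon^{-d}J(x/\varepsilon)$. An equilibrium is a probability density solving the stationary equation weakly. Hypothesis (H1): $(J^s)_{s\in(1/2,1)}$ is a family of probability densities on $\mathbb{R}^d$ with $J^s\in L^1\cap L^p$ for some $p\in(1,\infty]$, such that (i) $\int\min\{1,|y|^2\}J^s<\infty$; (ii) there exist $\delta,C_0>0$ independent of $s$ with $\hat J^s(\xi)=1-|\xi|^{2s}+R_s(\xi)$, $|R_s(\xi)|\le C_0|\xi|^{2s+\delta}$ for $|\xi|\le1$; (iii) there exist $C,R>0$, $\Psi$ with $\int(1+|x|^2)|\Psi|<\infty$, $\int x\Psi=0$, independent of $s$, with $J^s(x)\le C(1-s)|x|^{-d-2s}+\Psi(x)$ for $|x|\ge R$. Hypothesis (H2): $J^1$ is a probability density with $\hat J^1(\xi)=1-|\xi|^2+R_1(\xi)$, $|R_1(\xi)|\le C_0|\xi|^{2+\delta}$ for $|\xi|\le1$, and there is $\mathfrak C>0$ with $\left|\frac{1-\hat J^s(\xi)}{|\xi|^{2s}}-\frac{1-\hat J^1(\xi)}{|\xi|^2}\right|\le\mathfrak C(1-s)|\xi|^\delta\max(1,|\log|\xi||)$ for all $s\in(1/2,1)$, $\xi\in\mathbb{R}^d$. *)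

theory Defs
  imports "HOL-Analysis.Analysis"
begin

definition prob_density :: "('a::euclidean_space \<Rightarrow> real) \<Rightarrow> bool" where
  "prob_density f \<longleftrightarrow> f \<in> borel_measurable lborel \<and> (\<forall>x. 0 \<le> f x)
      \<and> integrable lborel f \<and> integral\<^sup>L lborel f = 1"

definition in_some_Lp :: "('a::euclidean_space \<Rightarrow> real) \<Rightarrow> bool" where
  "in_some_Lp f \<longleftrightarrow> f \<in> borel_measurable lborel \<and>
     ((\<exists>p>1. integrable lborel (\<lambda>x. \<bar>f x\<bar> powr p)) \<or> (\<exists>B. AE x in lborel. \<bar>f x\<bar> \<le> B))"

definition fourier :: "('a::euclidean_space \<Rightarrow> real) \<Rightarrow> 'a \<Rightarrow> complex" where
  "fourier f \<xi> = integral\<^sup>L lborel (\<lambda>x. cis (- (x \<bullet> \<xi>)) * complex_of_real (f x))"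

definition jbr :: "'a::euclidean_space \<Rightarrow> real" where
  "jbr x = sqrt (1 + (norm x)\<^sup>2)"

text \<open>Weighted L^1_k norm (as an extended nonnegative real, so finiteness is part of any bound).\<close>
definition L1k_norm :: "real \<Rightarrow> ('a::euclidean_space \<Rightarrow> real) \<Rightarrow> ennreal" where
  "L1k_norm k f = (\<integral>\<^sup>+ x. ennreal (jbr x powr k * \<bar>f x\<bar>) \<partial>lborel)"

definition rescale :: "real \<Rightarrow> ('a::euclidean_space \<Rightarrow> real) \<Rightarrow> 'a \<Rightarrow> real" where
  "rescale \<epsilon> J x = \<epsilon> powr (- real DIM('a)) * J ((1 / \<epsilon>) *\<^sub>R x)"

definition test_fun :: "('a::euclidean_space \<Rightarrow> real) \<Rightarrow> ('a \<Rightarrow> ('a \<Rightarrow>\<^sub>L real)) \<Rightarrow> bool" where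
  "test_fun \<phi> \<phi>' \<longleftrightarrow> (\<forall>x. (\<phi> has_derivative blinfun_apply (\<phi>' x)) (at x))
     \<and> continuous_on UNIV \<phi>' \<and> bounded {x. \<phi> x \<noteq> 0}"

text \<open>Equilibrium: probability density u solving weakly
  0 = eps^(-a) (J_eps * u - u) + div(x u),
  i.e. for all test functions phi:
  integral u(y) [eps^(-a) (integral J_eps(x-y) phi(x) dx - phi(y)) - y . grad phi(y)] dy = 0.\<close>
definition equilibrium :: "('a::euclidean_space \<Rightarrow> real) \<Rightarrow> real \<Rightarrow> real \<Rightarrow> ('a \<Rightarrow> real) \<Rightarrow> bool" where
  "equilibrium J a \<epsilon> u \<longleftrightarrow> prob_density u \<and>
     (\<forall>\<phi> \<phi>'. test_fun \<phi> \<phi>' \<longrightarrow>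
        integral\<^sup>L lborel (\<lambda>y. u y * (\<epsilon> powr (- a) *
            ((\<integral>x. rescale \<epsilon> J (x - y) * \<phi> x \<partial>lborel) - \<phi> y)
          - blinfun_apply (\<phi>' y) y)) = 0)"

definition H1 :: "(real \<Rightarrow> 'a::euclidean_space \<Rightarrow> real) \<Rightarrow> real \<Rightarrow> real \<Rightarrow> bool" where
  "H1 J \<delta> C\<^sub>0 \<longleftrightarrow> \<delta> > 0 \<and> C\<^sub>0 > 0 \<and>
     (\<forall>s\<in>{1/2<..<1}. prob_density (J s) \<and> in_some_Lp (J s)
        \<and> (\<integral>\<^sup>+ y. ennreal (min 1 ((norm y)\<^sup>2) * J s y) \<partial>lborel) < \<infinity>
        \<and> (\<forall>\<xi>. norm \<xi> \<le> 1 \<longrightarrow>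
              cmod (fourier (J s) \<xi> - complex_of_real (1 - norm \<xi> powr (2 * s)))
                \<le> C\<^sub>0 * norm \<xi> powr (2 * s + \<delta>)))
   \<and> (\<exists>C R (\<Psi>::'a \<Rightarrow> real). C > 0 \<and> R > 0 \<and> \<Psi> \<in> borel_measurable lborel
        \<and> integrable lborel (\<lambda>x. (1 + (norm x)\<^sup>2) * \<bar>\<Psi> x\<bar>)
        \<and> (\<integral>x. \<Psi> x *\<^sub>R x \<partial>lborel) = 0
        \<and> (\<forall>s\<in>{1/2<..<1}. \<forall>x. norm x \<ge> R \<longrightarrow>
              J s x \<le> C * (1 - s) * norm x powr (- real DIM('a) - 2 * s) + \<Psi> x))"

definition H2 :: "(real \<Rightarrow> 'a::euclidean_space \<Rightarrow> real) \<Rightarrow> ('a \<Rightarrow> real) \<Rightarrow> real \<Rightarrow> real \<Rightarrow> bool" where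
  "H2 J J1 \<delta> C\<^sub>0 \<longleftrightarrow> prob_density J1 \<and>
     (\<forall>\<xi>. norm \<xi> \<le> 1 \<longrightarrow>
        cmod (fourier J1 \<xi> - complex_of_real (1 - (norm \<xi>)\<^sup>2)) \<le> C\<^sub>0 * norm \<xi> powr (2 + \<delta>))
   \<and> (\<exists>\<CC>>0. \<forall>s\<in>{1/2<..<1}. \<forall>\<xi>. \<xi> \<noteq> 0 \<longrightarrow>
        cmod ((1 - fourier (J s) \<xi>) / complex_of_real (norm \<xi> powr (2 * s))
              - (1 - fourier J1 \<xi>) / complex_of_real ((norm \<xi>)\<^sup>2))
          \<le> \<CC> * (1 - s) * norm \<xi> powr \<delta> * max 1 \<bar>ln (norm \<xi>)\<bar>)"

end

theory Submission
  imports Defs "HOL-Probability.Probability"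
begin

text \<open>
  Testing the stationary equation with dilated, truncated plane waves turns it into a linear ODE along
  rays for the Fourier transform, so that an equilibrium has transform
  \<open>exp (- \<Phi> \<xi>)\<close> with \<open>\<Phi> \<xi> = \<epsilon> powr (- a) * (\<integral>r\<in>{0..1}. (1 - J^(\<epsilon> r \<xi>)) / r)\<close>.
  Hypothesis (H2) makes the two exponents differ by \<open>O((1 - s) (1 + |\<xi>|) powr (2 + \<delta> + \<kappa>))\<close>.
  Decay of the transforms comes from \<open>(\<integral>r\<in>{0..1}. (1 - cos (r w)) / r) \<ge> ln |w| - O(1)\<close> together with
  the fact that thin slabs carry little mass under \<open>J1\<close>, hence (by H2, tested against a Gaussian) under
  \<open>J s\<close> for \<open>s\<close> near \<open>1\<close>. The range of \<open>\<epsilon>\<close> gives just enough decay for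
  an \<open>L^2\<close> bound of order \<open>(1 - s) powr (1 - \<kappa>)\<close> with any \<open>\<kappa> > 0\<close>. This loss is recovered by interpolating
  with a moment of order \<open>m' \<in> (m, 1)\<close> instead of \<open>m\<close>. For \<open>s\<close> away from \<open>1\<close> the moment bound suffices.
\<close>

section \<open>Fourier transforms of integrable functions and of the Gaussian\<close>

text \<open>Since \<open>1 - fourier J\<close> is bounded, the exponent grows only like \<epsilon>
  powr (- a) times ln (\<epsilon> |\<xi>|), so the transforms have merely polynomial decay, of order
  about \<epsilon> powr (- 2). With d the dimension, the condition on \<epsilon> says exactly
  \<epsilon> powr (- 2) > 2 + \<delta> + d/2. Uniformly over that range this is borderline: growth
  of order 2 + \<delta> in the difference of the exponents, set against this decay, leaves |\<xi>|
  powr (- d/2), whose square just fails to be integrable at infinity. Uniform estimates lose a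
  little more, through the logarithm in (H2), the mass of slabs and the rate \<epsilon> powr (- 2s)
  in place of \<epsilon> powr (- 2). The difference of the exponents is therefore used only to the
  power 1 - \<kappa>. With a loss \<kappa> in the decay and a loss \<kappa> in the growth, this
  power gains \<kappa> (2 + \<delta> + \<kappa>), which exceeds 2 \<kappa>, and integrability
  returns. The equilibria are only known to be integrable, so the L^2 norm of their transforms is
  converted into an L^1 bound on balls by duality, after smoothing with Gaussians.\<close>

lemma fourier_integrable:
  fixes f :: "'a::euclidean_space \<Rightarrow> real"
  assumes "integrable lborel f"
  shows "integrable lborel (\<lambda>x. cis (- (x \<bullet> \<xi>)) * complex_of_real (f x))"
proof (rule Bochner_Integration.integrable_bound[OF integrable_abs[OF assms]])
  have [measurable]: "f \<in> borel_measurable borel" using assms by auto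
  have "continuous_on UNIV (\<lambda>x. cis (- (x \<bullet> \<xi>)))"
    by (intro continuous_intros)
  then have [measurable]: "(\<lambda>x. cis (- (x \<bullet> \<xi>))) \<in> borel_measurable borel"
    by (rule borel_measurable_continuous_onI)
  show "(\<lambda>x. cis (- (x \<bullet> \<xi>)) * complex_of_real (f x)) \<in> borel_measurable lborel"
    by measurable
qed (auto simp: norm_mult)

lemma norm_fourier_le:
  fixes f :: "'a::euclidean_space \<Rightarrow> real"
  shows "norm (fourier f \<xi>) \<le> (LBINT x. \<bar>f x\<bar>)"
  unfolding fourier_def
  by (rule order_trans[OF integral_norm_bound]) (simp add: norm_mult)

lemma norm_fourier_le_1: "prob_density f \<Longrightarrow> norm (fourier f \<xi>) \<le> 1"
  using norm_fourier_le[of f \<xi>] by (auto simp: prob_density_def)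

lemma fourier_0: "prob_density f \<Longrightarrow> fourier f 0 = 1"
  by (simp add: fourier_def prob_density_def)

lemma continuous_on_fourier:
  fixes f :: "'a::euclidean_space \<Rightarrow> real"
  assumes "integrable lborel f"
  shows "continuous_on UNIV (fourier f)"
  unfolding fourier_def continuous_on_eq_continuous_within
proof safe
  fix \<xi> :: 'a
  have [measurable]: "f \<in> borel_measurable borel" using assms by auto
  show "isCont (\<lambda>\<xi>. LINT x|lborel. cis (- (x \<bullet> \<xi>)) * complex_of_real (f x)) \<xi>"
    unfolding continuous_at_sequentially
  proof (safe, unfold comp_def)
    fix X :: "nat \<Rightarrow> 'a" assume X: "X \<longlonglongrightarrow> \<xi>"
    show "(\<lambda>n. LINT x|lborel. cis (- (x \<bullet> X n)) * complex_of_real (f x)) \<longlonglongrightarrow>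
        (LINT x|lborel. cis (- (x \<bullet> \<xi>)) * complex_of_real (f x))"
    proof (rule integral_dominated_convergence[where w="\<lambda>x. \<bar>f x\<bar>"])
      show "AE x in lborel. (\<lambda>n. cis (- (x \<bullet> X n)) * complex_of_real (f x))
          \<longlonglongrightarrow> cis (- (x \<bullet> \<xi>)) * complex_of_real (f x)"
        by (intro AE_I2 tendsto_intros X)
    qed (use assms fourier_integrable[OF assms] in \<open>auto simp: norm_mult\<close>)
  qed
qed

lemma fourier_measurable [measurable]:
  assumes "integrable lborel f"
  shows "fourier f \<in> borel_measurable borel"
  by (rule borel_measurable_continuous_onI[OF continuous_on_fourier[OF assms]])

lemma fourier_diff:
  fixes f g :: "'a::euclidean_space \<Rightarrow> real"
  assumes "integrable lborel f" "integrable lborel g"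
  shows "fourier (\<lambda>x. f x - g x) \<xi> = fourier f \<xi> - fourier g \<xi>"
  unfolding fourier_def
  by (subst Bochner_Integration.integral_diff[symmetric])
     (auto intro!: fourier_integrable[OF assms(1)] fourier_integrable[OF assms(2)] simp: right_diff_distrib)

lemma Re_fourier:
  fixes f :: "'a::euclidean_space \<Rightarrow> real"
  assumes "integrable lborel f"
  shows "Re (fourier f \<xi>) = (LBINT x. cos (x \<bullet> \<xi>) * f x)"
  unfolding fourier_def
  by (subst integral_Re[OF fourier_integrable[OF assms], symmetric]) simp

lemma integrable_cos_mult:
  fixes f :: "'a::euclidean_space \<Rightarrow> real"
  assumes "integrable lborel f"
  shows "integrable lborel (\<lambda>x. cos (x \<bullet> \<xi>) * f x)"
  using integrable_Re[OF fourier_integrable[OF assms, of \<xi>]] by simp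

lemma Re_1_minus_fourier:
  fixes f :: "'a::euclidean_space \<Rightarrow> real"
  assumes "prob_density f"
  shows "Re (1 - fourier f \<xi>) = (LBINT x. (1 - cos (x \<bullet> \<xi>)) * f x)"
  using assms Re_fourier[of f \<xi>] integrable_cos_mult[of f \<xi>]
  by (simp add: prob_density_def left_diff_distrib)

definition gauss :: "'a::euclidean_space \<Rightarrow> real" where
  "gauss x = exp (- (norm x)\<^sup>2 / 2)"

lemma gauss_nonneg [simp]: "0 \<le> gauss x"
  and gauss_pos [simp]: "0 < gauss x"
  and gauss_le_1 [simp]: "gauss x \<le> 1"
  by (auto simp: gauss_def)

lemma gauss_measurable [measurable]: "gauss \<in> borel_measurable borel"
  unfolding gauss_def by measurable

lemma gauss_minus [simp]: "gauss (- x) = gauss x"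
  by (simp add: gauss_def)

lemma gauss_conv_prod: "gauss (x::'a::euclidean_space) = (\<Prod>b\<in>Basis. exp (- (x \<bullet> b)\<^sup>2 / 2))"
proof -
  have "(norm x)\<^sup>2 = (\<Sum>b\<in>Basis. (x \<bullet> b)\<^sup>2)"
    by (subst power2_norm_eq_inner, subst euclidean_inner) (simp add: power2_eq_square)
  then show ?thesis
    by (simp add: gauss_def exp_sum[symmetric] sum_divide_distrib[symmetric] sum_negf)
qed

lemma gaussian_1d:
  fixes t :: real
  shows "integrable lborel (\<lambda>x. cis (x * t) * complex_of_real (exp (- x\<^sup>2 / 2)))"
    and "(LBINT x. cis (x * t) * complex_of_real (exp (- x\<^sup>2 / 2)))
          = complex_of_real (sqrt (2 * pi) * exp (- t\<^sup>2 / 2))"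
proof -
  have eq: "cis (x * t) * complex_of_real (exp (- x\<^sup>2 / 2)) =
      complex_of_real (sqrt (2 * pi)) * (std_normal_density x *\<^sub>R cis (t * x))" for x
    by (simp add: std_normal_density_def scaleR_conv_of_real mult.commute)
  have m: "(\<lambda>x. cis (t * x)) \<in> borel_measurable lborel"
    by (auto intro!: borel_measurable_continuous_onI continuous_intros)
  have int: "integrable lborel (\<lambda>x. std_normal_density x *\<^sub>R cis (t * x))"
  proof (rule Bochner_Integration.integrable_bound[OF integrable_normal_density[of 1 0]])
    show "(\<lambda>x. std_normal_density x *\<^sub>R cis (t * x)) \<in> borel_measurable lborel"
      using m by measurable
  qed auto
  show "integrable lborel (\<lambda>x. cis (x * t) * complex_of_real (exp (- x\<^sup>2 / 2)))"
    unfolding eq by (intro integrable_mult_right int)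
  have "(LBINT x. std_normal_density x *\<^sub>R cis (t * x)) = char std_normal_distribution t"
    unfolding char_def using m by (subst integral_density) (auto simp: cis_conv_exp)
  then show "(LBINT x. cis (x * t) * complex_of_real (exp (- x\<^sup>2 / 2)))
          = complex_of_real (sqrt (2 * pi) * exp (- t\<^sup>2 / 2))"
    unfolding eq integral_mult_right_zero by (simp only: char_std_normal_distribution of_real_mult)
qed

text \<open>Coordinates with respect to \<open>Basis\<close> carry Lebesgue measure to a product
  measure (\<open>lborel_eq\<close>), where integrals of products factor.\<close>

lemma prod_basis_integral:
  fixes f :: "'a::euclidean_space \<Rightarrow> real \<Rightarrow> complex"
  assumes int: "\<And>b. b \<in> Basis \<Longrightarrow> integrable lborel (f b)"
  shows "integrable lborel (\<lambda>x. \<Prod>b\<in>Basis. f b (x \<bullet> b))"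
    and "(LBINT x. (\<Prod>b\<in>Basis. f b (x \<bullet> b))) = (\<Prod>b\<in>Basis. (LBINT x. f b x))"
proof -
  interpret product_sigma_finite "\<lambda>_::'a. lborel :: real measure"
    by unfold_locales
  have m [measurable]: "f b \<in> borel_measurable borel" if "b \<in> Basis" for b
    using int[OF that] by auto
  have m2: "(\<lambda>x. \<Prod>b\<in>Basis. f b (x \<bullet> b)) \<in> borel_measurable borel"
    by (intro borel_measurable_prod) measurable
  have eq: "(\<Prod>b\<in>Basis. f b ((\<Sum>c\<in>Basis. g c *\<^sub>R c) \<bullet> b)) = (\<Prod>b\<in>Basis. f b (g b))" for g
    by (intro prod.cong) auto
  show "integrable lborel (\<lambda>x. \<Prod>b\<in>Basis. f b (x \<bullet> b))"
    using product_integrable_prod[of Basis f] int m2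
    by (subst lborel_eq, subst integrable_distr_eq) (auto simp: eq)
  show "(LBINT x. (\<Prod>b\<in>Basis. f b (x \<bullet> b))) = (\<Prod>b\<in>Basis. (LBINT x. f b x))"
    using product_integral_prod[of Basis f] int m2
    by (subst (1) lborel_eq, subst integral_distr) (auto simp: eq)
qed

lemma gauss_fourier_aux:
  fixes \<xi> :: "'a::euclidean_space"
  shows "integrable lborel (\<lambda>x. cis (x \<bullet> \<xi>) * complex_of_real (gauss x))"
    and "(LBINT x. cis (x \<bullet> \<xi>) * complex_of_real (gauss x))
          = complex_of_real (sqrt (2 * pi) ^ DIM('a) * gauss \<xi>)"
proof -
  have cs: "cis (sum g A) = (\<Prod>b\<in>A. cis (g b))" for g and A :: "'a set"
    by (induction A rule: infinite_finite_induct) (auto simp: cis_mult[symmetric])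
  have eq: "cis (x \<bullet> \<xi>) * complex_of_real (gauss x) =
     (\<Prod>b\<in>Basis. cis ((x \<bullet> b) * (\<xi> \<bullet> b)) * complex_of_real (exp (- (x \<bullet> b)\<^sup>2 / 2)))" for x
    by (subst euclidean_inner) (simp add: cs gauss_conv_prod prod.distrib)
  show "integrable lborel (\<lambda>x. cis (x \<bullet> \<xi>) * complex_of_real (gauss x))"
    unfolding eq by (intro prod_basis_integral gaussian_1d)
  show "(LBINT x. cis (x \<bullet> \<xi>) * complex_of_real (gauss x))
          = complex_of_real (sqrt (2 * pi) ^ DIM('a) * gauss \<xi>)"
    unfolding eq
    by (subst prod_basis_integral(2)[OF gaussian_1d(1)], subst gaussian_1d(2))
       (simp only: gauss_conv_prod prod.distrib prod_constant of_real_mult of_real_prod of_real_power)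
qed

lemma integrable_gauss [simp, intro]: "integrable lborel (gauss :: 'a::euclidean_space \<Rightarrow> real)"
  using integrable_Re[OF gauss_fourier_aux(1)[of 0]] by simp

lemma fourier_gauss:
  fixes \<xi> :: "'a::euclidean_space"
  shows "fourier gauss \<xi> = complex_of_real (sqrt (2 * pi) ^ DIM('a) * gauss \<xi>)"
  using gauss_fourier_aux(2)[of "- \<xi>"] by (simp add: fourier_def)

lemma integral_gauss: "(LBINT x. gauss (x::'a::euclidean_space)) = sqrt (2 * pi) ^ DIM('a)"
  using Re_fourier[of "gauss :: 'a \<Rightarrow> real" 0] fourier_gauss[of "0::'a"] by (simp add: gauss_def)

lemma lborel_integrable_scaleR:
  fixes f :: "'a::euclidean_space \<Rightarrow> 'b::{banach, second_countable_topology}"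
  assumes "integrable lborel f" "c > 0"
  shows "integrable lborel (\<lambda>x. f (t + c *\<^sub>R x))"
proof -
  have [measurable]: "f \<in> borel_measurable borel" using assms by auto
  have "integrable (density (distr lborel borel (\<lambda>x. t + c *\<^sub>R x)) (\<lambda>_. \<bar>c\<bar>^DIM('a))) f"
    using assms by (subst lborel_affine[symmetric]) auto
  then have "integrable (distr lborel borel (\<lambda>x. t + c *\<^sub>R x)) (\<lambda>x. (\<bar>c\<bar>^DIM('a)) *\<^sub>R f x)"
    by (subst (asm) integrable_density) auto
  then have "integrable lborel (\<lambda>x. (\<bar>c\<bar>^DIM('a)) *\<^sub>R f (t + c *\<^sub>R x))"
    by (subst (asm) integrable_distr_eq) auto
  then have "integrable lborel (\<lambda>x. (1/\<bar>c\<bar>^DIM('a)) *\<^sub>R ((\<bar>c\<bar>^DIM('a)) *\<^sub>R f (t + c *\<^sub>R x)))"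
    by (rule integrable_scaleR_right)
  moreover have "(1/\<bar>c\<bar>^DIM('a)) *\<^sub>R ((\<bar>c\<bar>^DIM('a)) *\<^sub>R y) = y" for y :: 'b
    using \<open>c > 0\<close> by simp
  ultimately show ?thesis by (simp only:)
qed

lemma lborel_integral_scaleR:
  fixes f :: "'a::euclidean_space \<Rightarrow> 'b::{banach, second_countable_topology}"
  assumes [measurable]: "f \<in> borel_measurable borel" and "c > 0"
  shows "(LBINT x. f x) = c ^ DIM('a) *\<^sub>R (LBINT x. f (t + c *\<^sub>R x))"
proof -
  have "(LBINT x. f x) = (\<integral>x. f x \<partial>(density (distr lborel borel (\<lambda>x. t + c *\<^sub>R x)) (\<lambda>_. \<bar>c\<bar>^DIM('a))))"
    using assms by (subst lborel_affine[symmetric]) auto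
  also have "\<dots> = (\<integral>x. (\<bar>c\<bar>^DIM('a)) *\<^sub>R f x \<partial>(distr lborel borel (\<lambda>x. t + c *\<^sub>R x)))"
    by (subst integral_density) auto
  also have "\<dots> = (LBINT x. (\<bar>c\<bar>^DIM('a)) *\<^sub>R f (t + c *\<^sub>R x))"
    by (subst integral_distr) auto
  finally show ?thesis using \<open>c > 0\<close> by simp
qed

section \<open>Testing the stationary equation with plane waves\<close>

lemma bounded_of_bounded_support:
  fixes f :: "'a::euclidean_space \<Rightarrow> real"
  assumes "continuous_on UNIV f" and "\<And>x. K < norm x \<Longrightarrow> f x = 0"
  shows "\<exists>B\<ge>0. \<forall>x. \<bar>f x\<bar> \<le> B"
proof -
  have "bounded (f ` cball 0 K)"
    by (intro compact_imp_bounded compact_continuous_image continuous_on_subset[OF assms(1)]) auto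
  then obtain B where "\<forall>y\<in>f ` cball 0 K. norm y \<le> B"
    unfolding bounded_iff by blast
  then have B: "\<And>x. norm x \<le> K \<Longrightarrow> \<bar>f x\<bar> \<le> B"
    by auto
  show ?thesis
  proof (intro exI[of _ "max B 0"] conjI allI)
    show "\<bar>f x\<bar> \<le> max B 0" for x
      using B[of x] assms(2)[of x] by (cases "norm x \<le> K") auto
  qed simp
qed

lemma test_fun_continuous: "test_fun \<phi> \<phi>' \<Longrightarrow> continuous_on UNIV \<phi>"
  unfolding test_fun_def
  by (intro continuous_at_imp_continuous_on) (auto dest!: has_derivative_continuous spec)

lemma test_fun_bounds:
  fixes \<phi> :: "'a::euclidean_space \<Rightarrow> real"
  assumes "test_fun \<phi> \<phi>'"
  shows "\<exists>B\<ge>0. \<forall>x. \<bar>\<phi> x\<bar> \<le> B" and "\<exists>B\<ge>0. \<forall>x. \<bar>blinfun_apply (\<phi>' x) x\<bar> \<le> B"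
    and "continuous_on UNIV (\<lambda>x. blinfun_apply (\<phi>' x) x)"
proof -
  have d: "(\<phi> has_derivative blinfun_apply (\<phi>' x)) (at x)" for x
    using assms by (auto simp: test_fun_def)
  have c: "continuous_on UNIV \<phi>'" using assms by (auto simp: test_fun_def)
  obtain K where K: "\<And>x. \<phi> x \<noteq> 0 \<Longrightarrow> norm x \<le> K"
    using assms unfolding test_fun_def bounded_iff by auto
  have z: "\<phi> x = 0" if "K < norm x" for x using K[of x] that by force
  have z': "blinfun_apply (\<phi>' x) x = 0" if "K < norm x" for x
  proof -
    \<comment> \<open>\<phi> vanishes on a whole neighbourhood of such an x, so uniqueness of
      derivatives forces \<open>\<phi>' x\<close> to be 0.\<close>
    have "((\<lambda>_. 0) has_derivative blinfun_apply (\<phi>' x)) (at x)"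
    proof (rule has_derivative_transform_within_open[OF d])
      show "open {x::'a. K < norm x}" by (intro open_Collect_less continuous_intros)
    qed (use that z in auto)
    then have "blinfun_apply (\<phi>' x) = (\<lambda>_. 0)"
      by (rule has_derivative_unique) simp
    then show ?thesis by simp
  qed
  show c2: "continuous_on UNIV (\<lambda>x. blinfun_apply (\<phi>' x) x)"
    by (intro continuous_intros c)
  show "\<exists>B\<ge>0. \<forall>x. \<bar>\<phi> x\<bar> \<le> B"
    by (rule bounded_of_bounded_support[OF test_fun_continuous[OF assms] z])
  show "\<exists>B\<ge>0. \<forall>x. \<bar>blinfun_apply (\<phi>' x) x\<bar> \<le> B"
    by (rule bounded_of_bounded_support[OF c2 z'])
qed

text \<open>Dilations turn the drift into a derivative: y . grad applied to \<phi>(r y) equals r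
  d/dr of \<phi>(r y).\<close>

lemma test_fun_dilate:
  fixes \<phi> :: "'a::euclidean_space \<Rightarrow> real"
  assumes "test_fun \<phi> \<phi>'" "r > 0"
  shows "test_fun (\<lambda>x. \<phi> (r *\<^sub>R x)) (\<lambda>x. r *\<^sub>R \<phi>' (r *\<^sub>R x))"
  unfolding test_fun_def
proof (intro conjI allI)
  fix x
  have "(\<phi> has_derivative blinfun_apply (\<phi>' (r *\<^sub>R x))) (at (r *\<^sub>R x))"
    using assms by (auto simp: test_fun_def)
  from has_derivative_compose[OF has_derivative_scaleR_right[OF has_derivative_ident] this]
  have "((\<lambda>x. \<phi> (r *\<^sub>R x)) has_derivative (\<lambda>h. blinfun_apply (\<phi>' (r *\<^sub>R x)) (r *\<^sub>R h))) (at x)"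
    by simp
  then show "((\<lambda>x. \<phi> (r *\<^sub>R x)) has_derivative blinfun_apply (r *\<^sub>R \<phi>' (r *\<^sub>R x))) (at x)"
    by (simp add: blinfun.bilinear_simps scaleR_blinfun.rep_eq)
next
  have "continuous_on UNIV \<phi>'" using assms by (auto simp: test_fun_def)
  then show "continuous_on UNIV (\<lambda>x. r *\<^sub>R \<phi>' (r *\<^sub>R x))"
    by (rule continuous_on_scaleR[OF continuous_on_const
          continuous_on_compose2[OF _ continuous_on_scaleR[OF continuous_on_const continuous_on_id]]]) auto
  obtain K where K: "\<And>x. \<phi> x \<noteq> 0 \<Longrightarrow> norm x \<le> K"
    using assms unfolding test_fun_def bounded_iff by auto
  show "bounded {x. \<phi> (r *\<^sub>R x) \<noteq> 0}"
    unfolding bounded_iff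
  proof (intro exI[of _ "K / r"] ballI)
    fix x assume "x \<in> {x. \<phi> (r *\<^sub>R x) \<noteq> 0}"
    then show "norm x \<le> K / r"
      using K[of "r *\<^sub>R x"] assms(2) by (simp add: field_simps)
  qed
qed

lemma integrable_density_mult:
  fixes u g :: "'a::euclidean_space \<Rightarrow> real"
  assumes "integrable lborel u" and [measurable]: "g \<in> borel_measurable borel"
    and "\<And>x. \<bar>g x\<bar> \<le> B"
  shows "integrable lborel (\<lambda>x. u x * g x)"
proof (rule Bochner_Integration.integrable_bound[OF integrable_mult_left[OF assms(1), of B]])
  have [measurable]: "u \<in> borel_measurable borel" using assms by auto
  show "(\<lambda>x. u x * g x) \<in> borel_measurable lborel" by measurable
  show "AE x in lborel. norm (u x * g x) \<le> norm (u x * B)"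
    using assms(3) by (intro AE_I2) (auto simp: abs_mult intro!: mult_left_mono intro: order_trans[OF _ abs_ge_self])
qed

lemma integrable_tensor_bound:
  fixes u :: "'a::euclidean_space \<Rightarrow> real" and g :: "real \<Rightarrow> real" and \<kappa> :: "'a \<Rightarrow> real \<Rightarrow> real"
  assumes u: "integrable lborel u" and g: "integrable lborel g"
    and [measurable]: "case_prod \<kappa> \<in> borel_measurable (borel \<Otimes>\<^sub>M borel)"
    and \<kappa>: "\<And>y r. \<bar>\<kappa> y r\<bar> \<le> g r"
  shows "integrable (lborel \<Otimes>\<^sub>M lborel) (\<lambda>(y, r). u y * \<kappa> y r)"
proof (rule Bochner_Integration.integrable_bound)
  have [measurable]: "u \<in> borel_measurable borel" "g \<in> borel_measurable borel" using u g by auto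
  show "integrable (lborel \<Otimes>\<^sub>M lborel) (\<lambda>(y, r). u y * g r)"
  proof (rule lborel_pair.Fubini_integrable)
    have "(\<lambda>y. \<integral>r. norm (case (y, r) of (y, r) \<Rightarrow> u y * g r) \<partial>lborel) = (\<lambda>y. \<bar>u y\<bar> * (LBINT r. \<bar>g r\<bar>))"
      by (simp add: abs_mult)
    then show "integrable lborel (\<lambda>y. \<integral>r. norm (case (y, r) of (y, r) \<Rightarrow> u y * g r) \<partial>lborel)"
      using u by simp
    show "AE y in lborel. integrable lborel (\<lambda>r. case (y, r) of (y, r) \<Rightarrow> u y * g r)"
      by (intro AE_I2) (simp only: prod.case integrable_mult_right[OF g])
  qed measurable
  show "(\<lambda>(y, r). u y * \<kappa> y r) \<in> borel_measurable (lborel \<Otimes>\<^sub>M lborel)"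
    by measurable
  have "\<bar>\<kappa> y r\<bar> \<le> \<bar>g r\<bar>" for y r using \<kappa>[of y r] by linarith
  then show "AE z in lborel \<Otimes>\<^sub>M lborel. norm (case z of (y, r) \<Rightarrow> u y * \<kappa> y r) \<le> norm (case z of (y, r) \<Rightarrow> u y * g r)"
    by (intro AE_I2) (auto simp: abs_mult intro!: mult_left_mono split: prod.splits)
qed

lemma convolution_rescale:
  fixes J \<phi> :: "'a::euclidean_space \<Rightarrow> real"
  assumes [measurable]: "J \<in> borel_measurable borel" "\<phi> \<in> borel_measurable borel" and "\<epsilon> > 0"
  shows "(LBINT x. rescale \<epsilon> J (x - y) * \<phi> x) = (LBINT w. J w * \<phi> (y + \<epsilon> *\<^sub>R w))"
proof -
  have "(LBINT x. rescale \<epsilon> J (x - y) * \<phi> x)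
      = \<epsilon> ^ DIM('a) *\<^sub>R (LBINT w. rescale \<epsilon> J (y + \<epsilon> *\<^sub>R w - y) * \<phi> (y + \<epsilon> *\<^sub>R w))"
    unfolding rescale_def by (rule lborel_integral_scaleR) (use assms in auto)
  also have "(\<lambda>w. rescale \<epsilon> J (y + \<epsilon> *\<^sub>R w - y) * \<phi> (y + \<epsilon> *\<^sub>R w))
      = (\<lambda>w. \<epsilon> powr (- real DIM('a)) * (J w * \<phi> (y + \<epsilon> *\<^sub>R w)))"
    using \<open>\<epsilon> > 0\<close> by (auto simp: rescale_def fun_eq_iff)
  also have "\<epsilon> ^ DIM('a) *\<^sub>R (LBINT w. \<epsilon> powr (- real DIM('a)) * (J w * \<phi> (y + \<epsilon> *\<^sub>R w)))
      = (LBINT w. J w * \<phi> (y + \<epsilon> *\<^sub>R w))"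
    using \<open>\<epsilon> > 0\<close> by (simp add: powr_minus powr_realpow)
  finally show ?thesis .
qed

text \<open>The jump term of the equation tested with \<phi>(r .), without the factor \<epsilon>
  powr (- a). It contains no derivative of \<phi> and is bounded for bounded \<phi>, so it makes
  sense for plane waves, which are not test functions.\<close>

definition jump_functional ::
  "('a::euclidean_space \<Rightarrow> real) \<Rightarrow> ('a \<Rightarrow> real) \<Rightarrow> real \<Rightarrow> ('a \<Rightarrow> real) \<Rightarrow> real \<Rightarrow> real" where
  "jump_functional u J \<epsilon> \<phi> r =
     (LBINT y. u y * ((LBINT w. J w * \<phi> (r *\<^sub>R (y + \<epsilon> *\<^sub>R w))) - \<phi> (r *\<^sub>R y)))"

lemma abs_average_le:
  fixes J \<phi> :: "'a::euclidean_space \<Rightarrow> real"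
  assumes J: "prob_density J" and "\<And>x. \<bar>\<phi> x\<bar> \<le> B"
  shows "\<bar>\<integral>w. J w * \<phi> (g w) \<partial>lborel\<bar> \<le> B"
proof -
  have "\<bar>\<integral>w. J w * \<phi> (g w) \<partial>lborel\<bar> \<le> (LBINT w. J w * B)"
  proof (rule order_trans[OF integral_abs_bound integral_mono_AE'])
    show "integrable lborel (\<lambda>w. J w * B)" using J by (auto simp: prob_density_def)
    show "AE w in lborel. \<bar>J w * \<phi> (g w)\<bar> \<le> J w * B"
      using J assms(2) by (intro AE_I2) (auto simp: abs_mult prob_density_def intro!: mult_left_mono)
    have "0 \<le> B" using assms(2)[of 0] by linarith
    then show "AE w in lborel. 0 \<le> J w * B"
      using J by (intro AE_I2) (auto simp: prob_density_def)
  qed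
  then show ?thesis using J by (auto simp: prob_density_def)
qed

text \<open>The jump term and the drift term of the weak equation are separately integrable against
  u, so the drift can be isolated. The left side is r d/dr of the integral of u(y) \<phi>(r y), with
  the derivative taken under the integral.\<close>

lemma equilibrium_dilated:
  fixes u J :: "'a::euclidean_space \<Rightarrow> real"
  assumes eq: "equilibrium J a \<epsilon> u" and J: "prob_density J" and "\<epsilon> > 0"
    and t: "test_fun \<phi> \<phi>'" and "r > 0"
  shows "(LBINT y. u y * blinfun_apply (\<phi>' (r *\<^sub>R y)) (r *\<^sub>R y))
       = \<epsilon> powr (- a) * jump_functional u J \<epsilon> \<phi> r"
proof -
  have u: "prob_density u" using eq by (simp add: equilibrium_def)
  have ui: "integrable lborel u" using u by (simp add: prob_density_def)
  have [measurable]: "J \<in> borel_measurable borel" "u \<in> borel_measurable borel"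
    using J u by (auto simp: prob_density_def)
  have [measurable]: "\<phi> \<in> borel_measurable borel"
    by (rule borel_measurable_continuous_onI[OF test_fun_continuous[OF t]])
  have [measurable]: "(\<lambda>x. blinfun_apply (\<phi>' x) x) \<in> borel_measurable borel"
    by (rule borel_measurable_continuous_onI[OF test_fun_bounds(3)[OF t]])
  obtain B1 where B1: "\<And>x. \<bar>\<phi> x\<bar> \<le> B1" using test_fun_bounds(1)[OF t] by auto
  obtain B2 where B2: "\<And>x. \<bar>blinfun_apply (\<phi>' x) x\<bar> \<le> B2" using test_fun_bounds(2)[OF t] by auto
  let ?g = "\<lambda>y. \<integral>w. J w * \<phi> (r *\<^sub>R (y + \<epsilon> *\<^sub>R w)) \<partial>lborel"
  have "(LBINT y. u y * (\<epsilon> powr (- a) * ((LBINT x. rescale \<epsilon> J (x - y) * \<phi> (r *\<^sub>R x)) - \<phi> (r *\<^sub>R y))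
          - blinfun_apply (r *\<^sub>R \<phi>' (r *\<^sub>R y)) y)) = 0"
    using eq test_fun_dilate[OF t \<open>r > 0\<close>] unfolding equilibrium_def by blast
  then have 0: "(LBINT y. \<epsilon> powr (- a) * (u y * (?g y - \<phi> (r *\<^sub>R y)))
          - u y * blinfun_apply (\<phi>' (r *\<^sub>R y)) (r *\<^sub>R y)) = 0"
    by (subst (asm) convolution_rescale)
       (use \<open>\<epsilon> > 0\<close> in \<open>auto simp: algebra_simps blinfun.bilinear_simps\<close>)
  have "\<bar>?g y\<bar> \<le> B1" for y by (rule abs_average_le[OF J B1])
  then have i1: "integrable lborel (\<lambda>y. u y * (?g y - \<phi> (r *\<^sub>R y)))"
    by (intro integrable_density_mult[OF ui, of _ "B1 + B1"])
       (measurable, rule order_trans[OF abs_triangle_ineq4 add_mono[OF _ B1]])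
  have i2: "integrable lborel (\<lambda>y. u y * blinfun_apply (\<phi>' (r *\<^sub>R y)) (r *\<^sub>R y))"
    by (intro integrable_density_mult[OF ui _ B2]) measurable
  show ?thesis
    using 0 i1 i2 by (simp add: jump_functional_def)
qed

lemma jump_functional_measurable:
  fixes u J :: "'a::euclidean_space \<Rightarrow> real"
  assumes [measurable]: "u \<in> borel_measurable borel" "J \<in> borel_measurable borel"
    "\<phi> \<in> borel_measurable borel"
  shows "jump_functional u J \<epsilon> \<phi> \<in> borel_measurable borel"
  unfolding jump_functional_def by measurable

text \<open>Dividing \<open>equilibrium_dilated\<close> by r and integrating in r removes the
  derivative of \<phi>: the fundamental theorem applies for each y, then Fubini. What remains sees
  only the values of \<phi>, which opens the way to plane waves. The factor 1 / r keeps the lower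
  end positive.\<close>

lemma equilibrium_test_increment:
  fixes u J :: "'a::euclidean_space \<Rightarrow> real"
  assumes eq: "equilibrium J a \<epsilon> u" and J: "prob_density J" and "\<epsilon> > 0"
    and t: "test_fun \<phi> \<phi>'" and r: "0 < r1" "r1 \<le> r2"
  shows "(LBINT y. u y * \<phi> (r2 *\<^sub>R y)) - (LBINT y. u y * \<phi> (r1 *\<^sub>R y))
       = (LBINT r. indicator {r1..r2} r * (\<epsilon> powr (- a) / r * jump_functional u J \<epsilon> \<phi> r))"
proof -
  have u: "prob_density u" using eq by (simp add: equilibrium_def)
  have ui: "integrable lborel u" using u by (simp add: prob_density_def)
  have [measurable]: "u \<in> borel_measurable borel" using ui by auto
  have [measurable]: "\<phi> \<in> borel_measurable borel"
    by (rule borel_measurable_continuous_onI[OF test_fun_continuous[OF t]])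
  define \<psi> where "\<psi> = (\<lambda>x. blinfun_apply (\<phi>' x) x)"
  have c\<psi>: "continuous_on UNIV \<psi>" unfolding \<psi>_def by (rule test_fun_bounds(3)[OF t])
  have [measurable]: "\<psi> \<in> borel_measurable borel"
    by (rule borel_measurable_continuous_onI[OF c\<psi>])
  obtain B1 where B1: "\<And>x. \<bar>\<phi> x\<bar> \<le> B1" using test_fun_bounds(1)[OF t] by auto
  obtain B2 where B2: "\<And>x. \<bar>\<psi> x\<bar> \<le> B2" "B2 \<ge> 0" using test_fun_bounds(2)[OF t] by (auto simp: \<psi>_def)
  have ftc: "(LBINT r. indicator {r1..r2} r *\<^sub>R (\<psi> (r *\<^sub>R y) / r)) = \<phi> (r2 *\<^sub>R y) - \<phi> (r1 *\<^sub>R y)" for y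
  proof (rule integral_FTC_atLeastAtMost[OF r(2)])
    fix x assume x: "r1 \<le> x" "x \<le> r2"
    have "(\<phi> has_derivative blinfun_apply (\<phi>' (x *\<^sub>R y))) (at (x *\<^sub>R y))"
      using t by (auto simp: test_fun_def)
    from has_derivative_compose[OF has_derivative_scaleR_left[OF has_derivative_ident] this]
    have "((\<lambda>x. \<phi> (x *\<^sub>R y)) has_derivative (\<lambda>h. blinfun_apply (\<phi>' (x *\<^sub>R y)) (h *\<^sub>R y))) (at x within {r1..r2})"
      by simp
    then show "((\<lambda>x. \<phi> (x *\<^sub>R y)) has_vector_derivative \<psi> (x *\<^sub>R y) / x) (at x within {r1..r2})"
      using x r by (simp add: has_vector_derivative_def \<psi>_def blinfun.bilinear_simps)
  next
    show "continuous_on {r1..r2} (\<lambda>r. \<psi> (r *\<^sub>R y) / r)"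
      using r by (intro continuous_intros continuous_on_compose2[OF c\<psi>]) auto
  qed
  let ?f = "\<lambda>y r. u y * (indicator {r1..r2} r * (\<psi> (r *\<^sub>R y) / r))"
  have bnd: "\<bar>indicator {r1..r2} r * (\<psi> (r *\<^sub>R y) / r)\<bar> \<le> indicator {r1..r2} r * (B2 / r1)" for r y
    using r B2 by (auto simp: indicator_def abs_mult abs_divide intro!: frac_le)
  have ib: "integrable lborel (\<lambda>r. indicator {r1..r2} r * (B2 / r1))"
    by (intro integrable_mult_left) (use r in \<open>auto simp: integrable_indicator_iff\<close>)
  have prod: "integrable (lborel \<Otimes>\<^sub>M lborel) (case_prod ?f)"
    by (rule integrable_tensor_bound[OF ui ib _ bnd]) measurable
  have i: "integrable lborel (\<lambda>y. u y * \<phi> (r *\<^sub>R y))" for r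
    by (intro integrable_density_mult[OF ui _ B1]) measurable
  have "(LBINT y. u y * \<phi> (r2 *\<^sub>R y)) - (LBINT y. u y * \<phi> (r1 *\<^sub>R y))
      = (LBINT y. u y * (\<phi> (r2 *\<^sub>R y) - \<phi> (r1 *\<^sub>R y)))"
    using i by (simp add: right_diff_distrib)
  also have "\<dots> = (LBINT y. (LBINT r. ?f y r))"
    by (simp only: ftc[unfolded real_scaleR_def] integral_mult_right_zero)
  also have "\<dots> = (LBINT r. (LBINT y. ?f y r))"
    by (rule lborel_pair.Fubini_integral[OF prod, symmetric])
  also have "\<dots> = (LBINT r. indicator {r1..r2} r * (\<epsilon> powr (- a) / r * jump_functional u J \<epsilon> \<phi> r))"
  proof (intro Bochner_Integration.integral_cong refl)
    fix r
    show "(LBINT y. ?f y r) = indicator {r1..r2} r * (\<epsilon> powr (- a) / r * jump_functional u J \<epsilon> \<phi> r)"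
    proof (cases "r \<in> {r1..r2}")
      case True
      then have "r > 0" using r by auto
      have "(LBINT y. ?f y r) = (LBINT y. u y * \<psi> (r *\<^sub>R y)) / r"
        using True by (simp add: field_simps)
      then show ?thesis
        using True equilibrium_dilated[OF eq J \<open>\<epsilon> > 0\<close> t \<open>r > 0\<close>] by (simp add: \<psi>_def)
    qed simp
  qed
  finally show ?thesis .
qed

section \<open>Plane waves as limits of test functions\<close>

lemma pos_part_square_derivative:
  "((\<lambda>t::real. (max 0 t)\<^sup>2) has_real_derivative 2 * max 0 t) (at t)"
proof -
  consider "t > 0" | "t < 0" | "t = 0" by linarith
  then show ?thesis
  proof cases
    case 1
    have "((\<lambda>t::real. t\<^sup>2) has_real_derivative 2 * max 0 t) (at t)"
      using 1 by (auto intro!: derivative_eq_intros)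
    then show ?thesis
      by (rule has_field_derivative_transform_within_open[where S="{0<..}"]) (use 1 in auto)
  next
    case 2
    have "((\<lambda>t::real. 0) has_real_derivative 2 * max 0 t) (at t)"
      using 2 by (auto intro!: derivative_eq_intros)
    then show ?thesis
      by (rule has_field_derivative_transform_within_open[where S="{..<0}"]) (use 2 in auto)
  next
    case 3
    have "(\<lambda>h::real. (max 0 h)\<^sup>2 / h) \<midarrow>0\<rightarrow> 0"
    proof (rule Lim_null_comparison)
      show "(\<lambda>h::real. \<bar>h\<bar>) \<midarrow>0\<rightarrow> 0" by (intro tendsto_rabs_zero tendsto_ident_at)
      show "\<forall>\<^sub>F h::real in at 0. norm ((max 0 h)\<^sup>2 / h) \<le> \<bar>h\<bar>"
        by (intro always_eventually allI) (auto simp: max_def power2_eq_square)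
    qed
    then show ?thesis using 3 by (simp add: DERIV_def)
  qed
qed

text \<open>Test functions are real, C^1 and of bounded support. Squaring the positive part makes
  the cutoff C^1, and the phase c replaces complex exponentials: c = 0 and c = pi/2 give the cosine
  and minus the sine.\<close>

definition cutoff_wave :: "real \<Rightarrow> 'a::euclidean_space \<Rightarrow> real \<Rightarrow> 'a \<Rightarrow> real" where
  "cutoff_wave n \<xi> c x = (max 0 (1 - (norm x)\<^sup>2 / n\<^sup>2))\<^sup>2 * cos (x \<bullet> \<xi> + c)"

lemma test_fun_cutoff_wave:
  fixes \<xi> :: "'a::euclidean_space"
  assumes "n > 0"
  shows "\<exists>\<phi>'. test_fun (cutoff_wave n \<xi> c) \<phi>'"
proof -
  define q where "q = (\<lambda>x::'a. 1 - (norm x)\<^sup>2 / n\<^sup>2)"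
  \<comment> \<open>The gradient of the wave, which \<open>blinfun_inner_left\<close> turns into the
    required bounded functional.\<close>
  define G where "G = (\<lambda>x. (2 * max 0 (q x) * cos (x \<bullet> \<xi> + c) * (- 2 / n\<^sup>2)) *\<^sub>R x
                    - ((max 0 (q x))\<^sup>2 * sin (x \<bullet> \<xi> + c)) *\<^sub>R \<xi>)"
  have cw: "cutoff_wave n \<xi> c = (\<lambda>x. (max 0 (q x))\<^sup>2 * cos (x \<bullet> \<xi> + c))"
    by (simp add: fun_eq_iff cutoff_wave_def q_def)
  have q: "(q has_derivative (\<lambda>h. - 2 / n\<^sup>2 * (x \<bullet> h))) (at x)" for x
    unfolding q_def power2_norm_eq_inner divide_inverse
    by (rule derivative_eq_intros refl ext)+ (simp add: inner_commute)
  have m: "((\<lambda>x. (max 0 (q x))\<^sup>2) has_derivative (\<lambda>h. 2 * max 0 (q x) * (- 2 / n\<^sup>2 * (x \<bullet> h)))) (at x)" for x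
    using has_derivative_compose[OF q pos_part_square_derivative[unfolded has_field_derivative_def]]
    by simp
  have "((\<lambda>x. cos (x \<bullet> \<xi> + c)) has_derivative (\<lambda>h. - sin (x \<bullet> \<xi> + c) * (h \<bullet> \<xi>))) (at x)" for x
    by (auto intro!: derivative_eq_intros)
  from has_derivative_mult[OF m this]
  have "(cutoff_wave n \<xi> c has_derivative (\<lambda>h. h \<bullet> G x)) (at x)" for x
    unfolding cw
    by (rule has_derivative_eq_rhs) (auto simp: G_def inner_diff_right algebra_simps inner_commute)
  then have 1: "(cutoff_wave n \<xi> c has_derivative blinfun_apply (blinfun_inner_left (G x))) (at x)" for x
    by simp
  have "continuous_on UNIV q" unfolding q_def using assms by (intro continuous_intros) auto
  then have "continuous_on UNIV G" unfolding G_def by (intro continuous_intros)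
  then have 2: "continuous_on UNIV (\<lambda>x. blinfun_inner_left (G x))"
    by (intro continuous_intros)
  have "bounded {x. cutoff_wave n \<xi> c x \<noteq> 0}"
    unfolding bounded_iff
  proof (intro exI[of _ n] ballI)
    fix x assume "x \<in> {x. cutoff_wave n \<xi> c x \<noteq> 0}"
    then have "max 0 (1 - (norm x)\<^sup>2 / n\<^sup>2) \<noteq> 0" unfolding cutoff_wave_def by auto
    then have "(norm x)\<^sup>2 / n\<^sup>2 < 1" by linarith
    then have "(norm x)\<^sup>2 < n\<^sup>2" using assms by (simp add: field_simps)
    then show "norm x \<le> n" using assms by (meson less_eq_real_def power_less_imp_less_base)
  qed
  then show ?thesis
    unfolding test_fun_def using 1 2 by (intro exI[of _ "\<lambda>x. blinfun_inner_left (G x)"]) auto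
qed

lemma cutoff_wave_measurable [measurable]: "cutoff_wave n \<xi> c \<in> borel_measurable borel"
  unfolding cutoff_wave_def[abs_def] by measurable

lemma cutoff_wave_le_1: "\<bar>cutoff_wave n \<xi> c x\<bar> \<le> 1"
proof -
  have "0 \<le> max 0 (1 - (norm x)\<^sup>2 / n\<^sup>2)" "max 0 (1 - (norm x)\<^sup>2 / n\<^sup>2) \<le> 1" by auto
  then have "\<bar>(max 0 (1 - (norm x)\<^sup>2 / n\<^sup>2))\<^sup>2\<bar> \<le> 1" by (simp add: power_le_one)
  then show ?thesis unfolding cutoff_wave_def abs_mult
    by (intro mult_le_one) auto
qed

lemma cutoff_wave_tendsto: "(\<lambda>n. cutoff_wave (real n) \<xi> c x) \<longlonglongrightarrow> cos (x \<bullet> \<xi> + c)"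
proof -
  have "(\<lambda>n. (norm x)\<^sup>2 * inverse (real n) ^ 2) \<longlonglongrightarrow> (norm x)\<^sup>2 * 0 ^ 2"
    by (intro tendsto_intros lim_inverse_n)
  then have "(\<lambda>n. (norm x)\<^sup>2 / (real n)\<^sup>2) \<longlonglongrightarrow> 0" by (simp add: field_simps)
  then have "(\<lambda>n. (max 0 (1 - (norm x)\<^sup>2 / (real n)\<^sup>2))\<^sup>2 * cos (x \<bullet> \<xi> + c))
      \<longlonglongrightarrow> (max 0 (1 - 0))\<^sup>2 * cos (x \<bullet> \<xi> + c)"
    by (intro tendsto_intros)
  then show ?thesis by (simp add: cutoff_wave_def)
qed

text \<open>Dominated convergence as the cutoff radius tends to infinity. The cutoff waves are
  bounded by 1, so the integrands are dominated by multiples of u and J, and the integral in r runs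
  over a bounded interval away from 0.\<close>

lemma equilibrium_wave_increment:
  fixes u J :: "'a::euclidean_space \<Rightarrow> real"
  assumes eq: "equilibrium J a \<epsilon> u" and J: "prob_density J" and "\<epsilon> > 0"
    and r: "0 < r1" "r1 \<le> r2"
  shows "(LBINT y. u y * cos (r2 *\<^sub>R y \<bullet> \<xi> + c)) - (LBINT y. u y * cos (r1 *\<^sub>R y \<bullet> \<xi> + c))
       = (LBINT r. indicator {r1..r2} r *
            (\<epsilon> powr (- a) / r * jump_functional u J \<epsilon> (\<lambda>x. cos (x \<bullet> \<xi> + c)) r))"
proof -
  have u: "prob_density u" using eq by (simp add: equilibrium_def)
  have ui: "integrable lborel u" and Ji: "integrable lborel J"
    using u J by (auto simp: prob_density_def)
  have [measurable]: "u \<in> borel_measurable borel" "J \<in> borel_measurable borel"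
    using ui Ji by auto
  have upos: "u y \<ge> 0" "J y \<ge> 0" for y using u J by (auto simp: prob_density_def)
  \<comment> \<open>\<open>Suc\<close> keeps the radius positive, as
    \<open>test_fun_cutoff_wave\<close> requires.\<close>
  define P where "P = (\<lambda>n. cutoff_wave (real (Suc n)) \<xi> c)"
  have P1: "\<bar>P n x\<bar> \<le> 1" for n x by (simp add: P_def cutoff_wave_le_1)
  have P_lim: "(\<lambda>n. P n x) \<longlonglongrightarrow> cos (x \<bullet> \<xi> + c)" for x
    unfolding P_def by (rule LIMSEQ_Suc[OF cutoff_wave_tendsto])
  have [measurable]: "P n \<in> borel_measurable borel" for n by (simp add: P_def)
  have lim1: "(\<lambda>n. \<integral>y. u y * P n (r *\<^sub>R y) \<partial>lborel) \<longlonglongrightarrow> (LBINT y. u y * cos (r *\<^sub>R y \<bullet> \<xi> + c))" for r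
  proof (rule integral_dominated_convergence[where w=u])
    show "AE y in lborel. (\<lambda>n. u y * P n (r *\<^sub>R y)) \<longlonglongrightarrow> u y * cos (r *\<^sub>R y \<bullet> \<xi> + c)"
      by (intro AE_I2 tendsto_intros P_lim)
    show "AE y in lborel. norm (u y * P n (r *\<^sub>R y)) \<le> u y" for n
      using P1 upos by (intro AE_I2) (auto simp: abs_mult mult_left_le)
  qed (use ui in auto)
  have lim2: "(\<lambda>n. \<integral>w. J w * P n (g w) \<partial>lborel) \<longlonglongrightarrow> (LBINT w. J w * cos (g w \<bullet> \<xi> + c))"
    if [measurable]: "g \<in> borel_measurable borel" for g
  proof (rule integral_dominated_convergence[where w=J])
    show "AE y in lborel. (\<lambda>n. J y * P n (g y)) \<longlonglongrightarrow> J y * cos (g y \<bullet> \<xi> + c)"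
      by (intro AE_I2 tendsto_intros P_lim)
    show "AE y in lborel. norm (J y * P n (g y)) \<le> J y" for n
      using P1 upos by (intro AE_I2) (auto simp: abs_mult mult_left_le)
  qed (use Ji in auto)
  have av: "\<bar>(LBINT w. J w * P n (g w)) - P n x\<bar> \<le> 2" for n x and g :: "'a \<Rightarrow> 'a"
  proof -
    have "\<bar>\<integral>w. J w * P n (g w) \<partial>lborel\<bar> \<le> 1" by (rule abs_average_le[OF J P1])
    then show ?thesis using P1[of n x] by linarith
  qed
  have lim3: "(\<lambda>n. jump_functional u J \<epsilon> (P n) r) \<longlonglongrightarrow> jump_functional u J \<epsilon> (\<lambda>x. cos (x \<bullet> \<xi> + c)) r" for r
    unfolding jump_functional_def
  proof (rule integral_dominated_convergence[where w="\<lambda>y. u y * 2"])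
    show "AE y in lborel. (\<lambda>n. u y * ((LBINT w. J w * P n (r *\<^sub>R (y + \<epsilon> *\<^sub>R w))) - P n (r *\<^sub>R y)))
      \<longlonglongrightarrow> u y * ((LBINT w. J w * cos (r *\<^sub>R (y + \<epsilon> *\<^sub>R w) \<bullet> \<xi> + c)) - cos (r *\<^sub>R y \<bullet> \<xi> + c))"
      by (intro AE_I2 tendsto_intros P_lim lim2) measurable
    show "AE y in lborel. norm (u y * ((LBINT w. J w * P n (r *\<^sub>R (y + \<epsilon> *\<^sub>R w))) - P n (r *\<^sub>R y))) \<le> u y * 2" for n
      using av upos by (intro AE_I2) (auto simp: abs_mult intro!: mult_left_mono)
  qed (use ui in auto)
  have jb: "\<bar>jump_functional u J \<epsilon> (P n) r\<bar> \<le> 2" for n r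
    unfolding jump_functional_def by (rule abs_average_le[OF u, where g="\<lambda>x. x"]) (rule av)
  have [measurable]: "jump_functional u J \<epsilon> (P n) \<in> borel_measurable borel" for n
    by (rule jump_functional_measurable) auto
  have [measurable]: "jump_functional u J \<epsilon> (\<lambda>x. cos (x \<bullet> \<xi> + c)) \<in> borel_measurable borel"
    by (rule jump_functional_measurable) auto
  have lim4: "(\<lambda>n. \<integral>r. indicator {r1..r2} r * (\<epsilon> powr (- a) / r * jump_functional u J \<epsilon> (P n) r) \<partial>lborel)
     \<longlonglongrightarrow> (LBINT r. indicator {r1..r2} r *
            (\<epsilon> powr (- a) / r * jump_functional u J \<epsilon> (\<lambda>x. cos (x \<bullet> \<xi> + c)) r))"
  proof (rule integral_dominated_convergence[where w="\<lambda>r. indicator {r1..r2} r * (\<epsilon> powr (- a) / r1 * 2)"])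
    show "integrable lborel (\<lambda>r. indicator {r1..r2} r * (\<epsilon> powr (- a) / r1 * 2))"
      by (intro integrable_mult_left) (use r in \<open>auto simp: integrable_indicator_iff\<close>)
    show "AE r in lborel. (\<lambda>n. indicator {r1..r2} r * (\<epsilon> powr (- a) / r * jump_functional u J \<epsilon> (P n) r))
       \<longlonglongrightarrow> indicator {r1..r2} r * (\<epsilon> powr (- a) / r * jump_functional u J \<epsilon> (\<lambda>x. cos (x \<bullet> \<xi> + c)) r)"
      by (intro AE_I2 tendsto_intros lim3)
    have "norm (indicator {r1..r2} r * (\<epsilon> powr (- a) / r * jump_functional u J \<epsilon> (P n) r))
        \<le> indicator {r1..r2} r * (\<epsilon> powr (- a) / r1 * 2)" for n r
    proof (cases "r \<in> {r1..r2}")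
      case True
      then have "\<epsilon> powr (- a) / r * \<bar>jump_functional u J \<epsilon> (P n) r\<bar> \<le> \<epsilon> powr (- a) / r1 * 2"
        using jb[of n r] r by (intro mult_mono frac_le) auto
      then show ?thesis using True r by (simp add: abs_mult)
    qed auto
    then show "AE r in lborel. norm (indicator {r1..r2} r * (\<epsilon> powr (- a) / r * jump_functional u J \<epsilon> (P n) r))
        \<le> indicator {r1..r2} r * (\<epsilon> powr (- a) / r1 * 2)" for n
      by (intro AE_I2)
  qed measurable
  have "\<exists>\<phi>'. test_fun (P n) \<phi>'" for n unfolding P_def by (rule test_fun_cutoff_wave) simp
  then have "(LBINT y. u y * P n (r2 *\<^sub>R y)) - (LBINT y. u y * P n (r1 *\<^sub>R y))
       = (LBINT r. indicator {r1..r2} r * (\<epsilon> powr (- a) / r * jump_functional u J \<epsilon> (P n) r))" for n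
    using equilibrium_test_increment[OF eq J \<open>\<epsilon> > 0\<close> _ r] by metis
  then have "(\<lambda>n. \<integral>r. indicator {r1..r2} r * (\<epsilon> powr (- a) / r * jump_functional u J \<epsilon> (P n) r) \<partial>lborel)
    \<longlonglongrightarrow> (LBINT y. u y * cos (r2 *\<^sub>R y \<bullet> \<xi> + c)) - (LBINT y. u y * cos (r1 *\<^sub>R y \<bullet> \<xi> + c))"
    using tendsto_diff[OF lim1[of r2] lim1[of r1]] by simp
  then show ?thesis by (rule LIMSEQ_unique[OF _ lim4])
qed

section \<open>The transform of an equilibrium\<close>

lemma integral_Re_cis:
  fixes u :: "'a::euclidean_space \<Rightarrow> real"
  assumes "integrable lborel u"
  shows "(LBINT y. u y * Re (z * cis (- (y \<bullet> \<eta>)))) = Re (z * fourier u \<eta>)"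
proof -
  have "Re (z * fourier u \<eta>) = Re (LBINT y. z * (cis (- (y \<bullet> \<eta>)) * complex_of_real (u y)))"
    by (simp add: fourier_def)
  also have "\<dots> = (LBINT y. Re (z * (cis (- (y \<bullet> \<eta>)) * complex_of_real (u y))))"
    by (rule integral_Re[symmetric]) (intro integrable_mult_right fourier_integrable assms)
  also have "\<dots> = (LBINT y. u y * Re (z * cis (- (y \<bullet> \<eta>))))"
    by (rule Bochner_Integration.integral_cong) (simp_all add: algebra_simps)
  finally show ?thesis by simp
qed

lemma integral_cos_shift:
  fixes u :: "'a::euclidean_space \<Rightarrow> real"
  assumes "integrable lborel u"
  shows "(LBINT y. u y * cos (y \<bullet> \<eta> + c)) = Re (cis (- c) * fourier u \<eta>)"
proof -
  have "cos (y \<bullet> \<eta> + c) = Re (cis (- c) * cis (- (y \<bullet> \<eta>)))" for y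
    by (simp only: cis_mult Re_complex_of_real cis.sel) (metis cos_minus minus_add_distrib add.commute)
  then show ?thesis using integral_Re_cis[OF assms] by (simp only:)
qed

text \<open>Plane waves diagonalise convolution: averaging over the jump \<epsilon> w multiplies the
  wave by the transform of J at \<epsilon> r \<xi>, and integration against u then produces the
  transform of u at r \<xi>.\<close>

lemma jump_functional_wave:
  fixes u J :: "'a::euclidean_space \<Rightarrow> real"
  assumes u: "integrable lborel u" and J: "prob_density J"
  shows "jump_functional u J \<epsilon> (\<lambda>x. cos (x \<bullet> \<xi> + c)) r
     = Re (cis (- c) * ((fourier J ((\<epsilon> * r) *\<^sub>R \<xi>) - 1) * fourier u (r *\<^sub>R \<xi>)))"
proof -
  have Ji: "integrable lborel J" using J by (simp add: prob_density_def)
  define p where "p = fourier J ((\<epsilon> * r) *\<^sub>R \<xi>)"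
  have "(LBINT w. J w * cos (r *\<^sub>R (y + \<epsilon> *\<^sub>R w) \<bullet> \<xi> + c)) - cos (r *\<^sub>R y \<bullet> \<xi> + c)
     = Re ((cis (- c) * (p - 1)) * cis (- (y \<bullet> (r *\<^sub>R \<xi>))))" for y
  proof -
    have "(LBINT w. J w * cos (r *\<^sub>R (y + \<epsilon> *\<^sub>R w) \<bullet> \<xi> + c))
       = (LBINT w. J w * cos (w \<bullet> ((\<epsilon> * r) *\<^sub>R \<xi>) + (y \<bullet> (r *\<^sub>R \<xi>) + c)))"
      by (simp add: inner_add_left algebra_simps)
    also have "\<dots> = Re (cis (- (y \<bullet> (r *\<^sub>R \<xi>) + c)) * p)"
      unfolding p_def by (rule integral_cos_shift[OF Ji])
    also have "cis (- (y \<bullet> (r *\<^sub>R \<xi>) + c)) = cis (- c) * cis (- (y \<bullet> (r *\<^sub>R \<xi>)))"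
      by (simp only: cis_mult minus_add_distrib add.commute)
    finally have 1: "(LBINT w. J w * cos (r *\<^sub>R (y + \<epsilon> *\<^sub>R w) \<bullet> \<xi> + c))
       = Re (cis (- c) * cis (- (y \<bullet> (r *\<^sub>R \<xi>))) * p)" .
    have "cos (r *\<^sub>R y \<bullet> \<xi> + c) = Re (cis (- c) * cis (- (y \<bullet> (r *\<^sub>R \<xi>))))"
      by (simp only: cis_mult cis.sel) (metis cos_minus minus_add_distrib add.commute inner_scaleR_left inner_scaleR_right)
    with 1 show ?thesis by (simp only: minus_complex.sel(1)[symmetric]) (simp add: algebra_simps)
  qed
  then show ?thesis
    unfolding jump_functional_def
    by (simp only: integral_Re_cis[OF u] p_def) (simp only: mult.assoc)
qed

text \<open>The coefficient q in the equation v' = - q v for v(r) =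
  \<open>fourier u (r *\<^sub>R \<xi>)\<close>.\<close>

definition relax_rate :: "('a::euclidean_space \<Rightarrow> real) \<Rightarrow> real \<Rightarrow> real \<Rightarrow> 'a \<Rightarrow> real \<Rightarrow> complex" where
  "relax_rate J a \<epsilon> \<xi> r = complex_of_real (\<epsilon> powr (- a) / r) * (1 - fourier J ((\<epsilon> * r) *\<^sub>R \<xi>))"

definition log_symbol :: "('a::euclidean_space \<Rightarrow> real) \<Rightarrow> real \<Rightarrow> real \<Rightarrow> 'a \<Rightarrow> complex" where
  "log_symbol J a \<epsilon> \<xi> = integral {0..1} (relax_rate J a \<epsilon> \<xi>)"

lemma fourier_increment:
  fixes u J :: "'a::euclidean_space \<Rightarrow> real"
  assumes eq: "equilibrium J a \<epsilon> u" and J: "prob_density J" and "\<epsilon> > 0"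
    and r: "0 < r1" "r1 \<le> r2"
  shows "((\<lambda>r. - relax_rate J a \<epsilon> \<xi> r * fourier u (r *\<^sub>R \<xi>)) has_integral
           (fourier u (r2 *\<^sub>R \<xi>) - fourier u (r1 *\<^sub>R \<xi>))) {r1..r2}"
proof -
  have ui: "integrable lborel u" and Ji: "integrable lborel J"
    using eq J by (auto simp: prob_density_def equilibrium_def)
  let ?g = "\<lambda>r. - relax_rate J a \<epsilon> \<xi> r * fourier u (r *\<^sub>R \<xi>)"
  have cF: "continuous_on S (\<lambda>r::real. fourier u (r *\<^sub>R \<xi>))"
       "continuous_on S (\<lambda>r::real. fourier J ((\<epsilon> * r) *\<^sub>R \<xi>))" for S
    by (rule continuous_on_compose2[OF continuous_on_fourier[OF ui]]
             continuous_on_compose2[OF continuous_on_fourier[OF Ji]], intro continuous_intros, simp)+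
  have cg: "continuous_on {r1..r2} ?g"
    unfolding relax_rate_def using r by (intro continuous_intros cF) auto
  have *: "((\<lambda>r. Re (cis (- c) * ?g r)) has_integral
       Re (cis (- c) * (fourier u (r2 *\<^sub>R \<xi>) - fourier u (r1 *\<^sub>R \<xi>)))) {r1..r2}" for c
  proof -
    let ?h = "\<lambda>r. Re (cis (- c) * ?g r)"
    have ch: "continuous_on {r1..r2} ?h"
      by (intro continuous_on_Re continuous_on_mult continuous_on_const cg)
    have h: "\<epsilon> powr (- a) / r * jump_functional u J \<epsilon> (\<lambda>x. cos (x \<bullet> \<xi> + c)) r = ?h r" for r
    proof -
      define k where "k = \<epsilon> powr (- a) / r"
      have Re_scale: "k * Re z = Re (complex_of_real k * z)" for z by simp
      show ?thesis
        unfolding jump_functional_wave[OF ui J] Re_scale relax_rate_def k_def[symmetric]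
        by (rule arg_cong[where f=Re]) (simp add: algebra_simps)
    qed
    have L: "(LBINT y. u y * cos (s *\<^sub>R y \<bullet> \<xi> + c)) = Re (cis (- c) * fourier u (s *\<^sub>R \<xi>))" for s
      using integral_cos_shift[OF ui, of "s *\<^sub>R \<xi>" c] by simp
    have "Re (cis (- c) * fourier u (r2 *\<^sub>R \<xi>)) - Re (cis (- c) * fourier u (r1 *\<^sub>R \<xi>))
      = (LINT r:{r1..r2}|lborel. ?h r)"
      using equilibrium_wave_increment[OF eq J \<open>\<epsilon> > 0\<close> r, of \<xi> c]
      by (simp only: L h set_lebesgue_integral_def real_scaleR_def)
    also have "\<dots> = integral {r1..r2} ?h"
      by (rule set_borel_integral_eq_integral(2)[OF borel_integrable_atLeastAtMost'[OF ch]])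
    finally have "integral {r1..r2} ?h = Re (cis (- c) * (fourier u (r2 *\<^sub>R \<xi>) - fourier u (r1 *\<^sub>R \<xi>)))"
      by (simp add: algebra_simps)
    then show ?thesis
      using integrable_integral[OF integrable_continuous_interval[OF ch]] by (simp only:)
  qed
  have "((\<lambda>r. Re (?g r)) has_integral Re (fourier u (r2 *\<^sub>R \<xi>) - fourier u (r1 *\<^sub>R \<xi>))) {r1..r2}"
    using *[of 0] by simp
  \<comment> \<open>For c = pi/2 the factor \<open>cis (- c)\<close> is -i, and Re (-i z) = Im
    z.\<close>
  moreover have "((\<lambda>r. Im (?g r)) has_integral Im (fourier u (r2 *\<^sub>R \<xi>) - fourier u (r1 *\<^sub>R \<xi>))) {r1..r2}"
    using *[of "pi/2"] by simp
  ultimately have "((\<lambda>r. complex_of_real (Re (?g r)) + \<i> * complex_of_real (Im (?g r))) has_integral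
      complex_of_real (Re (fourier u (r2 *\<^sub>R \<xi>) - fourier u (r1 *\<^sub>R \<xi>)))
      + \<i> * complex_of_real (Im (fourier u (r2 *\<^sub>R \<xi>) - fourier u (r1 *\<^sub>R \<xi>)))) {r1..r2}"
    by (intro has_integral_add has_integral_mult_right)
       (auto dest!: has_integral_linear[OF _ bounded_linear_of_real] simp: o_def)
  then show ?thesis by (simp only: complex_eq[symmetric])
qed

lemma norm_1_minus_fourier_le_2: "prob_density f \<Longrightarrow> norm (1 - fourier f \<xi>) \<le> 2"
  using norm_triangle_ineq4[of 1 "fourier f \<xi>"] norm_fourier_le_1[of f \<xi>] by simp

text \<open>The factor \<epsilon> powr (- a) cancels against the power a of |\<epsilon> r \<xi>|, so
  whatever is derived from this bound is uniform in \<epsilon>.\<close>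

lemma norm_relax_rate_le:
  fixes J :: "'a::euclidean_space \<Rightarrow> real"
  assumes M: "\<And>\<eta>. norm (1 - fourier J \<eta>) \<le> M * norm \<eta> powr a" and "\<epsilon> > 0" "r \<ge> 0"
  shows "norm (relax_rate J a \<epsilon> \<xi> r) \<le> M * norm \<xi> powr a * r powr (a - 1)"
proof (cases "r = 0")
  case False
  then have "r > 0" using assms by simp
  have "norm (relax_rate J a \<epsilon> \<xi> r) = \<epsilon> powr (- a) / r * norm (1 - fourier J ((\<epsilon> * r) *\<^sub>R \<xi>))"
    using \<open>r > 0\<close> by (simp add: relax_rate_def norm_mult norm_divide)
  also have "\<dots> \<le> \<epsilon> powr (- a) / r * (M * norm ((\<epsilon> * r) *\<^sub>R \<xi>) powr a)"
    using \<open>r > 0\<close> by (intro mult_left_mono M) auto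
  also have "\<dots> = M * norm \<xi> powr a * r powr (a - 1)"
    using \<open>r > 0\<close> \<open>\<epsilon> > 0\<close> by (simp add: abs_mult powr_mult powr_minus powr_diff field_simps)
  finally show ?thesis .
next
  case True
  have "0 \<le> M * norm \<xi> powr a" using M[of \<xi>] norm_ge_zero order_trans by blast
  then show ?thesis using True by (simp add: relax_rate_def)
qed

lemma continuous_on_relax_rate:
  fixes J :: "'a::euclidean_space \<Rightarrow> real"
  assumes J: "prob_density J" and M: "\<And>\<eta>. norm (1 - fourier J \<eta>) \<le> M * norm \<eta> powr a"
    and "\<epsilon> > 0" "a > 1"
  shows "continuous_on {0..} (relax_rate J a \<epsilon> \<xi>)"
  unfolding continuous_on_eq_continuous_within
proof
  fix r :: real assume "r \<in> {0..}"
  have Ji: "integrable lborel J" using J by (auto simp: prob_density_def)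
  show "continuous (at r within {0..}) (relax_rate J a \<epsilon> \<xi>)"
  proof (cases "r = 0")
    case False
    have "continuous_on {0<..} (relax_rate J a \<epsilon> \<xi>)"
      unfolding relax_rate_def
      by (intro continuous_intros continuous_on_compose2[OF continuous_on_fourier[OF Ji]]) auto
    then have "isCont (relax_rate J a \<epsilon> \<xi>) r"
      using False \<open>r \<in> {0..}\<close> by (subst (asm) continuous_on_eq_continuous_at) auto
    then show ?thesis by (rule continuous_at_imp_continuous_at_within)
  next
    case True
    have "((\<lambda>r::real. M * norm \<xi> powr a * r powr (a - 1)) \<longlongrightarrow> M * norm \<xi> powr a * 0) (at 0 within {0..})"
    proof (intro tendsto_intros)
      have "((\<lambda>r::real. r powr (a - 1)) \<longlongrightarrow> 0 powr (a - 1)) (at 0 within {0..})"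
        using \<open>a > 1\<close> by (intro tendsto_powr') (auto intro!: tendsto_intros simp: eventually_at_filter)
      then show "((\<lambda>r::real. r powr (a - 1)) \<longlongrightarrow> 0) (at 0 within {0..})" by simp
    qed
    then have "((relax_rate J a \<epsilon> \<xi>) \<longlongrightarrow> 0) (at 0 within {0..})"
      by (rule Lim_null_comparison[rotated, OF tendsto_eq_rhs])
         (auto simp: eventually_at_filter intro!: always_eventually norm_relax_rate_le[OF M \<open>\<epsilon> > 0\<close>])
    then show ?thesis using True by (simp add: continuous_within relax_rate_def)
  qed
qed

text \<open>Along a ray the transform of the equilibrium solves a linear ODE whose rate is bounded at
  \<open>0\<close> because \<open>a > 1\<close>; \<open>relax_rate\<close> takes the junk value \<open>0\<close> at \<open>r = 0\<close>, which is its limit there.\<close>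

lemma fourier_equilibrium:
  fixes u J :: "'a::euclidean_space \<Rightarrow> real"
  assumes eq: "equilibrium J a \<epsilon> u" and J: "prob_density J"
    and M: "\<And>\<eta>. norm (1 - fourier J \<eta>) \<le> M * norm \<eta> powr a"
    and "\<epsilon> > 0" "a > 1"
  shows "fourier u \<xi> = exp (- log_symbol J a \<epsilon> \<xi>)"
proof -
  have u: "prob_density u" using eq by (simp add: equilibrium_def)
  then have ui: "integrable lborel u" by (auto simp: prob_density_def)
  define q where "q = relax_rate J a \<epsilon> \<xi>"
  define v where "v = (\<lambda>r::real. fourier u (r *\<^sub>R \<xi>))"
  have cq: "continuous_on {0..} q" unfolding q_def by (rule continuous_on_relax_rate[OF J M \<open>\<epsilon> > 0\<close> \<open>a > 1\<close>])
  have cv: "continuous_on S v" for S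
    unfolding v_def by (rule continuous_on_compose2[OF continuous_on_fourier[OF ui]], intro continuous_intros, simp)
  define Q where "Q = (\<lambda>r. integral {0..r} q)"
  have Q': "(Q has_vector_derivative q x) (at x)" if "0 < x" for x
  proof -
    have "(Q has_vector_derivative q x) (at x within {0..2 * x})"
      unfolding Q_def by (rule integral_has_vector_derivative[OF continuous_on_subset[OF cq]]) (use that in auto)
    then show ?thesis using that by (simp add: at_within_Icc_at)
  qed
  have v': "(v has_vector_derivative - q x * v x) (at x)" if "0 < x" for x
  proof -
    \<comment> \<open>The increments of v are integrals of a continuous function, hence v is
      differentiable. The base point x/2 stays in the range r > 0 covered by
      \<open>fourier_increment\<close>.\<close>
    define I where "I = (\<lambda>y. integral {x/2..y} (\<lambda>r. - q r * v r))"
    have "(I has_vector_derivative - q x * v x) (at x within {x/2..2 * x})"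
      unfolding I_def using that
      by (intro integral_has_vector_derivative continuous_intros cv continuous_on_subset[OF cq]) auto
    then have "((\<lambda>y. v (x/2) + I y) has_vector_derivative - q x * v x) (at x within {x/2..2 * x})"
      by (auto intro!: derivative_eq_intros)
    then have "(v has_vector_derivative - q x * v x) (at x within {x/2..2 * x})"
    proof (rule has_vector_derivative_transform[rotated 2])
      fix y assume "y \<in> {x/2..2*x}"
      then show "v y = v (x/2) + I y"
        using integral_unique[OF fourier_increment[OF eq J \<open>\<epsilon> > 0\<close>, of "x/2" y \<xi>]] that
        by (simp add: I_def q_def v_def)
    qed (use that in auto)
    then show ?thesis using that by (simp add: at_within_Icc_at)
  qed
  \<comment> \<open>Integrating factor. Differentiability of w is available only for r > 0, so its
    constancy on [0, 1] comes from a criterion with exceptional set {0} and continuity up to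
    0.\<close>
  define w where "w = (\<lambda>r. v r * exp (Q r))"
  have "w 1 = w 0"
  proof (rule has_derivative_zero_unique_strong_convex[where S="{0..1}" and K="{0}" and f=w and c=0])
    have "continuous_on {0..1} Q"
      unfolding Q_def
      by (rule indefinite_integral_continuous_1[OF integrable_continuous_interval[OF continuous_on_subset[OF cq]]]) auto
    then show "continuous_on {0..1} w" unfolding w_def by (intro continuous_intros cv)
    fix x :: real assume "x \<in> {0..1} - {0}"
    then have "x > 0" by auto
    have "((\<lambda>r. exp (Q r)) has_vector_derivative q x * exp (Q x)) (at x)"
      using field_vector_diff_chain_at[OF Q'[OF \<open>x > 0\<close>] DERIV_exp] by (simp add: o_def)
    from has_vector_derivative_mult[OF v'[OF \<open>x > 0\<close>] this]
    have "(w has_vector_derivative 0) (at x)"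
      by (simp add: w_def algebra_simps)
    then show "(w has_derivative (\<lambda>h. 0)) (at x within {0..1})"
      by (auto simp: has_vector_derivative_def intro: has_derivative_at_withinI)
  qed auto
  moreover have "w 0 = 1" using fourier_0[OF u] by (simp add: w_def v_def Q_def)
  ultimately have "fourier u \<xi> * exp (log_symbol J a \<epsilon> \<xi>) = 1"
    by (simp add: w_def v_def Q_def q_def log_symbol_def)
  then show ?thesis by (simp add: exp_minus field_simps)
qed

section \<open>Bounding the \<open>L^1\<close> norm on balls by the \<open>L^2\<close> norm of the transform\<close>

lemma integrable_tensor_kernel:
  fixes f :: "'a::euclidean_space \<Rightarrow> complex" and g :: "'b::euclidean_space \<Rightarrow> complex"
    and \<kappa> :: "'a \<Rightarrow> 'b \<Rightarrow> complex"
  assumes f: "integrable lborel f" and g: "integrable lborel g"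
    and [measurable]: "case_prod \<kappa> \<in> borel_measurable (borel \<Otimes>\<^sub>M borel)"
    and \<kappa>: "\<And>y z. norm (\<kappa> y z) \<le> 1"
  shows "integrable (lborel \<Otimes>\<^sub>M lborel) (\<lambda>(y, z). f y * (g z * \<kappa> y z))"
proof (rule lborel_pair.Fubini_integrable)
  have [measurable]: "f \<in> borel_measurable borel" "g \<in> borel_measurable borel" using f g by auto
  show "(\<lambda>(y, z). f y * (g z * \<kappa> y z)) \<in> borel_measurable (lborel \<Otimes>\<^sub>M lborel)"
    by measurable
  have i: "integrable lborel (\<lambda>z. g z * \<kappa> y z)" for y
    by (rule Bochner_Integration.integrable_bound[OF g])
       (use \<kappa> in \<open>auto simp: norm_mult mult_left_le\<close>)
  show "AE y in lborel. integrable lborel (\<lambda>z. case (y, z) of (y, z) \<Rightarrow> f y * (g z * \<kappa> y z))"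
    by (intro AE_I2) (simp only: prod.case integrable_mult_right[OF i])
  show "integrable lborel (\<lambda>y. \<integral>z. norm (case (y, z) of (y, z) \<Rightarrow> f y * (g z * \<kappa> y z)) \<partial>lborel)"
  proof (rule Bochner_Integration.integrable_bound)
    show "integrable lborel (\<lambda>y. norm (f y) * (LBINT z. norm (g z)))"
      by (intro integrable_mult_left integrable_norm f)
    show "(\<lambda>y. \<integral>z. norm (case (y, z) of (y, z) \<Rightarrow> f y * (g z * \<kappa> y z)) \<partial>lborel) \<in> borel_measurable lborel"
      by measurable
    have "(LBINT z. norm (g z * \<kappa> y z)) \<le> (LBINT z. norm (g z))" for y
      by (intro integral_mono integrable_norm i g) (use \<kappa> in \<open>auto simp: norm_mult mult_left_le\<close>)
    then show "AE y in lborel. norm (LBINT z. norm (case (y, z) of (y, z) \<Rightarrow> f y * (g z * \<kappa> y z)))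
         \<le> norm (norm (f y) * (LBINT z. norm (g z)))"
      by (intro AE_I2) (auto simp: norm_mult intro!: mult_left_mono)
  qed
qed

text \<open>The two variables may live in different spaces: for slab masses one of them is a single
  real variable.\<close>

lemma fubini_phase:
  fixes f :: "'a::euclidean_space \<Rightarrow> complex" and g :: "'b::euclidean_space \<Rightarrow> complex"
    and \<theta> :: "'a \<times> 'b \<Rightarrow> real"
  assumes f: "integrable lborel f" and g: "integrable lborel g" and \<theta>: "continuous_on UNIV \<theta>"
  shows "(LBINT y. f y * (LBINT z. g z * cis (\<theta> (y, z))))
       = (LBINT z. g z * (LBINT y. f y * cis (\<theta> (y, z))))"
    and "integrable lborel (\<lambda>y. f y * (LBINT z. g z * cis (\<theta> (y, z))))"
proof -
  have [measurable]: "f \<in> borel_measurable borel" "g \<in> borel_measurable borel" using f g by auto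
  have "continuous_on UNIV (\<lambda>x. cis (\<theta> x))"
    by (intro continuous_intros \<theta>)
  then have m [measurable]: "(\<lambda>(y, z). cis (\<theta> (y, z))) \<in> borel_measurable (borel \<Otimes>\<^sub>M borel)"
    unfolding borel_prod case_prod_beta prod.collapse by (rule borel_measurable_continuous_onI)
  note int = integrable_tensor_kernel[OF f g m, simplified]
  have "(LBINT y. f y * (LBINT z. g z * cis (\<theta> (y, z))))
      = (LBINT y. (LBINT z. f y * (g z * cis (\<theta> (y, z)))))"
    by simp
  also have "\<dots> = (LBINT z. (LBINT y. f y * (g z * cis (\<theta> (y, z)))))"
    by (rule lborel_pair.Fubini_integral[OF int, symmetric])
  also have "\<dots> = (LBINT z. g z * (LBINT y. f y * cis (\<theta> (y, z))))"
    by (simp add: mult.left_commute[of "f _"])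
  finally show "(LBINT y. f y * (LBINT z. g z * cis (\<theta> (y, z))))
       = (LBINT z. g z * (LBINT y. f y * cis (\<theta> (y, z))))" .
  show "integrable lborel (\<lambda>y. f y * (LBINT z. g z * cis (\<theta> (y, z))))"
    using lborel_pair.integrable_fst[OF int] by simp
qed

lemma fubini_cis:
  fixes f g :: "'a::euclidean_space \<Rightarrow> complex"
  assumes f: "integrable lborel f" and g: "integrable lborel g"
  shows "(LBINT y. f y * (LBINT z. g z * cis (c * (y \<bullet> z))))
       = (LBINT z. g z * (LBINT y. f y * cis (c * (y \<bullet> z))))"
    and "integrable lborel (\<lambda>y. f y * (LBINT z. g z * cis (c * (y \<bullet> z))))"
proof -
  have "continuous_on UNIV (\<lambda>x::'a \<times> 'a. c * (fst x \<bullet> snd x))"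
    by (intro continuous_intros)
  from fubini_phase[OF f g this] show "(LBINT y. f y * (LBINT z. g z * cis (c * (y \<bullet> z))))
       = (LBINT z. g z * (LBINT y. f y * cis (c * (y \<bullet> z))))"
    and "integrable lborel (\<lambda>y. f y * (LBINT z. g z * cis (c * (y \<bullet> z))))"
    by simp_all
qed

section \<open>A Parseval identity for pairings smoothed by a Gaussian\<close>

lemma cnj_fourier:
  fixes f :: "'a::euclidean_space \<Rightarrow> real"
  shows "cnj (fourier f \<xi>) = (LBINT x. cis (x \<bullet> \<xi>) * complex_of_real (f x))"
  unfolding fourier_def by (subst Bochner_Integration.integral_cnj[symmetric]) (simp add: cis_cnj)

text \<open>Pairs f with \<phi> smoothed at scale h. The kernel is not normalised: its mass is of
  order h to the dimension, a power that cancels in \<open>pairing_bound\<close>.\<close>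

definition gauss_pairing :: "real \<Rightarrow> ('a::euclidean_space \<Rightarrow> real) \<Rightarrow> ('a \<Rightarrow> real) \<Rightarrow> real" where
  "gauss_pairing h f \<phi> = (LBINT y. f y * (LBINT x. \<phi> x * gauss ((1/h) *\<^sub>R (y - x))))"

text \<open>Write the Gaussian as a superposition of plane waves with Gaussian weight and exchange
  integrals twice. The weight \<open>gauss z\<close> keeps every double integral absolutely
  convergent, although the transforms of f and \<phi> need not be integrable.\<close>

lemma gauss_pairing_fourier:
  fixes f \<phi> :: "'a::euclidean_space \<Rightarrow> real"
  assumes f: "integrable lborel f" and \<phi>: "integrable lborel \<phi>" and h: "h > 0"
  shows "complex_of_real (sqrt (2 * pi) ^ DIM('a) * gauss_pairing h f \<phi>)
     = (LBINT z. complex_of_real (gauss z) * fourier \<phi> ((1/h) *\<^sub>R z) * cnj (fourier f ((1/h) *\<^sub>R z)))"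
proof -
  have fc: "integrable lborel (\<lambda>x. complex_of_real (f x))" "integrable lborel (\<lambda>x. complex_of_real (\<phi> x))"
    using f \<phi> by auto
  define k where "k = sqrt (2 * pi) ^ DIM('a)"
  have inner: "complex_of_real (k * (LBINT x. \<phi> x * gauss ((1/h) *\<^sub>R (y - x))))
    = (LBINT z. (complex_of_real (gauss z) * fourier \<phi> ((1/h) *\<^sub>R z)) * cis (1/h * (y \<bullet> z)))" for y
  proof -
    have gi: "integrable lborel (\<lambda>z. complex_of_real (gauss z) * cis (1/h * (y \<bullet> z)))"
      using gauss_fourier_aux(1)[of "(1/h) *\<^sub>R y"] by (simp add: inner_commute mult.commute)
    have g: "(LBINT z. complex_of_real (gauss z) * cis (1/h * (y \<bullet> z)) * cis (- (1/h) * (x \<bullet> z)))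
        = complex_of_real (k * gauss ((1/h) *\<^sub>R (y - x)))" for x
    proof -
      have "complex_of_real (gauss z) * cis (1/h * (y \<bullet> z)) * cis (- (1/h) * (x \<bullet> z))
          = cis (z \<bullet> ((1/h) *\<^sub>R (y - x))) * complex_of_real (gauss z)" for z
        by (simp add: mult.assoc cis_mult inner_diff_right right_diff_distrib inner_commute diff_divide_distrib)
      then show ?thesis
        unfolding k_def using gauss_fourier_aux(2)[of "(1/h) *\<^sub>R (y - x)"] by (simp only:)
    qed
    have "complex_of_real (k * (LBINT x. \<phi> x * gauss ((1/h) *\<^sub>R (y - x))))
       = (LBINT x. complex_of_real (k * (\<phi> x * gauss ((1/h) *\<^sub>R (y - x)))))"
      by (simp only: integral_complex_of_real integral_mult_right_zero)
    also have "\<dots> = (LBINT x. complex_of_real (\<phi> x) *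
          (LBINT z. complex_of_real (gauss z) * cis (1/h * (y \<bullet> z)) * cis (- (1/h) * (x \<bullet> z))))"
      unfolding g by (simp add: mult_ac)
    also have "\<dots> = (LBINT z. complex_of_real (gauss z) * cis (1/h * (y \<bullet> z)) *
          (LBINT x. complex_of_real (\<phi> x) * cis (- (1/h) * (x \<bullet> z))))"
      by (rule fubini_cis(1)[OF fc(2) gi])
    also have "(\<lambda>z. \<integral>x. complex_of_real (\<phi> x) * cis (- (1/h) * (x \<bullet> z)) \<partial>lborel) = (\<lambda>z. fourier \<phi> ((1/h) *\<^sub>R z))"
      by (simp add: fourier_def fun_eq_iff mult.commute)
    finally show ?thesis by (simp add: mult_ac)
  qed
  have gp: "integrable lborel (\<lambda>z. complex_of_real (gauss z) * fourier \<phi> ((1/h) *\<^sub>R z))"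
  proof -
    have "integrable lborel (\<lambda>z. complex_of_real (gauss z) * (LBINT x. complex_of_real (\<phi> x) * cis (- (1/h) * (z \<bullet> x))))"
      by (rule fubini_cis(2)) (use fc in auto)
    also have "(\<lambda>z. \<integral>x. complex_of_real (\<phi> x) * cis (- (1/h) * (z \<bullet> x)) \<partial>lborel) = (\<lambda>z. fourier \<phi> ((1/h) *\<^sub>R z))"
      by (simp add: fourier_def fun_eq_iff mult.commute inner_commute)
    finally show ?thesis .
  qed
  have "complex_of_real (k * gauss_pairing h f \<phi>)
     = (LBINT y. complex_of_real (f y) * complex_of_real (k * (LBINT x. \<phi> x * gauss ((1/h) *\<^sub>R (y - x)))))"
    unfolding gauss_pairing_def
    by (subst integral_mult_right_zero[symmetric], subst integral_complex_of_real[symmetric]) (simp add: mult_ac)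
  also have "\<dots> = (LBINT z. complex_of_real (gauss z) * fourier \<phi> ((1/h) *\<^sub>R z) *
       (LBINT y. complex_of_real (f y) * cis (1/h * (y \<bullet> z))))"
    unfolding inner by (rule fubini_cis(1)[OF fc(1) gp])
  also have "(\<lambda>z. \<integral>y. complex_of_real (f y) * cis (1/h * (y \<bullet> z)) \<partial>lborel) = (\<lambda>z. cnj (fourier f ((1/h) *\<^sub>R z)))"
    by (simp add: cnj_fourier fun_eq_iff mult.commute)
  finally show ?thesis by (simp add: k_def)
qed

lemma gauss_average:
  fixes \<phi> :: "'a::euclidean_space \<Rightarrow> real"
  assumes [measurable]: "\<phi> \<in> borel_measurable borel" and "h > 0"
  shows "(LBINT x. \<phi> x * gauss ((1/h) *\<^sub>R (y - x)))
     = h ^ DIM('a) * (LBINT w. \<phi> (y + h *\<^sub>R w) * gauss w)"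
  using lborel_integral_scaleR[of "\<lambda>x. \<phi> x * gauss ((1/h) *\<^sub>R (y - x))" h y] assms by simp

lemma abs_gauss_average_le:
  fixes \<phi> :: "'a::euclidean_space \<Rightarrow> real" and g :: "'a \<Rightarrow> 'a"
  assumes "\<And>x. \<bar>\<phi> x\<bar> \<le> 1"
  shows "\<bar>\<integral>w. \<phi> (g w) * gauss w \<partial>lborel\<bar> \<le> sqrt (2 * pi) ^ DIM('a)"
  unfolding integral_gauss[symmetric, where 'a='a]
  by (rule order_trans[OF integral_abs_bound integral_mono_AE'])
     (use assms in \<open>auto simp: abs_mult mult_left_le_one_le\<close>)

text \<open>Cauchy-Schwarz in \<open>gauss_pairing_fourier\<close>. The transform of f enters
  through K. In the other factor one of two Gaussians is bounded by 1, and the same identity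
  recognises the rest as the pairing of \<phi> with itself, which |\<phi>| \<le> 1 controls by the
  L^1 norm of \<phi>.\<close>

lemma gauss_pairing_bound:
  fixes f \<phi> :: "'a::euclidean_space \<Rightarrow> real"
  assumes f: "integrable lborel f" and \<phi>: "integrable lborel \<phi>" and h: "h > 0"
    and \<phi>1: "\<And>x. \<bar>\<phi> x\<bar> \<le> 1" and K: "(\<integral>\<^sup>+\<xi>. ennreal ((norm (fourier f \<xi>))\<^sup>2) \<partial>lborel) \<le> ennreal K" "K \<ge> 0"
  shows "(gauss_pairing h f \<phi>)\<^sup>2 \<le> (h ^ DIM('a))\<^sup>2 * K * (LBINT x. \<bar>\<phi> x\<bar>)"
proof -
  define k where "k = sqrt (2 * pi) ^ DIM('a)"
  have "k > 0" by (simp add: k_def)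
  have [measurable]: "f \<in> borel_measurable borel" "\<phi> \<in> borel_measurable borel" using f \<phi> by auto
  have [measurable]: "fourier f \<in> borel_measurable borel" "fourier \<phi> \<in> borel_measurable borel"
    by (rule fourier_measurable f \<phi>)+
  let ?F = "\<lambda>z. fourier f ((1/h) *\<^sub>R z)" and ?P = "\<lambda>z. fourier \<phi> ((1/h) *\<^sub>R z)"
  have F: "(\<integral>\<^sup>+z. ennreal ((norm (?F z))\<^sup>2) \<partial>lborel) \<le> ennreal (h ^ DIM('a) * K)"
  proof -
    have "(\<integral>\<^sup>+z. ennreal ((norm (?F z))\<^sup>2) \<partial>lborel)
       = ennreal (h ^ DIM('a)) * (\<integral>\<^sup>+z. ennreal ((norm (fourier f ((1/h) *\<^sub>R (0 + h *\<^sub>R z))))\<^sup>2) \<partial>lborel)"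
      using h by (subst lborel_affine[of h 0]) (auto simp: nn_integral_density nn_integral_distr nn_integral_cmult)
    also have "\<dots> \<le> ennreal (h ^ DIM('a)) * ennreal K"
      using h by (intro mult_left_mono) (auto intro: order_trans[OF _ K(1)])
    finally show ?thesis using h K(2) by (simp add: ennreal_mult)
  qed
  have P: "(\<integral>\<^sup>+z. ennreal ((gauss z * norm (?P z))\<^sup>2) \<partial>lborel) \<le> ennreal (k * (k * h ^ DIM('a) * (LBINT x. \<bar>\<phi> x\<bar>)))"
  proof -
    have int: "integrable lborel (\<lambda>z. gauss z * (norm (?P z))\<^sup>2)"
    proof (rule Bochner_Integration.integrable_bound)
      show "integrable lborel (\<lambda>z::'a. gauss z * (LBINT x. \<bar>\<phi> x\<bar>)\<^sup>2)" by simp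
      show "AE z in lborel. norm (gauss z * (norm (?P z))\<^sup>2) \<le> norm (gauss z * (LBINT x. \<bar>\<phi> x\<bar>)\<^sup>2)"
        using norm_fourier_le[of \<phi>] by (intro AE_I2) (auto simp: abs_mult intro!: mult_left_mono power_mono)
    qed measurable
    have "(\<integral>\<^sup>+z. ennreal ((gauss z * norm (?P z))\<^sup>2) \<partial>lborel) \<le> (\<integral>\<^sup>+z. ennreal (gauss z * (norm (?P z))\<^sup>2) \<partial>lborel)"
    proof (intro nn_integral_mono ennreal_leI)
      fix z
      have "(gauss z * norm (?P z))\<^sup>2 = gauss z * (gauss z * (norm (?P z))\<^sup>2)"
        by (simp add: power_mult_distrib power2_eq_square mult_ac)
      also have "\<dots> \<le> gauss z * (norm (?P z))\<^sup>2"
        by (intro mult_left_mono mult_left_le_one_le) auto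
      finally show "(gauss z * norm (?P z))\<^sup>2 \<le> gauss z * (norm (?P z))\<^sup>2" .
    qed
    also have "\<dots> = ennreal (LBINT z. gauss z * (norm (?P z))\<^sup>2)"
      by (rule nn_integral_eq_integral[OF int]) simp
    also have "(LBINT z. gauss z * (norm (?P z))\<^sup>2) = k * gauss_pairing h \<phi> \<phi>"
    proof -
      have "complex_of_real (LBINT z. gauss z * (norm (?P z))\<^sup>2) = complex_of_real (k * gauss_pairing h \<phi> \<phi>)"
        unfolding k_def gauss_pairing_fourier[OF \<phi> \<phi> h] integral_complex_of_real[symmetric]
        by (simp only: of_real_mult complex_norm_square mult.assoc)
      then show ?thesis by (simp only: of_real_eq_iff)
    qed
    also have "gauss_pairing h \<phi> \<phi> \<le> k * h ^ DIM('a) * (LBINT x. \<bar>\<phi> x\<bar>)"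
    proof -
      have "gauss_pairing h \<phi> \<phi> \<le> (LBINT y. \<bar>\<phi> y\<bar> * (h ^ DIM('a) * k))"
        unfolding gauss_pairing_def
      proof (rule order_trans[OF abs_ge_self order_trans[OF integral_abs_bound integral_mono_AE']])
        show "integrable lborel (\<lambda>y. \<bar>\<phi> y\<bar> * (h ^ DIM('a) * k))" using \<phi> by auto
        show "AE y in lborel. \<bar>\<phi> y * (LBINT x. \<phi> x * gauss ((1/h) *\<^sub>R (y - x)))\<bar> \<le> \<bar>\<phi> y\<bar> * (h ^ DIM('a) * k)"
          using h abs_gauss_average_le[OF \<phi>1]
          by (intro AE_I2) (auto simp: abs_mult gauss_average k_def intro!: mult_left_mono)
      qed (use \<open>k > 0\<close> h in auto)
      then show ?thesis by (simp add: mult_ac)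
    qed
    finally show ?thesis using \<open>k > 0\<close> by (simp add: ennreal_leI mult_left_mono)
  qed
  have "ennreal ((k * \<bar>gauss_pairing h f \<phi>\<bar>)) \<le> (\<integral>\<^sup>+z. ennreal (norm (?F z)) * ennreal (gauss z * norm (?P z)) \<partial>lborel)"
  proof -
    have "k * \<bar>gauss_pairing h f \<phi>\<bar> = norm (complex_of_real (k * gauss_pairing h f \<phi>))"
      using \<open>k > 0\<close> by (simp add: norm_mult abs_mult)
    also have "\<dots> = norm (LBINT z. complex_of_real (gauss z) * ?P z * cnj (?F z))"
      unfolding k_def gauss_pairing_fourier[OF f \<phi> h] ..
    finally have e: "k * \<bar>gauss_pairing h f \<phi>\<bar> = norm (LBINT z. complex_of_real (gauss z) * ?P z * cnj (?F z))" .
    have "ennreal (k * \<bar>gauss_pairing h f \<phi>\<bar>) \<le> (\<integral>\<^sup>+z. norm (complex_of_real (gauss z) * ?P z * cnj (?F z)) \<partial>lborel)"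
    proof (cases "integrable lborel (\<lambda>z. complex_of_real (gauss z) * ?P z * cnj (?F z))")
      \<comment> \<open>A non-integrable function has Bochner integral 0 by convention, so nothing
        remains to be bounded.\<close>
      case False
      then have "(LBINT z. complex_of_real (gauss z) * ?P z * cnj (?F z)) = 0"
        by (rule not_integrable_integral_eq)
      then have "k * \<bar>gauss_pairing h f \<phi>\<bar> = 0"
        using e by (simp only: norm_zero)
      then show ?thesis by (simp only: ennreal_0 zero_le)
    qed (simp only: e integral_norm_bound_ennreal)
    then show ?thesis by (simp add: norm_mult ennreal_mult[symmetric] mult_ac)
  qed
  then have "(ennreal ((k * \<bar>gauss_pairing h f \<phi>\<bar>)))\<^sup>2 \<le> (\<integral>\<^sup>+z. ennreal (norm (?F z)) * ennreal (gauss z * norm (?P z)) \<partial>lborel)\<^sup>2"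
    by (rule power_mono) simp
  also have "\<dots> \<le> (\<integral>\<^sup>+z. (ennreal (norm (?F z)))\<^sup>2 \<partial>lborel) * (\<integral>\<^sup>+z. (ennreal (gauss z * norm (?P z)))\<^sup>2 \<partial>lborel)"
    by (rule Cauchy_Schwarz_nn_integral) measurable
  also have "\<dots> \<le> ennreal (h ^ DIM('a) * K) * ennreal (k * (k * h ^ DIM('a) * (LBINT x. \<bar>\<phi> x\<bar>)))"
    using F P by (intro mult_mono) (auto simp: ennreal_power)
  finally have "(k * \<bar>gauss_pairing h f \<phi>\<bar>)\<^sup>2 \<le> h ^ DIM('a) * K * (k * (k * h ^ DIM('a) * (LBINT x. \<bar>\<phi> x\<bar>)))"
    using \<open>k > 0\<close> h K(2) by (simp add: ennreal_power ennreal_mult[symmetric])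
  then have "k\<^sup>2 * (gauss_pairing h f \<phi>)\<^sup>2 \<le> k\<^sup>2 * ((h ^ DIM('a))\<^sup>2 * K * (LBINT x. \<bar>\<phi> x\<bar>))"
    by (simp add: power_mult_distrib power2_eq_square mult_ac)
  then show ?thesis using \<open>k > 0\<close> by simp
qed

text \<open>Let h tend to 0 in \<open>gauss_pairing_bound\<close>: continuity of \<phi> makes its
  Gaussian averages converge to k \<phi>, and the powers of h cancel. The L^1 norm of \<phi> takes
  the place of a squared L^2 norm because |\<phi>| \<le> 1.\<close>

lemma pairing_bound:
  fixes f \<phi> :: "'a::euclidean_space \<Rightarrow> real"
  assumes f: "integrable lborel f" and \<phi>: "integrable lborel \<phi>" and c: "continuous_on UNIV \<phi>"
    and \<phi>1: "\<And>x. \<bar>\<phi> x\<bar> \<le> 1" and K: "(\<integral>\<^sup>+\<xi>. ennreal ((norm (fourier f \<xi>))\<^sup>2) \<partial>lborel) \<le> ennreal K" "K \<ge> 0"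
  shows "((2 * pi) ^ DIM('a)) * (LBINT y. f y * \<phi> y)\<^sup>2 \<le> K * (LBINT x. \<bar>\<phi> x\<bar>)"
proof -
  define k where "k = sqrt (2 * pi) ^ DIM('a)"
  have k: "k > 0" "k\<^sup>2 = (2 * pi) ^ DIM('a)"
    by (simp_all add: k_def power_mult[symmetric] mult.commute[of _ 2] power_mult)
  have [measurable]: "f \<in> borel_measurable borel" "\<phi> \<in> borel_measurable borel" using f \<phi> by auto
  define h where "h = (\<lambda>n. 1 / real (Suc n))"
  have h: "h n > 0" "h \<longlonglongrightarrow> 0" for n
    unfolding h_def using LIMSEQ_Suc[OF lim_1_over_n] by auto
  define A where "A = (\<lambda>n y. \<integral>w. \<phi> (y + h n *\<^sub>R w) * gauss w \<partial>lborel)"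
  have A_lim: "(\<lambda>n. A n y) \<longlonglongrightarrow> \<phi> y * k" for y
  proof -
    have "(\<lambda>n. A n y) \<longlonglongrightarrow> (\<integral>w. \<phi> y * gauss w \<partial>(lborel :: 'a measure))"
      unfolding A_def
    proof (rule integral_dominated_convergence[where w=gauss])
      have "(\<lambda>n. y + h n *\<^sub>R w) \<longlonglongrightarrow> y + 0 *\<^sub>R w" for w by (intro tendsto_intros h)
      then have "(\<lambda>n. \<phi> (y + h n *\<^sub>R w)) \<longlonglongrightarrow> \<phi> y" for w
        using c by (intro isCont_tendsto_compose[where g=\<phi>]) (auto simp: continuous_on_eq_continuous_at)
      then show "AE w in lborel. (\<lambda>n. \<phi> (y + h n *\<^sub>R w) * gauss w) \<longlonglongrightarrow> \<phi> y * gauss w"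
        by (intro AE_I2 tendsto_intros)
      show "AE w in lborel. norm (\<phi> (y + h n *\<^sub>R w) * gauss w) \<le> gauss w" for n
        using \<phi>1 by (intro AE_I2) (auto simp: abs_mult mult_left_le_one_le)
    qed auto
    then show ?thesis by (simp add: integral_gauss k_def)
  qed
  have Ab: "\<bar>A n y\<bar> \<le> k" for n y unfolding A_def k_def by (rule abs_gauss_average_le[OF \<phi>1])
  have [measurable]: "A n \<in> borel_measurable borel" for n unfolding A_def by measurable
  have lim: "(\<lambda>n. \<integral>y. f y * A n y \<partial>lborel) \<longlonglongrightarrow> (LBINT y. f y * (\<phi> y * k))"
  proof (rule integral_dominated_convergence[where w="\<lambda>y. \<bar>f y\<bar> * k"])
    show "AE y in lborel. (\<lambda>n. f y * A n y) \<longlonglongrightarrow> f y * (\<phi> y * k)"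
      by (intro AE_I2 tendsto_intros A_lim)
    show "AE y in lborel. norm (f y * A n y) \<le> \<bar>f y\<bar> * k" for n
      using Ab by (intro AE_I2) (auto simp: abs_mult intro!: mult_left_mono)
  qed (use f in auto)
  have "(LBINT y. f y * A n y)\<^sup>2 \<le> K * (LBINT x. \<bar>\<phi> x\<bar>)" for n
  proof -
    have "gauss_pairing (h n) f \<phi> = (LBINT y. f y * (h n ^ DIM('a) * A n y))"
      unfolding gauss_pairing_def A_def using h(1) by (simp only: gauss_average \<open>\<phi> \<in> borel_measurable borel\<close>)
    also have "\<dots> = h n ^ DIM('a) * (LBINT y. f y * A n y)"
      by (simp add: mult.left_commute[of "f _"])
    finally have e: "gauss_pairing (h n) f \<phi> = h n ^ DIM('a) * (LBINT y. f y * A n y)" .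
    have "(h n ^ DIM('a))\<^sup>2 * (LBINT y. f y * A n y)\<^sup>2 \<le> (h n ^ DIM('a))\<^sup>2 * (K * (LBINT x. \<bar>\<phi> x\<bar>))"
      using gauss_pairing_bound[OF f \<phi> h(1) \<phi>1 K, of n] unfolding e by (simp add: power_mult_distrib mult_ac)
    moreover have "(h n ^ DIM('a))\<^sup>2 > 0" using h(1)[of n] by simp
    ultimately show ?thesis by (simp only: mult_le_cancel_left_pos)
  qed
  then have "(LBINT y. f y * (\<phi> y * k))\<^sup>2 \<le> K * (LBINT x. \<bar>\<phi> x\<bar>)"
    by (intro LIMSEQ_le_const2[OF tendsto_power[OF lim]]) auto
  moreover have "(LBINT y. f y * (\<phi> y * k)) = k * (LBINT y. f y * \<phi> y)"
    by (simp add: mult_ac)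
  ultimately show ?thesis using k by (simp add: power_mult_distrib)
qed

text \<open>Duality: f is tested against continuous approximations of \<open>sgn (f x)\<close>,
  clipped to [-1, 1] and multiplied by a tent equal to 1 on the ball and 0 beyond radius 2 R. Hence
  the volume of the doubled ball on the right. The factor (2 pi) ^ d from
  \<open>pairing_bound\<close> is at least 1 and is dropped.\<close>

lemma L1_ball_le_fourier_L2:
  fixes f :: "'a::euclidean_space \<Rightarrow> real"
  assumes f: "integrable lborel f" and "R > 0"
    and K: "(\<integral>\<^sup>+\<xi>. ennreal ((norm (fourier f \<xi>))\<^sup>2) \<partial>lborel) \<le> ennreal K" "K \<ge> 0"
  shows "(LBINT x. indicator (cball 0 R) x * \<bar>f x\<bar>)\<^sup>2
       \<le> K * (unit_ball_vol (DIM('a)) * (2 * R) ^ DIM('a))"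
proof -
  have [measurable]: "f \<in> borel_measurable borel" using f by auto
  \<comment> \<open>\<open>measurable_on\<close> supplies the continuous functions that converge to
    sgn f outside a negligible set.\<close>
  have "(\<lambda>x. sgn (f x)) measurable_on UNIV"
    by (rule lebesgue_measurable_imp_measurable_on_real) (auto intro!: measurable_completion)
  then obtain N g where N: "negligible N" and g: "\<And>n. continuous_on UNIV (g n)"
      and gl: "\<And>x. x \<notin> N \<Longrightarrow> (\<lambda>n. g n x) \<longlonglongrightarrow> sgn (f x)"
    unfolding measurable_on_def by auto
  have AEN: "AE x in lborel. x \<notin> N"
    using N by (metis AE_completion_iff AE_not_in negligible_iff_null_sets)
  define cut where "cut = (\<lambda>x::'a. max 0 (min 1 (2 - norm x / R)))"
  define \<phi> where "\<phi> = (\<lambda>n x. max (-1) (min 1 (g n x)) * cut x)"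
  have cut: "0 \<le> cut x" "cut x \<le> 1" "x \<in> cball 0 R \<Longrightarrow> cut x = 1" "x \<notin> cball 0 (2 * R) \<Longrightarrow> cut x = 0" for x
    using \<open>R > 0\<close> by (auto simp: cut_def field_simps max_def min_def)
  have [measurable]: "cut \<in> borel_measurable borel" unfolding cut_def by measurable
  have c: "continuous_on UNIV (\<phi> n)" for n
    unfolding \<phi>_def cut_def using \<open>R > 0\<close> by (intro continuous_intros g) auto
  have [measurable]: "\<phi> n \<in> borel_measurable borel" for n by (rule borel_measurable_continuous_onI[OF c])
  have b: "\<bar>\<phi> n x\<bar> \<le> cut x" for n x
    unfolding \<phi>_def abs_mult using cut[of x] by (simp add: mult_left_le_one_le)
  then have b1: "\<bar>\<phi> n x\<bar> \<le> 1" for n x using cut(2) order_trans by blast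
  have b2: "\<bar>\<phi> n x\<bar> \<le> indicator (cball 0 (2 * R)) x" for n x
    using b[of n x] cut[of x] by (auto simp: indicator_def)
  have ii: "integrable lborel (indicator (cball 0 (2 * R)) :: 'a \<Rightarrow> real)"
    using \<open>R > 0\<close> by (auto simp: integrable_indicator_iff emeasure_cball)
  have i: "integrable lborel (\<phi> n)" for n
    by (rule Bochner_Integration.integrable_bound[OF ii]) (use b2 in auto)
  define V where "V = unit_ball_vol (DIM('a)) * (2 * R) ^ DIM('a)"
  have "(LBINT x. \<bar>\<phi> n x\<bar>) \<le> V" for n
  proof -
    have "(LBINT x. \<bar>\<phi> n x\<bar>) \<le> (\<integral>x. indicator (cball 0 (2 * R)) x \<partial>(lborel :: 'a measure))"
      using b2 i ii by (intro integral_mono) auto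
    also have "\<dots> = V" using \<open>R > 0\<close> by (simp add: content_cball V_def)
    finally show ?thesis .
  qed
  then have n: "(LBINT y. f y * \<phi> n y)\<^sup>2 \<le> K * V" for n
  proof -
    have "1 \<le> (2 * pi) ^ DIM('a)" using pi_gt3 by (intro one_le_power) linarith
    then have "1 * (LBINT y. f y * \<phi> n y)\<^sup>2 \<le> (2 * pi) ^ DIM('a) * (LBINT y. f y * \<phi> n y)\<^sup>2"
      by (rule mult_right_mono) simp
    then have "(LBINT y. f y * \<phi> n y)\<^sup>2 \<le> (2 * pi) ^ DIM('a) * (LBINT y. f y * \<phi> n y)\<^sup>2"
      by simp
    also have "\<dots> \<le> K * (LBINT x. \<bar>\<phi> n x\<bar>)" by (rule pairing_bound[OF f i c b1 K])
    also have "\<dots> \<le> K * V" using K(2) \<open>(LBINT x. \<bar>\<phi> n x\<bar>) \<le> V\<close> by (rule mult_left_mono[rotated])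
    finally show ?thesis .
  qed
  have lim: "(\<lambda>n. \<integral>y. f y * \<phi> n y \<partial>lborel) \<longlonglongrightarrow> (LBINT y. f y * (sgn (f y) * cut y))"
  proof (rule integral_dominated_convergence[where w="\<lambda>y. \<bar>f y\<bar>"])
    show "AE y in lborel. (\<lambda>n. f y * \<phi> n y) \<longlonglongrightarrow> f y * (sgn (f y) * cut y)"
      using AEN
    proof eventually_elim
      case (elim y)
      have "(\<lambda>n. f y * \<phi> n y) \<longlonglongrightarrow> f y * (max (-1) (min 1 (sgn (f y))) * cut y)"
        unfolding \<phi>_def by (intro tendsto_intros gl elim)
      then show ?case by (simp add: sgn_if)
    qed
    show "AE y in lborel. norm (f y * \<phi> n y) \<le> \<bar>f y\<bar>" for n
      using b1 by (intro AE_I2) (auto simp: abs_mult mult_left_le)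
  qed (use f in auto)
  have sq: "(LBINT y. f y * (sgn (f y) * cut y))\<^sup>2 \<le> K * V"
    by (rule LIMSEQ_le_const2[OF tendsto_power[OF lim]]) (use n in auto)
  have e: "f y * (sgn (f y) * cut y) = cut y * \<bar>f y\<bar>" for y by (simp add: abs_sgn mult_ac)
  have ic: "integrable lborel (\<lambda>y. cut y * \<bar>f y\<bar>)"
    by (rule Bochner_Integration.integrable_bound[OF f]) (use cut in \<open>auto simp: abs_mult mult_left_le_one_le\<close>)
  have "(LBINT x. indicator (cball 0 R) x * \<bar>f x\<bar>) \<le> (LBINT y. cut y * \<bar>f y\<bar>)"
    by (rule integral_mono_AE'[OF ic]) (use cut in \<open>auto simp: indicator_def intro!: AE_I2\<close>)
  then have "(LBINT x. indicator (cball 0 R) x * \<bar>f x\<bar>)\<^sup>2 \<le> (LBINT y. cut y * \<bar>f y\<bar>)\<^sup>2"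
    by (rule power_mono) (auto intro!: integral_nonneg_AE)
  then show ?thesis using sq unfolding e V_def by linarith
qed

section \<open>Integrability of power weights and moment bounds\<close>

lemma ennreal_le_suminf: "f n \<le> (\<Sum>n. f n :: ennreal)"
  using sum_le_suminf[of f "{n}"] by simp

text \<open>Dyadic decomposition: \<open>(1 + |x|) powr - p\<close> is dominated by the series below,
  whose integral is a geometric series because \<open>p > DIM('a)\<close>.\<close>

lemma nn_integral_power_decay_finite:
  assumes p: "p > real DIM('a::euclidean_space)"
  shows "(\<integral>\<^sup>+x. ennreal ((1 + norm (x::'a)) powr (- p)) \<partial>lborel) < \<infinity>"
proof -
  define V where "V = unit_ball_vol (real DIM('a))"
  define b where "b = (\<lambda>n (x::'a). ennreal (2 powr (p - p * real n)) * indicator (cball 0 (2 ^ n)) x)"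
  have [measurable]: "b n \<in> borel_measurable borel" for n
    unfolding b_def
    by (rule borel_measurable_times_ennreal[OF borel_measurable_const borel_measurable_indicator])
       (rule borel_closed[OF closed_cball])
  have le: "ennreal ((1 + norm x) powr (- p)) \<le> (\<Sum>n. b n x)" for x :: 'a
  proof -
    define n where "n = (LEAST n. 1 + norm x \<le> 2 ^ n)"
    obtain m where "1 + norm x < 2 ^ m" using real_arch_pow[of 2 "1 + norm x"] by auto
    then have n: "1 + norm x \<le> 2 ^ n" unfolding n_def by (rule LeastI[OF less_imp_le])
    \<comment> \<open>The subtraction is of reals: for n = 0 the left side is 1/2.\<close>
    have lower: "2 powr (real n - 1) \<le> 1 + norm x"
    proof (cases n)
      case 0 then show ?thesis by (simp add: powr_minus_divide)
    next
      case (Suc k)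
      then have "\<not> 1 + norm x \<le> 2 ^ k" unfolding n_def using not_less_Least by (metis lessI)
      then show ?thesis using Suc by (simp add: powr_realpow)
    qed
    have "(1 + norm x) powr (- p) \<le> (2 powr (real n - 1)) powr (- p)"
      using p lower by (intro powr_mono2') auto
    also have "\<dots> = 2 powr (p - p * real n)"
      by (simp add: powr_powr algebra_simps)
    finally have "ennreal ((1 + norm x) powr (- p)) \<le> b n x"
      using n by (auto simp: b_def intro!: ennreal_leI)
    also have "\<dots> \<le> (\<Sum>n. b n x)"
      by (rule ennreal_le_suminf)
    finally show ?thesis .
  qed
  define q where "q = 2 powr (real DIM('a) - p)"
  have q: "0 < q" "q < 1" using p powr_less_mono[of "real DIM('a) - p" 0 2] by (auto simp: q_def)
  have bn: "(\<integral>\<^sup>+x. b n x \<partial>lborel) = ennreal (2 powr p * V * q ^ n)" for n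
  proof -
    have "(\<integral>\<^sup>+x. b n x \<partial>lborel) = ennreal (2 powr (p - p * real n)) * ennreal (V * (2 ^ n) ^ DIM('a))"
      unfolding b_def by (subst nn_integral_cmult_indicator) (simp_all add: emeasure_cball V_def)
    also have "\<dots> = ennreal (2 powr (p - p * real n) * (V * (2 ^ n) ^ DIM('a)))"
      by (simp add: V_def ennreal_mult[symmetric])
    also have "2 powr (p - p * real n) * (V * (2 ^ n) ^ DIM('a)) = 2 powr p * V * q ^ n"
    proof -
      have "((2::real) ^ n) ^ DIM('a) = 2 powr (real n * real DIM('a))"
        by (metis power_mult powr_realpow of_nat_mult zero_less_numeral)
      moreover have "q ^ n = 2 powr (real n * real DIM('a) - p * real n)"
        unfolding q_def by (simp add: powr_powr powr_realpow[symmetric] algebra_simps)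
      ultimately show ?thesis by (simp add: powr_diff mult_ac)
    qed
    finally show ?thesis .
  qed
  have "(\<integral>\<^sup>+x. ennreal ((1 + norm (x::'a)) powr (- p)) \<partial>lborel) \<le> (\<integral>\<^sup>+x. (\<Sum>n. b n x) \<partial>lborel)"
    by (intro nn_integral_mono le)
  also have "\<dots> = (\<Sum>n. \<integral>\<^sup>+x. b n x \<partial>lborel)"
    by (rule nn_integral_suminf) simp
  also have "\<dots> = (\<Sum>n. ennreal (2 powr p * V * q ^ n))"
    using bn by simp
  also have "\<dots> = ennreal (\<Sum>n. 2 powr p * V * q ^ n)"
    using q by (intro suminf_ennreal2) (auto simp: V_def intro!: summable_mult)
  also have "\<dots> < \<infinity>" by simp
  finally show ?thesis .
qed

section \<open>Moments of order below 1 from the transform near frequency 0\<close>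

lemma gauss_moment_integrable:
  "integrable lborel (\<lambda>x::'a::euclidean_space. (1 + (norm x)\<^sup>2) * gauss x)"
proof (rule Bochner_Integration.integrable_bound)
  have "integrable lborel (\<lambda>x::'a. 4 * gauss (0 + (1 / sqrt 2) *\<^sub>R x))"
    by (intro integrable_mult_right lborel_integrable_scaleR) auto
  then show "integrable lborel (\<lambda>x::'a. 4 * gauss ((1 / sqrt 2) *\<^sub>R x))" by simp
  have "(1 + t) * exp (- t / 2) \<le> 4 * exp (- t / 4)" if "t \<ge> 0" for t :: real
  proof -
    have "1 + t \<le> 4 * exp (t / 4)" using exp_ge_add_one_self[of "t/4"] that by (simp; linarith)
    then have "(1 + t) * exp (- t / 2) \<le> 4 * exp (t / 4) * exp (- t / 2)"
      by (intro mult_right_mono) auto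
    also have "\<dots> = 4 * exp (- t / 4)" by (simp add: exp_add[symmetric] field_simps)
    finally show ?thesis .
  qed
  from this[of "(norm x)\<^sup>2" for x]
  show "AE x::'a in lborel. norm ((1 + (norm x)\<^sup>2) * gauss x) \<le> norm (4 * gauss ((1 / sqrt 2) *\<^sub>R x))"
    by (intro AE_I2) (simp add: gauss_def abs_mult power_divide)
qed simp

text \<open>By Fubini the left side, times a constant k \<ge> 1, is the Gaussian average of
  \<open>1 - fourier u (l *\<^sub>R \<xi>)\<close>. Since l \<le> 1 and 1 \<le> a \<le> 2, the power
  a of |l \<xi>| is at most l (1 + |\<xi>|^2). This gain of only one power of l is what confines the
  method to moments of order below 1.\<close>

lemma one_minus_gauss_le:
  fixes u :: "'a::euclidean_space \<Rightarrow> real"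
  assumes u: "prob_density u" and B: "\<And>\<xi>. norm (1 - fourier u \<xi>) \<le> B * norm \<xi> powr a"
    and a: "1 \<le> a" "a \<le> 2" and l: "0 < l" "l \<le> 1"
  shows "(LBINT x. u x * (1 - gauss (l *\<^sub>R x)))
     \<le> l * B * (LBINT \<xi>. (1 + (norm \<xi>)\<^sup>2) * gauss (\<xi>::'a))"
proof -
  have ui: "integrable lborel u" and un: "\<And>x. 0 \<le> u x" and u1: "integral\<^sup>L lborel u = 1"
    using u by (auto simp: prob_density_def)
  have [measurable]: "u \<in> borel_measurable borel" using ui by auto
  have [measurable]: "fourier u \<in> borel_measurable borel" by (rule fourier_measurable[OF ui])
  have B0: "B \<ge> 0"
  proof -
    obtain e :: 'a where "norm e = 1" using vector_choose_size[of 1] by auto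
    with order_trans[OF norm_ge_zero B[of e]] show ?thesis by simp
  qed
  define k where "k = sqrt (2 * pi) ^ DIM('a)"
  have k1: "k \<ge> 1" unfolding k_def using pi_gt3 by (intro one_le_power) (simp add: real_le_rsqrt)
  have gi: "integrable lborel (\<lambda>\<xi>::'a. complex_of_real (gauss \<xi>))" by auto
  have ui': "integrable lborel (\<lambda>x. complex_of_real (u x))" using ui by auto
  have F: "fourier u (l *\<^sub>R \<xi>) = (LBINT x. complex_of_real (u x) * cis (- l * (x \<bullet> \<xi>)))" for \<xi>
    by (simp add: fourier_def mult.commute)
  have Fi: "integrable lborel (\<lambda>\<xi>. complex_of_real (gauss \<xi>) * fourier u (l *\<^sub>R \<xi>))"
    using fubini_cis(2)[OF gi ui', of "- l"] unfolding F by (simp add: inner_commute)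
  have "complex_of_real (k * (LBINT x. u x * gauss (l *\<^sub>R x)))
     = (LBINT x. complex_of_real (u x) * complex_of_real (k * gauss (l *\<^sub>R x)))"
    by (subst integral_mult_right_zero[symmetric], subst integral_complex_of_real[symmetric]) (simp add: mult_ac)
  also have "\<dots> = (LBINT x. complex_of_real (u x) * (LBINT \<xi>. complex_of_real (gauss \<xi>) * cis (- l * (x \<bullet> \<xi>))))"
  proof -
    have "complex_of_real (k * gauss (l *\<^sub>R x)) = (LBINT \<xi>. complex_of_real (gauss \<xi>) * cis (- l * (x \<bullet> \<xi>)))" for x :: 'a
      unfolding k_def using gauss_fourier_aux(2)[of "- (l *\<^sub>R x)"] by (simp add: inner_commute mult.commute)
    then show ?thesis by (simp only:)
  qed
  also have "\<dots> = (LBINT \<xi>. complex_of_real (gauss \<xi>) * fourier u (l *\<^sub>R \<xi>))"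
    unfolding F by (rule fubini_cis(1)[OF ui' gi])
  finally have e: "complex_of_real (k * (LBINT x. u x * gauss (l *\<^sub>R x)))
     = (LBINT \<xi>. complex_of_real (gauss \<xi>) * fourier u (l *\<^sub>R \<xi>))" .
  have ig: "integrable lborel (\<lambda>x. u x * gauss (l *\<^sub>R x))"
    by (rule integrable_density_mult[OF ui, of _ 1]) (auto simp: )
  have nn: "0 \<le> (LBINT x. u x * (1 - gauss (l *\<^sub>R x)))"
    using un by (intro integral_nonneg_AE AE_I2 mult_nonneg_nonneg) auto
  have "(LBINT x. u x * (1 - gauss (l *\<^sub>R x))) = 1 - (LBINT x. u x * gauss (l *\<^sub>R x))"
    using ig ui u1 by (simp add: right_diff_distrib)
  note e1 = this
  then have "complex_of_real (k * (LBINT x. u x * (1 - gauss (l *\<^sub>R x))))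
     = complex_of_real k - complex_of_real (k * (LBINT x. u x * gauss (l *\<^sub>R x)))"
    unfolding e1 by (simp add: algebra_simps)
  also have "\<dots> = (\<integral>\<xi>. complex_of_real (gauss \<xi>) * (1 - fourier u (l *\<^sub>R \<xi>)) \<partial>(lborel :: 'a measure))"
    unfolding e using gi Fi integral_gauss[where 'a='a]
    by (simp add: right_diff_distrib k_def)
  finally have e2: "complex_of_real (k * (LBINT x. u x * (1 - gauss (l *\<^sub>R x))))
     = (\<integral>\<xi>. complex_of_real (gauss \<xi>) * (1 - fourier u (l *\<^sub>R \<xi>)) \<partial>(lborel :: 'a measure))" .
  have "k * (LBINT x. u x * (1 - gauss (l *\<^sub>R x)))
     = norm (\<integral>\<xi>. complex_of_real (gauss \<xi>) * (1 - fourier u (l *\<^sub>R \<xi>)) \<partial>(lborel :: 'a measure))"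
  proof -
    have "0 \<le> k * (LBINT x. u x * (1 - gauss (l *\<^sub>R x)))"
      using nn k1 by simp
    then have "k * (LBINT x. u x * (1 - gauss (l *\<^sub>R x)))
      = norm (complex_of_real (k * (LBINT x. u x * (1 - gauss (l *\<^sub>R x)))))"
      by (simp only: norm_of_real abs_of_nonneg)
    then show ?thesis by (simp only: e2)
  qed
  also have "\<dots> \<le> (LBINT \<xi>. l * B * ((1 + (norm \<xi>)\<^sup>2) * gauss (\<xi>::'a)))"
  proof (rule order_trans[OF integral_norm_bound integral_mono_AE'])
    show "integrable lborel (\<lambda>\<xi>. l * B * ((1 + (norm \<xi>)\<^sup>2) * gauss (\<xi>::'a)))"
      by (intro integrable_mult_right gauss_moment_integrable)
    show "AE \<xi> in lborel. norm (complex_of_real (gauss \<xi>) * (1 - fourier u (l *\<^sub>R \<xi>)))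
        \<le> l * B * ((1 + (norm \<xi>)\<^sup>2) * gauss (\<xi>::'a))"
    proof (intro AE_I2)
      fix \<xi> :: 'a
      have "norm \<xi> powr a \<le> 1 + (norm \<xi>)\<^sup>2"
      proof (cases "norm \<xi> \<le> 1")
        case True
        then have "norm \<xi> powr a \<le> 1" using a by (simp add: powr_le1)
        then show ?thesis by (simp add: add_increasing2)
      next
        case False
        then have "norm \<xi> powr a \<le> norm \<xi> powr 2" using a by (intro powr_mono) auto
        then show ?thesis using False by (simp add: powr_numeral)
      qed
      moreover have "l powr a \<le> l powr 1" using l a by (intro powr_mono') auto
      ultimately have "B * norm (l *\<^sub>R \<xi>) powr a \<le> B * (l * (1 + (norm \<xi>)\<^sup>2))"
        using l B0 by (simp add: powr_mult mult_mono mult_left_mono)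
      with B[of "l *\<^sub>R \<xi>"] have "norm (1 - fourier u (l *\<^sub>R \<xi>)) \<le> l * B * (1 + (norm \<xi>)\<^sup>2)"
        by (simp add: mult_ac)
      then have "gauss \<xi> * norm (1 - fourier u (l *\<^sub>R \<xi>)) \<le> gauss \<xi> * (l * B * (1 + (norm \<xi>)\<^sup>2))"
        by (rule mult_left_mono) simp
      then show "norm (complex_of_real (gauss \<xi>) * (1 - fourier u (l *\<^sub>R \<xi>))) \<le> l * B * ((1 + (norm \<xi>)\<^sup>2) * gauss \<xi>)"
        by (simp add: norm_mult mult_ac)
    qed
  qed (use l B0 in auto)
  finally have "k * (LBINT x. u x * (1 - gauss (l *\<^sub>R x)))
     \<le> l * B * (LBINT \<xi>. (1 + (norm \<xi>)\<^sup>2) * gauss (\<xi>::'a))" by simp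
  moreover have "1 * (LBINT x. u x * (1 - gauss (l *\<^sub>R x))) \<le> k * (LBINT x. u x * (1 - gauss (l *\<^sub>R x)))"
    using k1 nn by (rule mult_right_mono)
  ultimately show ?thesis by simp
qed

text \<open>Each dyadic shell \<open>2 ^ n \<le> |x|\<close> has weight at most \<open>3 (1 - gauss (x / 2 ^ n))\<close>.\<close>

lemma jbr_powr_le_suminf:
  fixes x :: "'a::euclidean_space"
  assumes m: "0 \<le> m" "m < 1"
  shows "ennreal (jbr x powr m) \<le> 2 + (\<Sum>n. ennreal (3 * 2 powr ((real n + 2) * m) * (1 - gauss ((1 / 2 ^ n) *\<^sub>R x))))"
proof -
  let ?b = "\<lambda>n. ennreal (3 * 2 powr ((real n + 2) * m) * (1 - gauss ((1 / 2 ^ n) *\<^sub>R x)))"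
  have jle: "jbr x \<le> 1 + norm x" unfolding jbr_def
    by (rule real_le_lsqrt) (auto simp: power2_eq_square algebra_simps)
  have jpos: "0 \<le> jbr x" by (simp add: jbr_def)
  show ?thesis
  proof (cases "norm x < 1")
    case True
    then have "jbr x powr m \<le> 2 powr m" using jle jpos m by (intro powr_mono2) auto
    also have "\<dots> \<le> 2 powr 1" using m by (intro powr_mono) auto
    finally have "ennreal (jbr x powr m) \<le> ennreal 2" by (intro ennreal_leI) simp
    then show ?thesis by (simp add: add_increasing2)
  next
    case False
    obtain k where k: "norm x < 2 ^ k" using real_arch_pow[of 2 "norm x"] by auto
    define N where "N = (LEAST n. norm x < 2 ^ n)"
    have N: "norm x < 2 ^ N" unfolding N_def using k by (rule LeastI)
    have "N \<noteq> 0" using N False by (cases N) auto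
    then obtain n where n: "N = Suc n" by (cases N) auto
    then have low: "2 ^ n \<le> norm x" unfolding N_def using not_less_Least[of n] by (metis lessI not_le)
    have "(1::real) \<le> 2 ^ n" by simp
    have "norm x < 2 * 2 ^ n" using N n by simp
    then have "jbr x \<le> 2 ^ n + 2 * 2 ^ n" using jle \<open>(1::real) \<le> 2 ^ n\<close> by linarith
    also have "\<dots> \<le> 2 powr (real n + 2)" by (simp add: powr_add powr_realpow powr_numeral)
    finally have "jbr x powr m \<le> (2 powr (real n + 2)) powr m" using jpos m by (intro powr_mono2) auto
    then have 1: "jbr x powr m \<le> 2 powr ((real n + 2) * m)" by (simp add: powr_powr)
    \<comment> \<open>Source of the factor 3: on the shell 1 - gauss is at least 1/3.\<close>
    have "gauss ((1 / 2 ^ n) *\<^sub>R x) \<le> 2 / 3"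
    proof -
      have "(1 / 2 ^ n) * norm x \<ge> 1" using low by (simp add: field_simps)
      then have "((1 / 2 ^ n) * norm x)\<^sup>2 \<ge> 1" using power_mono[of 1 "(1 / 2 ^ n) * norm x" 2] by simp
      then have "gauss ((1 / 2 ^ n) *\<^sub>R x) \<le> exp (- (1 / 2))" by (simp add: gauss_def)
      also have "\<dots> \<le> 2 / 3" using exp_ge_add_one_self[of "1/2"] by (simp add: exp_minus field_simps)
      finally show ?thesis .
    qed
    then have "jbr x powr m * 1 \<le> 2 powr ((real n + 2) * m) * (3 * (1 - gauss ((1 / 2 ^ n) *\<^sub>R x)))"
      using 1 by (intro mult_mono) auto
    then have "ennreal (jbr x powr m) \<le> ?b n" by (intro ennreal_leI) (simp add: algebra_simps)
    also have "\<dots> \<le> (\<Sum>n. ?b n)" by (rule ennreal_le_suminf)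
    finally show ?thesis by (simp add: add_increasing)
  qed
qed

text \<open>Summing \<open>one_minus_gauss_le\<close> with l = 2 powr (- n) over the dyadic shells,
  the weight 2 powr (n m) against the bound of order 2 powr (- n) leaves a geometric series of ratio
  2 powr (m - 1) < 1. The constant sees u and a only through B, so one constant serves all s and
  \<epsilon>.\<close>

lemma moment_bound:
  assumes m: "0 \<le> m" "m < 1" and B0: "B \<ge> 0"
  shows "\<exists>C\<ge>0. \<forall>(u :: 'a::euclidean_space \<Rightarrow> real) a. prob_density u \<longrightarrow> 1 \<le> a \<longrightarrow> a \<le> 2 \<longrightarrow>
      (\<forall>\<xi>. norm (1 - fourier u \<xi>) \<le> B * norm \<xi> powr a) \<longrightarrow>
      (\<integral>\<^sup>+x. ennreal (jbr x powr m * u x) \<partial>lborel) \<le> ennreal C"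
proof -
  define G where "G = (LBINT \<xi>. (1 + (norm \<xi>)\<^sup>2) * gauss (\<xi>::'a))"
  have G: "G \<ge> 0" unfolding G_def by (intro integral_nonneg_AE AE_I2) simp
  define q where "q = 2 powr (m - 1)"
  have q: "0 < q" "q < 1" using m powr_less_mono[of "m - 1" 0 2] by (auto simp: q_def)
  define c where "c = (\<lambda>n. 3 * 2 powr (2 * m) * B * G * q ^ n)"
  have c0: "c n \<ge> 0" for n using q G B0 by (simp add: c_def)
  have cs: "summable c" unfolding c_def using q by (intro summable_mult summable_geometric) auto
  have main: "(\<integral>\<^sup>+x. ennreal (jbr x powr m * u x) \<partial>lborel) \<le> ennreal (2 + suminf c)"
    if u: "prob_density u" and a: "1 \<le> a" "a \<le> 2" and F: "\<And>\<xi>. norm (1 - fourier u \<xi>) \<le> B * norm \<xi> powr a"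
    for u :: "'a \<Rightarrow> real" and a
  proof -
    have ui: "integrable lborel u" and un: "\<And>x. 0 \<le> u x" and u1: "integral\<^sup>L lborel u = 1"
      using u by (auto simp: prob_density_def)
    have [measurable]: "u \<in> borel_measurable borel" using ui by auto
    let ?b = "\<lambda>n x. ennreal (3 * 2 powr ((real n + 2) * m) * (1 - gauss ((1 / 2 ^ n) *\<^sub>R x)))"
    have b: "(\<integral>\<^sup>+x. ennreal (u x) * ?b n x \<partial>lborel) \<le> ennreal (c n)" for n
    proof -
      let ?k = "3 * 2 powr ((real n + 2) * m)"
      have i: "integrable lborel (\<lambda>x. u x * (1 - gauss ((1 / 2 ^ n) *\<^sub>R x)))"
        by (rule integrable_density_mult[OF ui, of _ 1]) auto
      have "(\<integral>\<^sup>+x. ennreal (u x) * ?b n x \<partial>lborel) = (\<integral>\<^sup>+x. ennreal (?k * (u x * (1 - gauss ((1 / 2 ^ n) *\<^sub>R x)))) \<partial>lborel)"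
        using un by (intro nn_integral_cong) (simp add: ennreal_mult[symmetric] mult_ac)
      also have "\<dots> = ennreal (?k * (LBINT x. u x * (1 - gauss ((1 / 2 ^ n) *\<^sub>R x))))"
        using i un by (subst nn_integral_eq_integral) (auto intro!: AE_I2)
      also have "\<dots> \<le> ennreal (?k * (1 / 2 ^ n * B * G))"
        unfolding G_def
        by (intro ennreal_leI mult_left_mono one_minus_gauss_le[OF u F a]) (auto simp: divide_le_eq)
      also have "?k * (1 / 2 ^ n * B * G) = c n"
        unfolding c_def q_def
        by (simp add: powr_realpow[symmetric] powr_powr powr_add powr_diff powr_minus algebra_simps power_divide)
      finally show ?thesis .
    qed
    have "(\<integral>\<^sup>+x. ennreal (jbr x powr m * u x) \<partial>lborel) \<le> (\<integral>\<^sup>+x. ennreal (u x) * 2 + (\<Sum>n. ennreal (u x) * ?b n x) \<partial>lborel)"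
    proof (rule nn_integral_mono)
      fix x
      have "ennreal (jbr x powr m * u x) = ennreal (u x) * ennreal (jbr x powr m)"
        using un by (simp add: ennreal_mult[symmetric] mult.commute)
      also have "\<dots> \<le> ennreal (u x) * (2 + (\<Sum>n. ?b n x))"
        by (intro mult_left_mono jbr_powr_le_suminf m) simp
      finally show "ennreal (jbr x powr m * u x) \<le> ennreal (u x) * 2 + (\<Sum>n. ennreal (u x) * ?b n x)"
        by (simp add: distrib_left)
    qed
    also have "\<dots> = (\<integral>\<^sup>+x. ennreal (u x) * 2 \<partial>lborel) + (\<Sum>n. \<integral>\<^sup>+x. ennreal (u x) * ?b n x \<partial>lborel)"
    proof -
      have s: "(\<integral>\<^sup>+x. (\<Sum>n. ennreal (u x) * ?b n x) \<partial>lborel) = (\<Sum>n. \<integral>\<^sup>+x. ennreal (u x) * ?b n x \<partial>lborel)"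
        by (rule nn_integral_suminf) measurable
      show ?thesis unfolding s[symmetric] by (rule nn_integral_add) measurable
    qed
    also have "\<dots> \<le> 2 + (\<Sum>n. ennreal (c n))"
    proof (intro add_mono suminf_le)
      have "(\<integral>\<^sup>+x. ennreal (u x) \<partial>lborel) = 1"
        using nn_integral_eq_integral[OF ui] un u1 by simp
      then show "(\<integral>\<^sup>+x. ennreal (u x) * 2 \<partial>lborel) \<le> 2" by (simp add: nn_integral_multc)
    qed (use b in auto)
    also have "(\<Sum>n. ennreal (c n)) = ennreal (suminf c)" by (rule suminf_ennreal2[OF c0 cs])
    also have "2 + ennreal (suminf c) = ennreal (2 + suminf c)"
      using suminf_nonneg[OF cs c0] by (simp add: ennreal_plus)
    finally show ?thesis .
  qed
  show ?thesis
    using main suminf_nonneg[OF cs c0] by (intro exI[of _ "2 + suminf c"]) auto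
qed

section \<open>Comparison of symbols and slab mass\<close>

lemma powr_le_add_powr:
  fixes t :: real
  assumes "0 \<le> t" "b1 \<le> b" "b \<le> b2"
  shows "t powr b \<le> t powr b1 + t powr b2"
proof (cases "t \<le> 1")
  case True
  show ?thesis
  proof (cases "t = 0")
    case False
    then have "t powr b \<le> t powr b1" using assms True by (intro powr_mono') auto
    then show ?thesis by (simp add: add_increasing2)
  qed simp
next
  case False
  then have "t powr b \<le> t powr b2" using assms by (intro powr_mono) auto
  then show ?thesis by (simp add: add_increasing)
qed

lemma powr_mult_abs_ln_le:
  fixes x c :: real
  assumes "0 < x" "x \<le> 1" "0 < c"
  shows "x powr c * \<bar>ln x\<bar> \<le> 1 / c"
proof -
  have "ln (1 / x) \<le> (1 / x) powr c / c" using assms by (intro ln_powr_bound) auto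
  then have "\<bar>ln x\<bar> \<le> 1 / (x powr c * c)"
    using assms by (simp add: ln_div powr_divide ln_le_zero_iff abs_of_nonpos)
  then have "x powr c * \<bar>ln x\<bar> \<le> x powr c * (1 / (x powr c * c))" by (intro mult_left_mono) auto
  then show ?thesis using assms by simp
qed

text \<open>In the application \<eta> = \<epsilon> t with \<epsilon> \<le> 1, so a bound in t alone
  is uniform in \<epsilon>. The logarithm is absorbed by the power \<delta> when \<eta> \<le> 1 and
  by an additional power \<kappa> when \<eta> > 1. The lower exponent 1/2 lies below a and is still
  integrable against dt/t at 0.\<close>

lemma powr_log_weight_le:
  fixes \<delta> \<kappa> a t \<eta> :: real
  assumes "0 < \<eta>" "\<eta> \<le> t" "0 < \<delta>" "0 < \<kappa>" "1 \<le> a" "a \<le> 2"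
  shows "t powr a * (\<eta> powr \<delta> * max 1 \<bar>ln \<eta>\<bar>)
     \<le> (1 + 1/\<delta> + 1/\<kappa>) * (t powr (1/2) + t powr (2 + \<delta> + \<kappa>))"
proof (cases "\<eta> \<le> 1")
  case True
  have "\<eta> powr \<delta> * 1 \<le> 1" using assms True by (simp add: powr_le1)
  moreover have "\<eta> powr \<delta> * \<bar>ln \<eta>\<bar> \<le> 1 / \<delta>" using assms True by (intro powr_mult_abs_ln_le) auto
  moreover have "0 < 1/\<delta>" "0 < 1/\<kappa>" using assms by auto
  ultimately have 1: "\<eta> powr \<delta> * max 1 \<bar>ln \<eta>\<bar> \<le> 1 + 1/\<delta> + 1/\<kappa>"
    unfolding max_def by (split if_split) linarith
  have 2: "t powr a \<le> t powr (1/2) + t powr (2 + \<delta> + \<kappa>)"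
    using assms by (intro powr_le_add_powr) auto
  have "t powr a * (\<eta> powr \<delta> * max 1 \<bar>ln \<eta>\<bar>)
      \<le> (t powr (1/2) + t powr (2 + \<delta> + \<kappa>)) * (1 + 1/\<delta> + 1/\<kappa>)"
    by (rule mult_mono[OF 2 1]) auto
  then show ?thesis by (simp add: mult.commute)
next
  case False
  then have t1: "1 < t" using assms by simp
  have "\<bar>ln \<eta>\<bar> \<le> \<eta> powr \<kappa> / \<kappa>" using False assms ln_powr_bound[of \<eta> \<kappa>] by simp
  also have "\<dots> \<le> t powr \<kappa> * (1/\<kappa>)" using assms by (simp add: divide_right_mono powr_mono2)
  finally have l: "\<bar>ln \<eta>\<bar> \<le> t powr \<kappa> * (1/\<kappa>)" .
  have t\<kappa>: "1 \<le> t powr \<kappa>" using t1 assms by (simp add: ge_one_powr_ge_zero)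
  have "max 1 \<bar>ln \<eta>\<bar> \<le> t powr \<kappa> * (1 + 1/\<kappa>)"
    using l t\<kappa> assms by (simp add: distrib_left add_increasing add_increasing2)
  then have m1: "\<eta> powr \<delta> * max 1 \<bar>ln \<eta>\<bar> \<le> t powr \<delta> * (t powr \<kappa> * (1 + 1/\<kappa>))"
    using assms by (intro mult_mono powr_mono2) auto
  have m2: "t powr a \<le> t powr 2" using t1 assms by (intro powr_mono) auto
  have "t powr a * (\<eta> powr \<delta> * max 1 \<bar>ln \<eta>\<bar>) \<le> t powr 2 * (t powr \<delta> * (t powr \<kappa> * (1 + 1/\<kappa>)))"
    by (rule mult_mono[OF m2 m1]) auto
  also have "\<dots> = (1 + 1/\<kappa>) * t powr (2 + \<delta> + \<kappa>)" by (simp add: powr_add mult_ac)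
  also have "\<dots> \<le> (1 + 1/\<delta> + 1/\<kappa>) * (t powr (1/2) + t powr (2 + \<delta> + \<kappa>))"
    using assms by (intro mult_mono) auto
  finally show ?thesis .
qed

text \<open>A tangent-line bound for exp, applied to a ln t and 2 ln t, yields the factor 2 - a
  (later 2 (1 - s)) and a logarithm. The logarithm is paid for by lowering the exponent to 1/2 when
  t \<le> 1 and by raising it by \<kappa> when t > 1.\<close>

lemma powr_diff_le:
  fixes \<delta> \<kappa> a t :: real
  assumes "0 < t" "0 < \<delta>" "0 < \<kappa>" "1 \<le> a" "a \<le> 2"
  shows "\<bar>t powr a - t powr 2\<bar> \<le> (2 - a) * (2 * (2 + 1/\<kappa>)) * (t powr (1/2) + t powr (2 + \<delta> + \<kappa>))"
proof -
  have exp_diff: "\<bar>exp x - exp y\<bar> \<le> \<bar>x - y\<bar> * (exp x + exp y)" for x y :: real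
  proof -
    have *: "exp x - exp y \<le> (x - y) * exp x" if "y \<le> x" for x y :: real
      using exp_ge_add_one_self[of "y - x"] mult_right_mono[of "1 + (y - x)" "exp (y - x)" "exp x"]
      by (simp add: exp_add[symmetric] algebra_simps)
    show ?thesis
    proof (cases "y \<le> x")
      case True
      have "exp x - exp y \<le> (x - y) * exp x" by (rule *[OF True])
      also have "\<dots> \<le> (x - y) * (exp x + exp y)" using True by (intro mult_left_mono) auto
      finally show ?thesis using True by simp
    next
      case False
      then have "exp y - exp x \<le> (y - x) * exp y" by (intro *) auto
      also have "\<dots> \<le> (y - x) * (exp x + exp y)" using False by (intro mult_left_mono) auto
      finally show ?thesis using False by simp
    qed
  qed
  have lb: "\<bar>ln t\<bar> * t powr b \<le> (2 + 1/\<kappa>) * (t powr (1/2) + t powr (2 + \<delta> + \<kappa>))"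
    if b: "1 \<le> b" "b \<le> 2" for b
  proof (cases "t \<le> 1")
    case True
    have "\<bar>ln t\<bar> * t powr b \<le> \<bar>ln t\<bar> * t powr 1" using True assms b by (intro mult_left_mono powr_mono') auto
    also have "\<dots> = t powr (1/2) * (t powr (1/2) * \<bar>ln t\<bar>)"
      using assms by (simp add: mult.assoc[symmetric] powr_add[symmetric])
    also have "\<dots> \<le> t powr (1/2) * 2"
      using powr_mult_abs_ln_le[of t "1/2"] assms True by (intro mult_left_mono) auto
    also have "\<dots> \<le> (t powr (1/2) + t powr (2 + \<delta> + \<kappa>)) * (2 + 1/\<kappa>)"
      using assms by (intro mult_mono) auto
    finally show ?thesis by (simp add: mult.commute)
  next
    case False
    have "\<bar>ln t\<bar> * t powr b \<le> (t powr \<kappa> / \<kappa>) * t powr 2"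
      using False assms b ln_powr_bound[of t \<kappa>] by (intro mult_mono powr_mono) auto
    also have "\<dots> = (1/\<kappa>) * t powr (2 + \<kappa>)" by (simp add: powr_add)
    also have "\<dots> \<le> (2 + 1/\<kappa>) * (t powr (1/2) + t powr (2 + \<delta> + \<kappa>))"
    proof (rule mult_mono)
      have "t powr (2 + \<kappa>) \<le> t powr (2 + \<delta> + \<kappa>)" using False assms by (intro powr_mono) auto
      then show "t powr (2 + \<kappa>) \<le> t powr (1/2) + t powr (2 + \<delta> + \<kappa>)" by (simp add: add_increasing)
    qed (use assms in auto)
    finally show ?thesis .
  qed
  have "\<bar>t powr a - t powr 2\<bar> \<le> \<bar>a * ln t - 2 * ln t\<bar> * (t powr a + t powr 2)"
    using exp_diff[of "a * ln t" "2 * ln t"] assms by (simp add: powr_def)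
  also have "\<bar>a * ln t - 2 * ln t\<bar> = (2 - a) * \<bar>ln t\<bar>"
    using assms by (simp add: left_diff_distrib[symmetric] abs_mult)
  also have "(2 - a) * \<bar>ln t\<bar> * (t powr a + t powr 2) = (2 - a) * (\<bar>ln t\<bar> * t powr a + \<bar>ln t\<bar> * t powr 2)"
    by (simp add: algebra_simps)
  also have "\<dots> \<le> (2 - a) * (2 * ((2 + 1/\<kappa>) * (t powr (1/2) + t powr (2 + \<delta> + \<kappa>))))"
    using lb[of a] lb[of 2] assms by (intro mult_left_mono) auto
  also have "\<dots> = (2 - a) * (2 * (2 + 1/\<kappa>)) * (t powr (1/2) + t powr (2 + \<delta> + \<kappa>))"
    by (simp only: mult.assoc)
  finally show ?thesis .
qed

text \<open>With |\<eta>| = \<epsilon> t, the two scaled terms become t powr (2s) and t powr 2 times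
  the quotients A and A1 compared in (H2). In t powr (2s) (A - A1) + (t powr (2s) - t powr 2) A1 the
  first summand is controlled by (H2) and the second by \<open>powr_diff_le\<close>, as A1 is
  bounded by M.\<close>

lemma symbol_difference:
  fixes \<eta> :: "'a::euclidean_space" and z z1 :: complex
  assumes "0 < \<epsilon>" "\<epsilon> \<le> 1" "0 < t" "norm \<eta> = \<epsilon> * t" "0 < \<delta>" "0 < \<kappa>" "1/2 < s" "s < 1" "0 \<le> Q" "0 \<le> M"
    and z1: "norm z1 \<le> M * (norm \<eta>)\<^sup>2"
    and d: "norm (z / complex_of_real (norm \<eta> powr (2 * s)) - z1 / complex_of_real ((norm \<eta>)\<^sup>2))
       \<le> Q * (1 - s) * norm \<eta> powr \<delta> * max 1 \<bar>ln (norm \<eta>)\<bar>"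
  shows "norm (complex_of_real (\<epsilon> powr (- (2 * s))) * z - complex_of_real (\<epsilon> powr (- 2)) * z1)
     \<le> (Q * (1 + 1/\<delta> + 1/\<kappa>) + 4 * M * (2 + 1/\<kappa>)) * (1 - s) * (t powr (1/2) + t powr (2 + \<delta> + \<kappa>))"
proof -
  define n where "n = norm \<eta>"
  have n: "0 < n" "n \<le> t" "n = \<epsilon> * t" using assms by (auto simp: n_def mult_left_le_one_le)
  define A where "A = z / complex_of_real (n powr (2 * s))"
  define A1 where "A1 = z1 / complex_of_real (n\<^sup>2)"
  have A1: "norm A1 \<le> M"
    using z1 n(1) unfolding A1_def n_def[symmetric]
    by (simp add: norm_divide norm_power divide_le_eq)
  let ?T = "t powr (1/2) + t powr (2 + \<delta> + \<kappa>)"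
  have T: "?T \<ge> 0" by simp
  have e1: "complex_of_real (\<epsilon> powr (- (2 * s))) * z = complex_of_real (t powr (2 * s)) * A"
    using assms n by (simp add: A_def powr_mult powr_minus field_simps)
  have e2: "complex_of_real (\<epsilon> powr (- 2)) * z1 = complex_of_real (t powr 2) * A1"
    using assms n by (simp add: A1_def powr_minus power_mult_distrib field_simps powr_numeral)
  have "complex_of_real (\<epsilon> powr (- (2 * s))) * z - complex_of_real (\<epsilon> powr (- 2)) * z1
      = complex_of_real (t powr (2 * s)) * (A - A1) + complex_of_real (t powr (2 * s) - t powr 2) * A1"
    unfolding e1 e2 by (simp add: algebra_simps)
  also have "norm \<dots> \<le> t powr (2 * s) * norm (A - A1) + \<bar>t powr (2 * s) - t powr 2\<bar> * norm A1"
    by (rule order_trans[OF norm_triangle_ineq]) (simp add: norm_mult del: of_real_diff)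
  also have "\<dots> \<le> Q * (1 - s) * ((1 + 1/\<delta> + 1/\<kappa>) * ?T) + ((2 - 2 * s) * (2 * (2 + 1/\<kappa>)) * ?T) * M"
  proof (rule add_mono)
    have "t powr (2 * s) * norm (A - A1) \<le> t powr (2 * s) * (Q * (1 - s) * n powr \<delta> * max 1 \<bar>ln n\<bar>)"
      using d unfolding A_def A1_def n_def by (intro mult_left_mono) auto
    also have "\<dots> = Q * (1 - s) * (t powr (2 * s) * (n powr \<delta> * max 1 \<bar>ln n\<bar>))" by (simp add: mult_ac)
    also have "\<dots> \<le> Q * (1 - s) * ((1 + 1/\<delta> + 1/\<kappa>) * ?T)"
      using assms n by (intro mult_left_mono powr_log_weight_le) auto
    finally show "t powr (2 * s) * norm (A - A1) \<le> Q * (1 - s) * ((1 + 1/\<delta> + 1/\<kappa>) * ?T)" .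
    show "\<bar>t powr (2 * s) - t powr 2\<bar> * norm A1 \<le> ((2 - 2 * s) * (2 * (2 + 1/\<kappa>)) * ?T) * M"
      using assms A1 T by (intro mult_mono powr_diff_le mult_nonneg_nonneg) auto
  qed
  also have "\<dots> = (Q * (1 + 1/\<delta> + 1/\<kappa>) + 4 * M * (2 + 1/\<kappa>)) * (1 - s) * ?T"
  proof -
    have "Q * (1 - s) * (c * T) + ((2 - 2 * s) * (2 * c') * T) * M = (Q * c + 4 * M * c') * (1 - s) * T"
      for c c' T :: real by algebra
    then show ?thesis .
  qed
  finally show ?thesis .
qed

section \<open>The mass of thin slabs, measured by Gaussians\<close>

text \<open>Directions violating the bound for \<open>A \<rightarrow> \<infinity>\<close> would accumulate at one whose hyperplane is not null.\<close>

lemma slab_mass_small: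
  fixes J :: "'a::euclidean_space \<Rightarrow> real"
  assumes J: "prob_density J" and "\<kappa> > 0"
  shows "\<exists>A\<ge>1. \<forall>\<omega>. norm \<omega> = 1 \<longrightarrow> (LBINT x. J x * exp (- (A * (x \<bullet> \<omega>))\<^sup>2 / 2)) \<le> \<kappa>"
proof (rule ccontr)
  assume "\<not> ?thesis"
  then have neg: "\<not> (1 \<le> A \<and> (\<forall>\<omega>. norm \<omega> = 1 \<longrightarrow> (LBINT x. J x * exp (- (A * (x \<bullet> \<omega>))\<^sup>2 / 2)) \<le> \<kappa>))" for A
    by blast
  have "\<exists>\<omega>. norm \<omega> = 1 \<and> \<kappa> < (LBINT x. J x * exp (- ((1 + real n) * (x \<bullet> \<omega>))\<^sup>2 / 2))" for n
    using neg[of "1 + real n"] unfolding de_Morgan_conj not_all not_imp not_le by auto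
  then obtain w where w: "\<And>n. norm (w n) = 1"
      "\<And>n. \<kappa> < (LBINT x. J x * exp (- ((1 + real n) * (x \<bullet> w n))\<^sup>2 / 2))"
    by metis
  have Ji: "integrable lborel J" and Jn: "\<And>x. 0 \<le> J x" using J by (auto simp: prob_density_def)
  have [measurable]: "J \<in> borel_measurable borel" using Ji by auto
  have "compact (sphere (0::'a) 1)" by simp
  then obtain \<omega> r where \<omega>: "\<omega> \<in> sphere 0 1" and r: "strict_mono r" and lim: "(w \<circ> r) \<longlonglongrightarrow> \<omega>"
    using w(1) unfolding compact_def by (metis mem_sphere_0)
  have "\<omega> \<noteq> 0" using \<omega> by auto
  have ae: "AE x in lborel. x \<bullet> \<omega> \<noteq> 0"
  proof -
    have "negligible {x. \<omega> \<bullet> x = 0}" using \<open>\<omega> \<noteq> 0\<close> by (intro negligible_hyperplane) auto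
    then have "AE x in lborel. x \<notin> {x. \<omega> \<bullet> x = 0}"
      by (metis AE_completion_iff AE_not_in negligible_iff_null_sets)
    then show ?thesis by (simp add: inner_commute)
  qed
  have "(\<lambda>n. \<integral>x. J x * exp (- ((1 + real (r n)) * (x \<bullet> w (r n)))\<^sup>2 / 2) \<partial>lborel) \<longlonglongrightarrow> (\<integral>x. 0 \<partial>(lborel :: 'a measure))"
  proof (rule integral_dominated_convergence[where w=J])
    show "AE x in lborel. (\<lambda>n. J x * exp (- ((1 + real (r n)) * (x \<bullet> w (r n)))\<^sup>2 / 2)) \<longlonglongrightarrow> 0"
      using ae
    proof eventually_elim
      case (elim x)
      have "(\<lambda>n. \<bar>x \<bullet> w (r n)\<bar>) \<longlonglongrightarrow> \<bar>x \<bullet> \<omega>\<bar>"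
        using lim by (intro tendsto_intros) (simp add: o_def)
      moreover have "filterlim (\<lambda>n. 1 + real (r n)) at_top sequentially"
        by (intro filterlim_tendsto_add_at_top[OF tendsto_const]
            filterlim_compose[OF filterlim_real_sequentially] filterlim_subseq r)
      ultimately have "filterlim (\<lambda>n. \<bar>x \<bullet> w (r n)\<bar> * (1 + real (r n))) at_top sequentially"
        using elim by (intro filterlim_tendsto_pos_mult_at_top) auto
      then have "filterlim (\<lambda>n. (\<bar>x \<bullet> w (r n)\<bar> * (1 + real (r n)))\<^sup>2) at_top sequentially"
        by (intro filterlim_pow_at_top) auto
      then have "filterlim (\<lambda>n. (1/2) * (\<bar>x \<bullet> w (r n)\<bar> * (1 + real (r n)))\<^sup>2) at_top sequentially"
        by (intro filterlim_tendsto_pos_mult_at_top[OF tendsto_const]) auto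
      then have "(\<lambda>n. exp (- ((1/2) * (\<bar>x \<bullet> w (r n)\<bar> * (1 + real (r n)))\<^sup>2))) \<longlonglongrightarrow> 0"
        by (intro filterlim_compose[OF exp_at_bot]) (simp add: filterlim_uminus_at_bot)
      then have "(\<lambda>n. J x * exp (- ((1/2) * (\<bar>x \<bullet> w (r n)\<bar> * (1 + real (r n)))\<^sup>2))) \<longlonglongrightarrow> J x * 0"
        by (intro tendsto_intros)
      then show ?case by (simp add: power_mult_distrib mult_ac)
    qed
    show "AE x in lborel. norm (J x * exp (- ((1 + real (r n)) * (x \<bullet> w (r n)))\<^sup>2 / 2)) \<le> J x" for n
      using Jn by (intro AE_I2) (auto simp: abs_mult mult_left_le)
  qed (use Ji in auto)
  then have "\<kappa> \<le> 0"
    by (intro LIMSEQ_le_const[where X="\<lambda>n. \<integral>x. J x * exp (- ((1 + real (r n)) * (x \<bullet> w (r n)))\<^sup>2 / 2) \<partial>lborel"])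
       (use w(2) less_imp_le in auto)
  then show False using \<open>\<kappa> > 0\<close> by simp
qed

text \<open>The Gaussian in x . \<omega> is the characteristic function of a standard normal
  variable, so by Fubini the mass of a soft slab is an average of the transform of J along the line
  of \<omega>.\<close>

lemma slab_mass_fourier:
  fixes J :: "'a::euclidean_space \<Rightarrow> real"
  assumes "integrable lborel J"
  shows "complex_of_real (sqrt (2 * pi) * (LBINT x. J x * exp (- (A * (x \<bullet> \<omega>))\<^sup>2 / 2)))
     = (LBINT t. complex_of_real (exp (- t\<^sup>2 / 2)) * fourier J ((A * t) *\<^sub>R \<omega>))" (is ?eq)
    and "integrable lborel (\<lambda>t. complex_of_real (exp (- t\<^sup>2 / 2)) * fourier J ((A * t) *\<^sub>R \<omega>))"
proof -
  have Jc: "integrable lborel (\<lambda>x. complex_of_real (J x))" using assms by auto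
  have gi: "integrable lborel (\<lambda>t::real. complex_of_real (exp (- t\<^sup>2 / 2)))"
    using gaussian_1d(1)[of 0] by simp
  have c: "continuous_on UNIV (\<lambda>z::'a \<times> real. - (A * (fst z \<bullet> \<omega>) * snd z))"
    and c': "continuous_on UNIV (\<lambda>z::real \<times> 'a. - (A * (snd z \<bullet> \<omega>) * fst z))"
    by (intro continuous_intros)+
  have F: "fourier J ((A * t) *\<^sub>R \<omega>) = (LBINT x. complex_of_real (J x) * cis (- (A * (x \<bullet> \<omega>) * t)))" for t
    by (simp add: fourier_def mult_ac)
  have G: "complex_of_real (sqrt (2 * pi) * exp (- (A * (x \<bullet> \<omega>))\<^sup>2 / 2))
     = (LBINT t. complex_of_real (exp (- t\<^sup>2 / 2)) * cis (- (A * (x \<bullet> \<omega>) * t)))" for x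
    using gaussian_1d(2)[of "- (A * (x \<bullet> \<omega>))"] by (simp add: mult_ac)
  have "complex_of_real (sqrt (2 * pi) * (LBINT x. J x * exp (- (A * (x \<bullet> \<omega>))\<^sup>2 / 2)))
     = (LBINT x. complex_of_real (J x) * complex_of_real (sqrt (2 * pi) * exp (- (A * (x \<bullet> \<omega>))\<^sup>2 / 2)))"
    by (subst integral_mult_right_zero[symmetric], subst integral_complex_of_real[symmetric]) (simp add: mult_ac)
  also have "\<dots> = (LBINT t. complex_of_real (exp (- t\<^sup>2 / 2)) * fourier J ((A * t) *\<^sub>R \<omega>))"
    unfolding G F using fubini_phase(1)[OF Jc gi c] by simp
  finally show ?eq .
  show "integrable lborel (\<lambda>t. complex_of_real (exp (- t\<^sup>2 / 2)) * fourier J ((A * t) *\<^sub>R \<omega>))"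
    unfolding F using fubini_phase(2)[OF gi Jc c'] by simp
qed

text \<open>This is why slabs are measured softly: the dual weight is again a Gaussian, so a
  difference of transforms of polynomial growth is harmless. N is a natural number to match the
  absolute moments of the normal density.\<close>

lemma slab_mass_transfer:
  fixes J J1 :: "'a::euclidean_space \<Rightarrow> real"
  assumes J: "integrable lborel J" "integrable lborel J1" and "norm \<omega> = 1" "0 \<le> A"
    and D: "\<And>\<eta>. norm (fourier J \<eta> - fourier J1 \<eta>) \<le> D * (1 + norm \<eta> ^ N)"
  shows "(LBINT x. J x * exp (- (A * (x \<bullet> \<omega>))\<^sup>2 / 2))
     \<le> (LBINT x. J1 x * exp (- (A * (x \<bullet> \<omega>))\<^sup>2 / 2))
       + D * (LBINT t. std_normal_density t * (1 + A ^ N * \<bar>t\<bar> ^ N))"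
proof -
  define I where "I = (\<lambda>f. \<integral>x. f x * exp (- (A * (x \<bullet> \<omega>))\<^sup>2 / 2) \<partial>(lborel :: 'a measure))"
  let ?g = "\<lambda>t. complex_of_real (exp (- t\<^sup>2 / 2))"
  have i: "integrable lborel (\<lambda>t. std_normal_density t * (1 + A ^ N * \<bar>t\<bar> ^ N))"
    using integrable_std_normal_moment_abs[of N]
    by (simp add: distrib_left mult.left_commute[of _ "A ^ N"])
  have "complex_of_real (sqrt (2 * pi) * (I J - I J1)) =
      (LBINT t. ?g t * fourier J ((A * t) *\<^sub>R \<omega>) - ?g t * fourier J1 ((A * t) *\<^sub>R \<omega>))"
    using slab_mass_fourier[OF J(1), of A \<omega>] slab_mass_fourier[OF J(2), of A \<omega>]
    by (simp add: I_def right_diff_distrib)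
  then have "norm (complex_of_real (sqrt (2 * pi) * (I J - I J1))) =
      norm (LBINT t. ?g t * fourier J ((A * t) *\<^sub>R \<omega>) - ?g t * fourier J1 ((A * t) *\<^sub>R \<omega>))"
    by (simp only:)
  also have "\<dots> \<le> (LBINT t. sqrt (2 * pi) * (D * (std_normal_density t * (1 + A ^ N * \<bar>t\<bar> ^ N))))"
  proof (rule order_trans[OF integral_norm_bound integral_mono_AE'])
    show "integrable lborel (\<lambda>t. sqrt (2 * pi) * (D * (std_normal_density t * (1 + A ^ N * \<bar>t\<bar> ^ N))))"
      by (intro integrable_mult_right i)
    have "norm (?g t * fourier J ((A * t) *\<^sub>R \<omega>) - ?g t * fourier J1 ((A * t) *\<^sub>R \<omega>))
        \<le> sqrt (2 * pi) * (D * (std_normal_density t * (1 + A ^ N * \<bar>t\<bar> ^ N)))" for t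
    proof -
      have "norm (?g t * fourier J ((A * t) *\<^sub>R \<omega>) - ?g t * fourier J1 ((A * t) *\<^sub>R \<omega>))
         = exp (- t\<^sup>2 / 2) * norm (fourier J ((A * t) *\<^sub>R \<omega>) - fourier J1 ((A * t) *\<^sub>R \<omega>))"
        by (simp only: right_diff_distrib[symmetric] norm_mult norm_of_real abs_exp_cancel)
      also have "\<dots> \<le> exp (- t\<^sup>2 / 2) * (D * (1 + norm ((A * t) *\<^sub>R \<omega>) ^ N))"
        by (intro mult_left_mono D) auto
      also have "\<dots> = sqrt (2 * pi) * (D * (std_normal_density t * (1 + A ^ N * \<bar>t\<bar> ^ N)))"
        using assms by (simp add: std_normal_density_def abs_mult power_mult_distrib mult_ac)
      finally show ?thesis .
    qed
    then show "AE t in lborel. norm (?g t * fourier J ((A * t) *\<^sub>R \<omega>) - ?g t * fourier J1 ((A * t) *\<^sub>R \<omega>))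
        \<le> sqrt (2 * pi) * (D * (std_normal_density t * (1 + A ^ N * \<bar>t\<bar> ^ N)))"
      and "AE t in lborel. 0 \<le> sqrt (2 * pi) * (D * (std_normal_density t * (1 + A ^ N * \<bar>t\<bar> ^ N)))"
      by (intro AE_I2; (blast intro: order_trans[OF norm_ge_zero])?)+
  qed
  also have "\<dots> = sqrt (2 * pi) * (D * (LBINT t. std_normal_density t * (1 + A ^ N * \<bar>t\<bar> ^ N)))"
    by simp
  finally have "sqrt (2 * pi) * \<bar>I J - I J1\<bar> \<le> sqrt (2 * pi) * (D * (LBINT t. std_normal_density t * (1 + A ^ N * \<bar>t\<bar> ^ N)))"
    by (simp only: norm_of_real abs_mult) simp
  then have "\<bar>I J - I J1\<bar> \<le> D * (LBINT t. std_normal_density t * (1 + A ^ N * \<bar>t\<bar> ^ N))"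
    by (simp add: mult_le_cancel_left_pos)
  then show ?thesis unfolding I_def by linarith
qed

section \<open>Lower bounds for the exponent\<close>

lemma Re_relax_rate:
  "Re (relax_rate J a \<epsilon> \<xi> r) = \<epsilon> powr (- a) / r * Re (1 - fourier J ((\<epsilon> * r) *\<^sub>R \<xi>))"
  by (simp add: relax_rate_def)

lemma Re_1_minus_fourier_nonneg: "prob_density f \<Longrightarrow> 0 \<le> Re (1 - fourier f \<xi>)"
  using complex_Re_le_cmod[of "fourier f \<xi>"] norm_fourier_le_1[of f \<xi>] by simp

lemma Re_relax_rate_nonneg: "prob_density J \<Longrightarrow> 0 \<le> r \<Longrightarrow> 0 \<le> Re (relax_rate J a \<epsilon> \<xi> r)"
  unfolding Re_relax_rate by (intro mult_nonneg_nonneg Re_1_minus_fourier_nonneg) auto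

context
  fixes J :: "'a::euclidean_space \<Rightarrow> real" and M a \<epsilon> :: real
  assumes J: "prob_density J" and M: "\<And>\<eta>. norm (1 - fourier J \<eta>) \<le> M * norm \<eta> powr a"
    and \<epsilon>: "0 < \<epsilon>" and a: "1 < a" "a \<le> 2"
begin

lemma relax_rate_integrable: "relax_rate J a \<epsilon> \<xi> integrable_on {0..1}"
  by (intro integrable_continuous_interval continuous_on_subset[OF continuous_on_relax_rate[OF J M \<epsilon> a(1)]]) auto

lemma Re_relax_rate_integrable:
  assumes "0 \<le> p" "q \<le> 1"
  shows "(\<lambda>r. Re (relax_rate J a \<epsilon> \<xi> r)) integrable_on {p..q}"
  by (intro integrable_continuous_interval continuous_on_Re continuous_on_subset[OF continuous_on_relax_rate[OF J M \<epsilon> a(1)]])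
     (use assms in auto)

lemma Re_log_symbol: "Re (log_symbol J a \<epsilon> \<xi>) = integral {0..1} (\<lambda>r. Re (relax_rate J a \<epsilon> \<xi> r))"
  unfolding log_symbol_def
  using integral_unique[OF has_integral_linear[OF integrable_integral[OF relax_rate_integrable[of \<xi>]] bounded_linear_Re]]
  by (simp add: o_def)

lemma Re_log_symbol_ge_part:
  assumes "0 \<le> p" "q \<le> 1"
  shows "integral {p..q} (\<lambda>r. Re (relax_rate J a \<epsilon> \<xi> r)) \<le> Re (log_symbol J a \<epsilon> \<xi>)"
  unfolding Re_log_symbol
  by (rule integral_subset_le) (use assms J Re_relax_rate_integrable Re_relax_rate_nonneg in auto)

lemma Re_log_symbol_nonneg: "0 \<le> Re (log_symbol J a \<epsilon> \<xi>)"
  using Re_log_symbol_ge_part[of 1 1 \<xi>] by simp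

lemma norm_log_symbol_le: "norm (log_symbol J a \<epsilon> \<xi>) \<le> M * norm \<xi> powr a"
proof -
  have B0: "0 \<le> M * norm \<xi> powr a" by (rule order_trans[OF norm_ge_zero M])
  have "((\<lambda>r. r powr (a - 1)) has_integral 1 powr (a - 1 + 1) / (a - 1 + 1)) {0..1}"
    using a by (intro has_integral_powr_from_0) auto
  then have hi: "((\<lambda>r. M * norm \<xi> powr a * r powr (a - 1)) has_integral M * norm \<xi> powr a * (1 / a)) {0..1}"
    by (intro has_integral_mult_right) simp
  have "norm (log_symbol J a \<epsilon> \<xi>) \<le> integral {0..1} (\<lambda>r. M * norm \<xi> powr a * r powr (a - 1))"
    unfolding log_symbol_def
  proof (rule integral_norm_bound_integral[OF relax_rate_integrable has_integral_integrable[OF hi]])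
    fix r :: real assume "r \<in> {0..1}"
    then show "norm (relax_rate J a \<epsilon> \<xi> r) \<le> M * norm \<xi> powr a * r powr (a - 1)"
      by (intro norm_relax_rate_le M \<epsilon>) auto
  qed
  also have "\<dots> = M * norm \<xi> powr a * (1 / a)" using hi by (rule integral_unique)
  also have "\<dots> \<le> M * norm \<xi> powr a" using a B0 by (intro mult_left_le) auto
  finally show ?thesis .
qed

text \<open>The part r \<le> \<rho> of the integral suffices; 1/4 comes from 1 / (2 a) with a \<le>
  2. It is applied with \<rho> = 1 when \<epsilon> |\<xi>| is below a threshold, and otherwise with
  \<rho> \<epsilon> |\<xi>| equal to that threshold.\<close>

lemma Re_log_symbol_ge_near_zero:
  assumes \<rho>: "0 < \<rho>" "\<rho> \<le> 1"
    and near: "\<And>\<eta>. norm \<eta> \<le> \<rho> * (\<epsilon> * norm \<xi>) \<Longrightarrow> norm \<eta> powr a / 2 \<le> Re (1 - fourier J \<eta>)"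
  shows "(\<rho> * norm \<xi>) powr a / 4 \<le> Re (log_symbol J a \<epsilon> \<xi>)"
proof -
  have "((\<lambda>r. r powr (a - 1)) has_integral \<rho> powr (a - 1 + 1) / (a - 1 + 1)) {0..\<rho>}"
    using a \<rho> by (intro has_integral_powr_from_0) auto
  then have hi: "((\<lambda>r. norm \<xi> powr a / 2 * r powr (a - 1)) has_integral norm \<xi> powr a / 2 * (\<rho> powr a / a)) {0..\<rho>}"
    by (intro has_integral_mult_right) simp
  have "(\<rho> * norm \<xi>) powr a / 4 = norm \<xi> powr a * \<rho> powr a / 4"
    using \<rho> by (simp add: powr_mult mult.commute)
  also have "\<dots> \<le> norm \<xi> powr a * \<rho> powr a / (2 * a)"
    using a by (intro divide_left_mono) auto
  also have "\<dots> = integral {0..\<rho>} (\<lambda>r. norm \<xi> powr a / 2 * r powr (a - 1))"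
    using integral_unique[OF hi] by simp
  also have "\<dots> \<le> integral {0..\<rho>} (\<lambda>r. Re (relax_rate J a \<epsilon> \<xi> r))"
  proof (rule integral_le[OF has_integral_integrable[OF hi] Re_relax_rate_integrable])
    fix r assume r: "r \<in> {0..\<rho>}"
    show "norm \<xi> powr a / 2 * r powr (a - 1) \<le> Re (relax_rate J a \<epsilon> \<xi> r)"
    proof (cases "r = 0")
      case False
      then have "r > 0" using r by auto
      have "norm \<xi> powr a / 2 * r powr (a - 1) = \<epsilon> powr (- a) / r * (norm ((\<epsilon> * r) *\<^sub>R \<xi>) powr a / 2)"
        using \<open>r > 0\<close> \<epsilon> by (simp add: abs_mult powr_mult powr_minus powr_diff field_simps)
      also have "\<dots> \<le> \<epsilon> powr (- a) / r * Re (1 - fourier J ((\<epsilon> * r) *\<^sub>R \<xi>))"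
        using \<open>r > 0\<close> \<epsilon> r by (intro mult_left_mono near) (auto simp: abs_mult mult_right_mono mult.assoc[symmetric] mult.commute[of _ \<epsilon>])
      finally show ?thesis unfolding Re_relax_rate .
    qed (simp add: Re_relax_rate)
  qed (use \<rho> in auto)
  also have "\<dots> \<le> Re (log_symbol J a \<epsilon> \<xi>)" using \<rho> by (intro Re_log_symbol_ge_part) auto
  finally show ?thesis .
qed

end

text \<open>The integrand dominates an exact derivative, that of ln r - sin (r u) / (r u) + 1 / (r
  u) with u = |w|: the surplus (sin (r u) - 1) / (r^2 u) is nonpositive. The boundary term at r = 1
  is nonnegative, and the one at r = 1/U costs at most 2 besides ln U.\<close>

lemma cosine_integral_ge:
  fixes U w :: real
  assumes U: "1 \<le> U" "U \<le> \<bar>w\<bar>"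
  shows "ln U - 2 \<le> (LBINT r. indicator {1/U..1} r * ((1 - cos (r * w)) / r))"
proof -
  define u where "u = \<bar>w\<bar>"
  have u: "U \<le> u" "u > 0" "u \<ge> 1" using U by (auto simp: u_def)
  have cw: "cos (r * w) = cos (r * u)" for r by (simp add: u_def abs_if)
  have c: "continuous_on {1/U..1} (\<lambda>r. 1 / r - cos (r * u) / r + sin (r * u) / (r\<^sup>2 * u) - 1 / (r\<^sup>2 * u))"
    using U u by (intro continuous_intros) auto
  have c2: "continuous_on {1/U..1} (\<lambda>r. (1 - cos (r * w)) / r)"
    using U by (intro continuous_intros) auto
  have pos: "r > 0" if "r \<in> {1/U..1}" for r using that U by (auto intro: less_le_trans[of 0 "1/U"])
  have "(LBINT r. indicator {1/U..1} r *\<^sub>R (1 / r - cos (r * u) / r + sin (r * u) / (r\<^sup>2 * u) - 1 / (r\<^sup>2 * u)))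
     = (ln 1 - sin (1 * u) / (1 * u) + 1 / (1 * u)) - (ln (1/U) - sin (1/U * u) / (1/U * u) + 1 / (1/U * u))"
  proof (rule integral_FTC_atLeastAtMost[OF _ _ c])
    show "1/U \<le> 1" using U by simp
    fix r assume "1/U \<le> r" "r \<le> 1"
    then have "r > 0" using pos by auto
    then show "((\<lambda>r. ln r - sin (r * u) / (r * u) + 1 / (r * u)) has_vector_derivative
        1 / r - cos (r * u) / r + sin (r * u) / (r\<^sup>2 * u) - 1 / (r\<^sup>2 * u)) (at r within {1/U..1})"
      unfolding has_real_derivative_iff_has_vector_derivative[symmetric]
      using u by (auto intro!: derivative_eq_intros simp: power2_eq_square field_simps)
  qed
  moreover have "(LBINT r. indicator {1/U..1} r *\<^sub>R (1 / r - cos (r * u) / r + sin (r * u) / (r\<^sup>2 * u) - 1 / (r\<^sup>2 * u)))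
     \<le> (LBINT r. indicator {1/U..1} r * ((1 - cos (r * w)) / r))"
  proof (rule integral_mono)
    show "integrable lborel (\<lambda>r. indicator {1/U..1} r *\<^sub>R (1 / r - cos (r * u) / r + sin (r * u) / (r\<^sup>2 * u) - 1 / (r\<^sup>2 * u)))"
      using borel_integrable_atLeastAtMost'[OF c] by (simp add: set_integrable_def)
    show "integrable lborel (\<lambda>r. indicator {1/U..1} r * ((1 - cos (r * w)) / r))"
      using borel_integrable_atLeastAtMost'[OF c2] by (simp add: set_integrable_def)
    fix r
    show "indicator {1/U..1} r *\<^sub>R (1 / r - cos (r * u) / r + sin (r * u) / (r\<^sup>2 * u) - 1 / (r\<^sup>2 * u))
       \<le> indicator {1/U..1} r * ((1 - cos (r * w)) / r)"
    proof (cases "r \<in> {1/U..1}")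
      case True
      have "sin (r * u) / (r\<^sup>2 * u) \<le> 1 / (r\<^sup>2 * u)"
        using pos[OF True] u by (intro divide_right_mono) auto
      then show ?thesis using True by (simp add: cw diff_divide_distrib)
    qed simp
  qed
  moreover have "ln U - 2 \<le> (ln 1 - sin (1 * u) / (1 * u) + 1 / (1 * u)) - (ln (1/U) - sin (1/U * u) / (1/U * u) + 1 / (1/U * u))"
  proof -
    have "sin u / u \<le> 1 / u" using u by (intro divide_right_mono) auto
    moreover have "- 1 \<le> sin (u / U) / (u / U)"
    proof -
      have "\<bar>sin (u / U)\<bar> \<le> u / U" using abs_sin_x_le_abs_x[of "u/U"] u U by simp
      then have "- (u / U) \<le> sin (u / U)" by linarith
      then show ?thesis using u U by (simp add: field_simps)
    qed
    moreover have "1 / (u / U) \<le> 1" using u U by (simp add: field_simps)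
    ultimately show ?thesis using U by (simp add: ln_div)
  qed
  ultimately show ?thesis by linarith
qed

text \<open>Fubini moves the integral in r inside the integral against J. A jump y with |A (y .
  \<omega>)| \<ge> 1 oscillates with frequency at least U = \<epsilon> |\<xi>| / A and contributes
  ln U - 2 by \<open>cosine_integral_ge\<close>; every other jump contributes at least 0. If the
  logarithm is too small to help, nonnegativity of the exponent is enough.\<close>

lemma Re_log_symbol_ge_log:
  fixes J :: "'a::euclidean_space \<Rightarrow> real"
  assumes J: "prob_density J" and M: "\<And>\<eta>. norm (1 - fourier J \<eta>) \<le> M * norm \<eta> powr a"
    and \<epsilon>: "0 < \<epsilon>" and a: "1 < a" "a \<le> 2" and A: "A \<ge> 1" and "\<xi> \<noteq> 0" and \<kappa>: "2 * \<kappa> \<le> 1"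
    and slab: "\<And>\<omega>. norm \<omega> = 1 \<Longrightarrow> (LBINT x. J x * exp (- (A * (x \<bullet> \<omega>))\<^sup>2 / 2)) \<le> \<kappa>"
  shows "\<epsilon> powr (- a) * ((1 - 2 * \<kappa>) * (ln (\<epsilon> * norm \<xi>) - ln A - 2)) \<le> Re (log_symbol J a \<epsilon> \<xi>)"
proof (cases "ln (\<epsilon> * norm \<xi>) - ln A - 2 \<le> 0")
  case True
  then have "\<epsilon> powr (- a) * ((1 - 2 * \<kappa>) * (ln (\<epsilon> * norm \<xi>) - ln A - 2)) \<le> 0"
    using \<kappa> by (intro mult_nonneg_nonpos) auto
  then show ?thesis using Re_log_symbol_nonneg[OF J M \<epsilon> a, of \<xi>] by linarith
next
  case False
  have Ji: "integrable lborel J" and Jn: "\<And>x. 0 \<le> J x" and J1: "integral\<^sup>L lborel J = 1"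
    using J by (auto simp: prob_density_def)
  have [measurable]: "J \<in> borel_measurable borel" using Ji by auto
  define T where "T = \<epsilon> * norm \<xi>"
  define U where "U = T / A"
  define \<omega> where "\<omega> = (1 / norm \<xi>) *\<^sub>R \<xi>"
  have T: "T > 0" using \<epsilon> \<open>\<xi> \<noteq> 0\<close> by (simp add: T_def)
  have "norm \<omega> = 1" using \<open>\<xi> \<noteq> 0\<close> by (simp add: \<omega>_def)
  have lnU: "ln U = ln T - ln A" using T A by (simp add: U_def ln_div)
  then have lnU2: "ln U > 2" using False by (simp add: T_def)
  have U: "U \<ge> 1"
  proof (rule ccontr)
    assume "\<not> U \<ge> 1"
    moreover have "U > 0" using T A by (simp add: U_def)
    ultimately have "ln U \<le> 0" by simp
    then show False using lnU2 by simp
  qed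
  define \<kappa>' where "\<kappa>' = (\<lambda>(y::'a) r. indicator {1/U..1} r * ((1 - cos (r * (y \<bullet> (\<epsilon> *\<^sub>R \<xi>)))) / r))"
  have m [measurable]: "case_prod \<kappa>' \<in> borel_measurable (borel \<Otimes>\<^sub>M borel)"
    unfolding \<kappa>'_def by measurable
  have \<kappa>'b: "\<bar>\<kappa>' y r\<bar> \<le> indicator {1/U..1} r * (2 * U)" for y r
  proof (cases "r \<in> {1/U..1}")
    case True
    then have "r > 0" using U by (auto intro: less_le_trans[of 0 "1/U"])
    have "\<bar>1 - cos (r * (y \<bullet> (\<epsilon> *\<^sub>R \<xi>)))\<bar> \<le> 2"
      using cos_le_one[of "r * (y \<bullet> (\<epsilon> *\<^sub>R \<xi>))"] cos_ge_minus_one[of "r * (y \<bullet> (\<epsilon> *\<^sub>R \<xi>))"]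
      by linarith
    then have "\<bar>1 - cos (r * (y \<bullet> (\<epsilon> *\<^sub>R \<xi>)))\<bar> / r \<le> 2 / (1 / U)"
      using True U by (intro frac_le) auto
    then show ?thesis using True \<open>r > 0\<close> by (simp add: \<kappa>'_def)
  qed (simp add: \<kappa>'_def)
  have ib: "integrable lborel (\<lambda>r::real. indicator {1/U..1} r * (2 * U))"
    using U by (intro integrable_mult_left) (auto simp: integrable_indicator_iff)
  have prod: "integrable (lborel \<Otimes>\<^sub>M lborel) (\<lambda>(y, r). J y * \<kappa>' y r)"
    by (rule integrable_tensor_bound[OF Ji ib m \<kappa>'b])
  have F: "(LBINT r. indicator {1/U..1} r * (1 / r * Re (1 - fourier J ((\<epsilon> * r) *\<^sub>R \<xi>))))
     = (LBINT y. J y * (LBINT r. \<kappa>' y r))"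
  proof -
    have "(LBINT r. indicator {1/U..1} r * (1 / r * Re (1 - fourier J ((\<epsilon> * r) *\<^sub>R \<xi>))))
       = (LBINT r. (LBINT y. J y * \<kappa>' y r))"
    proof (intro Bochner_Integration.integral_cong refl)
      fix r
      have "(LBINT y. J y * \<kappa>' y r) = (LBINT y. (indicator {1/U..1} r / r) * ((1 - cos (y \<bullet> ((\<epsilon> * r) *\<^sub>R \<xi>))) * J y))"
        by (intro Bochner_Integration.integral_cong refl) (simp add: \<kappa>'_def mult_ac)
      also have "\<dots> = (indicator {1/U..1} r / r) * Re (1 - fourier J ((\<epsilon> * r) *\<^sub>R \<xi>))"
        by (subst Re_1_minus_fourier[OF J]) (rule integral_mult_right_zero)
      finally show "indicator {1/U..1} r * (1 / r * Re (1 - fourier J ((\<epsilon> * r) *\<^sub>R \<xi>))) = (LBINT y. J y * \<kappa>' y r)"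
        by simp
    qed
    also have "\<dots> = (LBINT y. (LBINT r. J y * \<kappa>' y r))"
      by (rule lborel_pair.Fubini_integral[OF prod])
    finally show ?thesis by simp
  qed
  \<comment> \<open>1 - 2 exp (...) is a soft lower bound for the indicator of the complement of the
    slab: it never exceeds 1, and inside the slab it is nonpositive because exp (- 1/2) \<ge> 1/2.
    Hence the factor 1 - 2 \<kappa>.\<close>
  have low: "(ln U - 2) * (1 - 2 * exp (- (A * (y \<bullet> \<omega>))\<^sup>2 / 2)) \<le> (LBINT r. \<kappa>' y r)" for y
  proof (cases "1 \<le> \<bar>A * (y \<bullet> \<omega>)\<bar>")
    case True
    have yw: "y \<bullet> (\<epsilon> *\<^sub>R \<xi>) = T * (y \<bullet> \<omega>)" using \<open>\<xi> \<noteq> 0\<close> by (simp add: T_def \<omega>_def)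
    have "U \<le> \<bar>y \<bullet> (\<epsilon> *\<^sub>R \<xi>)\<bar>"
    proof -
      have "T * 1 \<le> T * \<bar>A * (y \<bullet> \<omega>)\<bar>" using True T by (intro mult_left_mono) auto
      then show ?thesis unfolding yw using T A by (simp add: U_def abs_mult field_simps)
    qed
    then have 1: "ln U - 2 \<le> (LBINT r. \<kappa>' y r)"
      unfolding \<kappa>'_def by (intro cosine_integral_ge U)
    have "(ln U - 2) * (1 - 2 * exp (- (A * (y \<bullet> \<omega>))\<^sup>2 / 2)) \<le> (ln U - 2) * 1"
      using lnU2 by (intro mult_left_mono) auto
    then show ?thesis unfolding mult_1_right using 1 by (rule order_trans)
  next
    case False
    then have "(A * (y \<bullet> \<omega>))\<^sup>2 \<le> 1" by (simp add: abs_square_le_1)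
    then have "- (1/2) \<le> - (A * (y \<bullet> \<omega>))\<^sup>2 / 2" by linarith
    moreover have "1/2 \<le> exp (- (1/2)::real)" using exp_ge_add_one_self[of "- (1/2)::real"] by simp
    ultimately have "1/2 \<le> exp (- (A * (y \<bullet> \<omega>))\<^sup>2 / 2)" by (meson exp_le_cancel_iff order_trans)
    then have "(ln U - 2) * (1 - 2 * exp (- (A * (y \<bullet> \<omega>))\<^sup>2 / 2)) \<le> 0"
      using lnU2 by (intro mult_nonneg_nonpos) linarith+
    also have "0 \<le> (LBINT r. \<kappa>' y r)"
      unfolding \<kappa>'_def using U
      by (intro integral_nonneg_AE AE_I2) (auto simp: indicator_def intro!: divide_nonneg_nonneg intro: order_trans[of 0 "1/U"])
    finally show ?thesis .
  qed
  have ie: "integrable lborel (\<lambda>y. J y * exp (- (A * (y \<bullet> \<omega>))\<^sup>2 / 2))"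
    by (rule integrable_density_mult[OF Ji, of _ 1]) auto
  have "(ln U - 2) * (1 - 2 * \<kappa>) \<le> (ln U - 2) * (1 - 2 * (LBINT x. J x * exp (- (A * (x \<bullet> \<omega>))\<^sup>2 / 2)))"
    using slab[OF \<open>norm \<omega> = 1\<close>] lnU2 by (intro mult_left_mono) auto
  also have "\<dots> = (LBINT y. J y * ((ln U - 2) * (1 - 2 * exp (- (A * (y \<bullet> \<omega>))\<^sup>2 / 2))))"
  proof -
    have "(LBINT y. J y * ((ln U - 2) * (1 - 2 * exp (- (A * (y \<bullet> \<omega>))\<^sup>2 / 2))))
       = (LBINT y. (ln U - 2) * (J y - 2 * (J y * exp (- (A * (y \<bullet> \<omega>))\<^sup>2 / 2))))"
      by (intro Bochner_Integration.integral_cong refl) (simp add: algebra_simps)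
    also have "\<dots> = (ln U - 2) * (1 - 2 * (LBINT x. J x * exp (- (A * (x \<bullet> \<omega>))\<^sup>2 / 2)))"
      using Ji ie J1 by simp
    finally show ?thesis ..
  qed
  also have "\<dots> \<le> (LBINT y. J y * (LBINT r. \<kappa>' y r))"
  proof (rule integral_mono)
    show "integrable lborel (\<lambda>y. J y * ((ln U - 2) * (1 - 2 * exp (- (A * (y \<bullet> \<omega>))\<^sup>2 / 2))))"
    proof -
      have "integrable lborel (\<lambda>y. (ln U - 2) * (J y - 2 * (J y * exp (- (A * (y \<bullet> \<omega>))\<^sup>2 / 2))))"
        by (intro integrable_mult_right Bochner_Integration.integrable_diff ie Ji)
      then show ?thesis by (simp add: algebra_simps)
    qed
    show "integrable lborel (\<lambda>y. J y * (LBINT r. \<kappa>' y r))"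
      using lborel_pair.integrable_fst[OF prod] by simp
  qed (intro mult_left_mono low Jn)
  also have "\<dots> = (LBINT r. indicator {1/U..1} r * (1 / r * Re (1 - fourier J ((\<epsilon> * r) *\<^sub>R \<xi>))))"
    by (rule F[symmetric])
  finally have main: "(ln U - 2) * (1 - 2 * \<kappa>) \<le> (LBINT r. indicator {1/U..1} r * (1 / r * Re (1 - fourier J ((\<epsilon> * r) *\<^sub>R \<xi>))))" .
  have c: "continuous_on {1/U..1} (\<lambda>r. Re (relax_rate J a \<epsilon> \<xi> r))"
    using U by (intro continuous_on_Re continuous_on_subset[OF continuous_on_relax_rate[OF J M \<epsilon> a(1)]])
      (auto intro: order_trans[of 0 "1/U"])
  have "\<epsilon> powr (- a) * ((ln U - 2) * (1 - 2 * \<kappa>)) \<le> \<epsilon> powr (- a) * (LBINT r. indicator {1/U..1} r * (1 / r * Re (1 - fourier J ((\<epsilon> * r) *\<^sub>R \<xi>))))"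
    by (intro mult_left_mono main) auto
  also have "\<dots> = (LBINT r. \<epsilon> powr (- a) * (indicator {1/U..1} r * (1 / r * Re (1 - fourier J ((\<epsilon> * r) *\<^sub>R \<xi>)))))"
    by (rule integral_mult_right_zero[symmetric])
  also have "\<dots> = (LINT r:{1/U..1}|lborel. Re (relax_rate J a \<epsilon> \<xi> r))"
    unfolding set_lebesgue_integral_def Re_relax_rate
    by (intro Bochner_Integration.integral_cong refl) (simp add: mult_ac)
  also have "\<dots> = integral {1/U..1} (\<lambda>r. Re (relax_rate J a \<epsilon> \<xi> r))"
    by (rule set_borel_integral_eq_integral(2)[OF borel_integrable_atLeastAtMost'[OF c]])
  also have "\<dots> \<le> Re (log_symbol J a \<epsilon> \<xi>)"
    using U by (intro Re_log_symbol_ge_part[OF J M \<epsilon> a]) auto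
  finally show ?thesis unfolding lnU T_def by (simp add: mult_ac)
qed

section \<open>Uniform decay\<close>

lemma ln_le_scaled:
  fixes \<eta> y :: real
  assumes "0 < \<eta>" "0 < y"
  shows "ln y \<le> \<eta> * y - ln \<eta>"
  using ln_le_minus_one[of "\<eta> * y"] assms by (simp add: ln_mult)

text \<open>The common shape of the expansions at frequency 0 in (H1), with a = 2s, and (H2), with a
  = 2, so that the same lemmas treat both kernels.\<close>

definition low_freq :: "('a::euclidean_space \<Rightarrow> real) \<Rightarrow> real \<Rightarrow> real \<Rightarrow> real \<Rightarrow> bool" where
  "low_freq J a \<delta> C \<longleftrightarrow> (\<forall>\<xi>. norm \<xi> \<le> 1 \<longrightarrow>
     norm (fourier J \<xi> - complex_of_real (1 - norm \<xi> powr a)) \<le> C * norm \<xi> powr (a + \<delta>))"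

text \<open>Outside the unit ball, where the expansion is silent, the trivial bound 2 is absorbed by
  the constant.\<close>

lemma low_freq_global:
  fixes J :: "'a::euclidean_space \<Rightarrow> real"
  assumes J: "prob_density J" and L: "low_freq J a \<delta> C" and "0 \<le> C" "0 < \<delta>" "0 < a"
  shows "norm (1 - fourier J \<eta>) \<le> (2 + C) * norm \<eta> powr a"
proof (cases "norm \<eta> \<le> 1")
  case True
  have "1 - fourier J \<eta> = complex_of_real (norm \<eta> powr a) - (fourier J \<eta> - complex_of_real (1 - norm \<eta> powr a))"
    by simp
  also have "norm \<dots> \<le> norm \<eta> powr a + C * norm \<eta> powr (a + \<delta>)"
    using L[unfolded low_freq_def, rule_format, OF True]
    by (intro order_trans[OF norm_triangle_ineq4[of "complex_of_real (norm \<eta> powr a)"]])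
       (rule add_mono, simp_all)
  also have "\<dots> \<le> norm \<eta> powr a + C * norm \<eta> powr a"
    using assms True by (intro add_left_mono mult_left_mono powr_mono') auto
  also have "\<dots> \<le> (2 + C) * norm \<eta> powr a" by (simp add: distrib_right)
  finally show ?thesis .
next
  case False
  then have "1 \<le> norm \<eta> powr a" using assms by (simp add: ge_one_powr_ge_zero)
  then have "(2 + C) * 1 \<le> (2 + C) * norm \<eta> powr a" using assms by (intro mult_left_mono) auto
  have "norm (1 - fourier J \<eta>) \<le> 2" by (rule norm_1_minus_fourier_le_2[OF J])
  also have "2 \<le> (2 + C) * 1" using assms by simp
  also note \<open>(2 + C) * 1 \<le> (2 + C) * norm \<eta> powr a\<close>
  finally show ?thesis .
qed

lemma low_freq_Re:
  fixes J :: "'a::euclidean_space \<Rightarrow> real"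
  assumes L: "low_freq J a \<delta> C" and C: "0 < C" "0 < \<delta>" and \<eta>: "norm \<eta> \<le> 1" "C * norm \<eta> powr \<delta> \<le> 1/2"
  shows "norm \<eta> powr a / 2 \<le> Re (1 - fourier J \<eta>)"
proof -
  have "\<bar>Re (fourier J \<eta> - complex_of_real (1 - norm \<eta> powr a))\<bar> \<le> C * norm \<eta> powr (a + \<delta>)"
    using L \<eta> unfolding low_freq_def by (blast intro: order_trans[OF abs_Re_le_cmod])
  also have "\<dots> = norm \<eta> powr a * (C * norm \<eta> powr \<delta>)" by (simp add: powr_add)
  also have "\<dots> \<le> norm \<eta> powr a * (1/2)" using \<eta> by (intro mult_left_mono) auto
  finally have "\<bar>Re (fourier J \<eta>) - (1 - norm \<eta> powr a)\<bar> \<le> norm \<eta> powr a / 2" by simp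
  then have "norm \<eta> powr a / 2 \<le> 1 - Re (fourier J \<eta>)" by linarith
  then show ?thesis by simp
qed

text \<open>For bounded rates the logarithmic lower bound alone gives the exponent \<open>\<gamma>\<close>; for large rates
  half of the rate pays for the factor \<open>\<epsilon> powr - \<gamma>\<close> hidden in passing from \<open>\<epsilon> * x\<close> to \<open>x\<close>.\<close>

lemma decay_arith:
  fixes \<gamma> \<gamma>1 b \<alpha> r0 c0 :: real
  assumes \<gamma>: "0 < \<gamma>" and b: "0 < b" "\<gamma> \<le> \<gamma>1 * b" and A: "1 \<le> A" and r0: "0 < r0" and c0: "0 < c0"
  shows "\<exists>C. \<forall>a \<epsilon> x g :: real. 1 \<le> a \<longrightarrow> 0 < \<epsilon> \<longrightarrow> \<epsilon> < 1 \<longrightarrow> \<gamma>1 \<le> \<epsilon> powr (- a) \<longrightarrow> 0 \<le> x \<longrightarrow> 0 \<le> g \<longrightarrow>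
     (\<epsilon> * x \<le> r0 \<longrightarrow> x powr a / 4 \<le> g) \<longrightarrow> (r0 < \<epsilon> * x \<longrightarrow> \<epsilon> powr (- a) * c0 \<le> g) \<longrightarrow>
     (0 < x \<longrightarrow> \<epsilon> powr (- a) * (b * (ln (\<epsilon> * x) - ln A - 2)) \<le> g) \<longrightarrow>
     \<gamma> * ln (1 + x) - g \<le> C"
proof -
  \<comment> \<open>Write l for \<epsilon> powr (- a). Beyond L one has l b \<ge> 2 \<gamma>, so
    half of g pays for \<gamma> times the logarithm; e is chosen so that \<gamma> e l = l c0 / 2,
    which the other half pays.\<close>
  define L where "L = 2 * \<gamma> / b"
  define e where "e = c0 / (2 * \<gamma>)"
  define X where "X = \<gamma> * \<bar>ln (4 * \<gamma>)\<bar>"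
  define Y where "Y = \<gamma> * (\<bar>ln L\<bar> + \<bar>ln e\<bar> + ln A + 2 + ln (1 + 1 / r0))"
  define C where "C = 1/2 + X + Y"
  have L: "L > 0" and e: "e > 0" using \<gamma> b c0 by (auto simp: L_def e_def)
  have lnA: "0 \<le> ln A" using A by simp
  have lnr: "0 \<le> ln (1 + 1 / r0)" using r0 by simp
  have "\<gamma> * ln (1 + x) - g \<le> C"
    if h: "1 \<le> a" "0 < \<epsilon>" "\<epsilon> < 1" "\<gamma>1 \<le> \<epsilon> powr (- a)" "0 \<le> x" "0 \<le> g"
      "\<epsilon> * x \<le> r0 \<longrightarrow> x powr a / 4 \<le> g" "r0 < \<epsilon> * x \<longrightarrow> \<epsilon> powr (- a) * c0 \<le> g"
      "0 < x \<longrightarrow> \<epsilon> powr (- a) * (b * (ln (\<epsilon> * x) - ln A - 2)) \<le> g"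
    for a \<epsilon> x g
  proof (cases "\<epsilon> * x \<le> r0")
    case True
    have "(x - 1) / 4 \<le> g"
    proof (cases "x \<le> 1")
      case True then show ?thesis using h by simp
    next
      case False
      then have "x powr 1 \<le> x powr a" using h by (intro powr_mono) auto
      then show ?thesis using False True h by simp
    qed
    \<comment> \<open>The slope 1 / (4 \<gamma>) makes the linear term (1 + x) / 4, which g \<ge> (x
      - 1) / 4 cancels up to 1/2.\<close>
    moreover have "\<gamma> * ln (1 + x) \<le> \<gamma> * (1 / (4 * \<gamma>) * (1 + x) - ln (1 / (4 * \<gamma>)))"
      using \<gamma> h by (intro mult_left_mono ln_le_scaled) auto
    moreover have "\<gamma> * (1 / (4 * \<gamma>) * (1 + x) - ln (1 / (4 * \<gamma>))) = (1 + x) / 4 + \<gamma> * ln (4 * \<gamma>)"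
      using \<gamma> by (simp add: ln_div field_simps)
    moreover have "\<gamma> * ln (4 * \<gamma>) \<le> X" unfolding X_def using \<gamma> by (intro mult_left_mono) auto
    moreover have "0 \<le> Y"
      unfolding Y_def using \<gamma> lnA lnr by (intro mult_nonneg_nonneg) auto
    ultimately show ?thesis unfolding C_def by argo
  next
    case False
    define T where "T = \<epsilon> * x"
    define l where "l = \<epsilon> powr (- a)"
    define P where "P = max 0 (ln T - ln A - 2)"
    have T: "T > r0" "T > 0" using False r0 by (auto simp: T_def)
    have x: "x > 0" using T h by (auto simp: T_def zero_less_mult_iff)
    have l: "l > 0" "\<gamma>1 \<le> l" using h by (auto simp: l_def)
    have le: "1 / \<epsilon> \<le> l"
    proof -
      have "\<epsilon> powr (- 1) \<le> \<epsilon> powr (- a)" using h by (intro powr_mono') auto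
      then show ?thesis using h by (simp add: l_def powr_minus_divide)
    qed
    have gP: "l * (b * P) \<le> g" using h(6) h(9) x l unfolding P_def T_def l_def
      by (cases "ln (\<epsilon> * x) - ln A - 2 \<le> 0") (auto simp: max_def)
    have gc: "l * c0 \<le> g" using h(8) T by (simp add: l_def T_def)
    have lnx: "ln (1 + x) \<le> ln (1 / \<epsilon>) + (P + ln A + 2 + ln (1 + 1 / r0))"
    proof -
      have "1 + x \<le> (1 / \<epsilon>) * (T * (1 + 1 / r0))"
      proof -
        have "1 \<le> T / r0" using T r0 by simp
        then have "\<epsilon> \<le> T / r0" using h by linarith
        then have "\<epsilon> * (1 + x) \<le> T * (1 + 1 / r0)" by (simp add: T_def distrib_left)
        then show ?thesis using h by (simp add: field_simps)
      qed
      then have "ln (1 + x) \<le> ln ((1 / \<epsilon>) * (T * (1 + 1 / r0)))"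
        using h by (intro ln_mono) auto
      also have "\<dots> = ln (1 / \<epsilon>) + (ln T + ln (1 + 1 / r0))"
      proof -
        have p: "0 < 1 / \<epsilon>" "0 < 1 + 1 / r0" using r0 h by (auto intro: add_pos_pos)
        have "0 < T * (1 + 1 / r0)" using T(2) p(2) by (rule mult_pos_pos)
        then show ?thesis by (simp only: ln_mult_pos[OF p(1)] ln_mult_pos[OF T(2) p(2)])
      qed
      also have "ln T \<le> P + ln A + 2" by (simp add: P_def)
      finally show ?thesis by simp
    qed
    have P: "P \<ge> 0" by (simp add: P_def)
    have key: "\<gamma> * ln (1 / \<epsilon>) + \<gamma> * P - g \<le> \<gamma> * (\<bar>ln L\<bar> + \<bar>ln e\<bar>)"
    proof (cases "l < L")
      case True
      \<comment> \<open>Here 1 / \<epsilon> \<le> l < L keeps \<epsilon> away from 0, and \<gamma>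
        \<le> \<gamma>1 b \<le> l b lets all of g pay for \<gamma> P.\<close>
      have "ln (1 / \<epsilon>) \<le> ln L" using le True h by (intro ln_mono) auto
      then have "\<gamma> * ln (1 / \<epsilon>) \<le> \<gamma> * (\<bar>ln L\<bar> + \<bar>ln e\<bar>)" using \<gamma> by (intro mult_left_mono) auto
      moreover have "\<gamma> * P \<le> l * b * P"
        using b l P by (intro mult_right_mono order_trans[OF b(2)] mult_right_mono) auto
      ultimately show ?thesis using gP by (simp add: mult.assoc)
    next
      case False
      then have "2 * \<gamma> \<le> l * b" using b by (simp add: L_def field_simps)
      then have "2 * \<gamma> * P \<le> l * b * P" using P by (intro mult_right_mono) auto
      moreover have "\<gamma> * ln (1 / \<epsilon>) \<le> \<gamma> * (e * l - ln e)"
      proof -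
        have "ln (1 / \<epsilon>) \<le> ln l" using le h by (intro ln_mono) auto
        also have "\<dots> \<le> e * l - ln e" by (rule ln_le_scaled[OF e l(1)])
        finally show ?thesis using \<gamma> by (intro mult_left_mono) auto
      qed
      moreover have "\<gamma> * (e * l - ln e) = l * c0 / 2 - \<gamma> * ln e"
        using \<gamma> by (simp add: e_def field_simps)
      moreover have "- (\<gamma> * ln e) \<le> \<gamma> * (\<bar>ln L\<bar> + \<bar>ln e\<bar>)"
      proof -
        have "\<gamma> * (- ln e) \<le> \<gamma> * (\<bar>ln L\<bar> + \<bar>ln e\<bar>)" using \<gamma> by (intro mult_left_mono) auto
        then show ?thesis by simp
      qed
      ultimately show ?thesis using gP gc by (simp add: mult.assoc)
    qed
    have "\<gamma> * ln (1 + x) \<le> \<gamma> * (ln (1 / \<epsilon>) + (P + ln A + 2 + ln (1 + 1 / r0)))"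
      using \<gamma> lnx by (intro mult_left_mono) auto
    also have "\<dots> = \<gamma> * ln (1 / \<epsilon>) + \<gamma> * P + \<gamma> * (ln A + 2 + ln (1 + 1 / r0))"
      by (simp add: algebra_simps)
    finally have "\<gamma> * ln (1 + x) - g \<le> \<gamma> * (\<bar>ln L\<bar> + \<bar>ln e\<bar>) + \<gamma> * (ln A + 2 + ln (1 + 1 / r0))"
      using key by linarith
    also have "\<dots> = Y"
      by (simp add: Y_def algebra_simps)
    also have "\<dots> \<le> C" unfolding C_def X_def using \<gamma> by simp
    finally show ?thesis .
  qed
  then show ?thesis by blast
qed

text \<open>J enters \<open>decay_arith\<close> only through three lower bounds for the exponent,
  each with constants depending on C0, \<delta>, \<kappa> and A alone: growth of order a while
  \<epsilon> |\<xi>| \<le> r0, a fixed multiple of \<epsilon> powr (- a) beyond, and the logarithm.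
  This gives uniformity in J, a and \<epsilon>.\<close>

lemma fourier_decay:
  fixes \<gamma> \<gamma>1 \<kappa> \<delta> C0 A :: real
  assumes \<gamma>: "0 < \<gamma>" and \<kappa>: "2 * \<kappa> < 1" "\<gamma> \<le> \<gamma>1 * (1 - 2 * \<kappa>)" and A: "1 \<le> A" and \<delta>: "0 < \<delta>" and C0: "0 < C0"
  shows "\<exists>C>0. \<forall>(J :: 'a::euclidean_space \<Rightarrow> real) a \<epsilon> \<xi>. prob_density J \<longrightarrow> 1 < a \<longrightarrow> a \<le> 2 \<longrightarrow>
     0 < \<epsilon> \<longrightarrow> \<epsilon> < 1 \<longrightarrow> \<gamma>1 \<le> \<epsilon> powr (- a) \<longrightarrow> low_freq J a \<delta> C0 \<longrightarrow>
     (\<forall>\<omega>. norm \<omega> = 1 \<longrightarrow> (LBINT x. J x * exp (- (A * (x \<bullet> \<omega>))\<^sup>2 / 2)) \<le> \<kappa>) \<longrightarrow>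
     exp (- Re (log_symbol J a \<epsilon> \<xi>)) \<le> C * (1 + norm \<xi>) powr (- \<gamma>)"
proof -
  \<comment> \<open>Within this radius the remainder of the expansion is at most half of the leading
    term.\<close>
  define r0 where "r0 = min 1 ((1 / (2 * C0)) powr (1 / \<delta>))"
  have r0: "0 < r0" "r0 \<le> 1" using C0 by (auto simp: r0_def)
  have r0\<delta>: "C0 * r0 powr \<delta> \<le> 1/2"
  proof -
    have "r0 powr \<delta> \<le> ((1 / (2 * C0)) powr (1 / \<delta>)) powr \<delta>" using \<delta> r0 by (intro powr_mono2) (auto simp: r0_def)
    then have "r0 powr \<delta> \<le> 1 / (2 * C0)" using \<delta> C0 by (simp add: powr_powr)
    then have "C0 * r0 powr \<delta> \<le> C0 * (1 / (2 * C0))" using C0 by (intro mult_left_mono) auto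
    then show ?thesis using C0 by simp
  qed
  \<comment> \<open>As r0 \<le> 1 and a \<le> 2, r0 powr a \<ge> r0^2, so this value works for every
    a.\<close>
  define c0 where "c0 = r0\<^sup>2 / 4"
  have c0: "0 < c0" using r0 by (simp add: c0_def)
  have b: "0 < 1 - 2 * \<kappa>" using \<kappa> by simp
  obtain C where C: "\<And>a \<epsilon> x g :: real. \<lbrakk>1 \<le> a; 0 < \<epsilon>; \<epsilon> < 1; \<gamma>1 \<le> \<epsilon> powr (- a); 0 \<le> x; 0 \<le> g;
     \<epsilon> * x \<le> r0 \<longrightarrow> x powr a / 4 \<le> g; r0 < \<epsilon> * x \<longrightarrow> \<epsilon> powr (- a) * c0 \<le> g;
     0 < x \<longrightarrow> \<epsilon> powr (- a) * ((1 - 2 * \<kappa>) * (ln (\<epsilon> * x) - ln A - 2)) \<le> g\<rbrakk> \<Longrightarrow>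
     \<gamma> * ln (1 + x) - g \<le> C"
    using decay_arith[OF \<gamma> b \<kappa>(2) A r0(1) c0] by blast
  have "exp (- Re (log_symbol J a \<epsilon> \<xi>)) \<le> exp C * (1 + norm \<xi>) powr (- \<gamma>)"
    if J: "prob_density J" and a: "1 < a" "a \<le> 2" and \<epsilon>: "0 < \<epsilon>" "\<epsilon> < 1" and g1: "\<gamma>1 \<le> \<epsilon> powr (- a)"
      and L: "low_freq J a \<delta> C0"
      and slab: "\<And>\<omega>. norm \<omega> = 1 \<Longrightarrow> (LBINT x. J x * exp (- (A * (x \<bullet> \<omega>))\<^sup>2 / 2)) \<le> \<kappa>"
    for J :: "'a \<Rightarrow> real" and a \<epsilon> \<xi>
  proof -
    define g where "g = Re (log_symbol J a \<epsilon> \<xi>)"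
    have M: "norm (1 - fourier J \<eta>) \<le> (2 + C0) * norm \<eta> powr a" for \<eta>
      by (rule low_freq_global[OF J L]) (use C0 \<delta> a in auto)
    have near: "norm \<eta> powr a / 2 \<le> Re (1 - fourier J \<eta>)" if "norm \<eta> \<le> r0" for \<eta>
    proof (rule low_freq_Re[OF L C0 \<delta>])
      have "C0 * norm \<eta> powr \<delta> \<le> C0 * r0 powr \<delta>" using that C0 \<delta> by (intro mult_left_mono powr_mono2) auto
      then show "C0 * norm \<eta> powr \<delta> \<le> 1 / 2" using r0\<delta> by linarith
    qed (use that r0 in auto)
    have "\<gamma> * ln (1 + norm \<xi>) - g \<le> C"
    proof (rule C[OF _ \<epsilon> g1])
      show "0 \<le> g" unfolding g_def by (rule Re_log_symbol_nonneg[OF J M \<epsilon>(1) a])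
      show "\<epsilon> * norm \<xi> \<le> r0 \<longrightarrow> norm \<xi> powr a / 4 \<le> g"
      proof
        assume *: "\<epsilon> * norm \<xi> \<le> r0"
        have "(1 * norm \<xi>) powr a / 4 \<le> g"
          unfolding g_def using * by (intro Re_log_symbol_ge_near_zero[OF J M \<epsilon>(1) a] near) auto
        then show "norm \<xi> powr a / 4 \<le> g" by simp
      qed
      show "r0 < \<epsilon> * norm \<xi> \<longrightarrow> \<epsilon> powr (- a) * c0 \<le> g"
      proof
        assume *: "r0 < \<epsilon> * norm \<xi>"
        \<comment> \<open>Only r \<le> \<rho> is kept, which holds the argument \<epsilon> r \<xi>
          of the transform within radius r0.\<close>
        define \<rho> where "\<rho> = r0 / (\<epsilon> * norm \<xi>)"
        have \<rho>: "0 < \<rho>" "\<rho> \<le> 1" "\<rho> * (\<epsilon> * norm \<xi>) = r0" using * r0 by (auto simp: \<rho>_def divide_le_eq)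
        have "\<epsilon> powr (- a) * c0 \<le> \<epsilon> powr (- a) * (r0 powr a / 4)"
        proof -
          have "r0 powr 2 \<le> r0 powr a" using r0 a by (intro powr_mono') auto
          then show ?thesis using r0 by (intro mult_left_mono) (auto simp: c0_def powr_numeral)
        qed
        also have "\<dots> = (\<rho> * norm \<xi>) powr a / 4"
        proof -
          have "\<rho> * norm \<xi> = r0 / \<epsilon>" using \<rho>(3) \<epsilon> by (simp add: field_simps)
          then show ?thesis using r0 \<epsilon> by (simp add: powr_divide powr_minus_divide)
        qed
        also have "\<dots> \<le> g"
          unfolding g_def using \<rho> by (intro Re_log_symbol_ge_near_zero[OF J M \<epsilon>(1) a] near) auto
        finally show "\<epsilon> powr (- a) * c0 \<le> g" .
      qed
      show "0 < norm \<xi> \<longrightarrow> \<epsilon> powr (- a) * ((1 - 2 * \<kappa>) * (ln (\<epsilon> * norm \<xi>) - ln A - 2)) \<le> g"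
        unfolding g_def using \<kappa> slab by (intro impI Re_log_symbol_ge_log[OF J M \<epsilon>(1) a A]) auto
    qed (use a in auto)
    then have "- g \<le> C + (- \<gamma>) * ln (1 + norm \<xi>)" by simp
    then have "exp (- g) \<le> exp (C + (- \<gamma>) * ln (1 + norm \<xi>))" by simp
    also have "\<dots> = exp C * (1 + norm \<xi>) powr (- \<gamma>)"
      by (simp only: exp_add powr_def) (simp add: add_nonneg_eq_0_iff)
    finally show ?thesis by (simp add: g_def)
  qed
  then show ?thesis by (intro exI[of _ "exp C"]) auto
qed

section \<open>The rate in \<open>1 - s\<close>\<close>

lemma norm_exp_neg_diff_le:
  fixes z w :: complex
  assumes "c \<le> Re z" "c \<le> Re w"
  shows "norm (exp (- z) - exp (- w)) \<le> exp (- c) * norm (z - w)"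
proof (rule field_differentiable_bound[where S="{z. c \<le> Re z}" and f'="\<lambda>z. - exp (- z)"])
  show "convex {z. c \<le> Re z}" by (rule convex_halfspace_Re_ge)
  show "((\<lambda>z. exp (- z)) has_field_derivative - exp (- z)) (at z within {z. c \<le> Re z})" for z
    by (auto intro!: derivative_eq_intros)
qed (use assms in auto)

text \<open>Interpolates between the Lipschitz bound, for |z - w| \<le> 1, and the triangle
  inequality. A power \<beta> < 1 reduces the growth in frequency that the decay of the exponentials
  must beat.\<close>

lemma norm_exp_neg_diff_powr_le:
  fixes z w :: complex
  assumes "0 \<le> \<beta>" "\<beta> \<le> 1"
  shows "norm (exp (- z) - exp (- w)) \<le> norm (z - w) powr \<beta> * (exp (- Re z) + exp (- Re w))"
proof (cases "norm (z - w) \<le> 1")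
  case True
  show ?thesis
  proof (cases "z = w")
    case False
    have "norm (exp (- z) - exp (- w)) \<le> exp (- min (Re z) (Re w)) * norm (z - w)"
      by (rule norm_exp_neg_diff_le) auto
    also have "\<dots> \<le> (exp (- Re z) + exp (- Re w)) * norm (z - w) powr \<beta>"
    proof (rule mult_mono)
      have "norm (z - w) powr 1 \<le> norm (z - w) powr \<beta>" using True assms by (intro powr_mono') auto
      then show "norm (z - w) \<le> norm (z - w) powr \<beta>" by simp
      show "exp (- min (Re z) (Re w)) \<le> exp (- Re z) + exp (- Re w)"
        by (auto simp: min_def add_increasing add_increasing2)
    qed (auto intro: add_nonneg_nonneg)
    finally show ?thesis by (simp add: mult.commute)
  qed simp
next
  case False
  have "norm (exp (- z) - exp (- w)) \<le> exp (- Re z) + exp (- Re w)"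
    by (rule order_trans[OF norm_triangle_ineq4]) simp
  moreover have "1 \<le> norm (z - w) powr \<beta>" using False assms by (intro ge_one_powr_ge_zero) auto
  ultimately show ?thesis
    using mult_right_mono[of 1 "norm (z - w) powr \<beta>" "exp (- Re z) + exp (- Re w)"]
    by (simp add: add_nonneg_nonneg)
qed

text \<open>z \<mapsto> exp (- z) is 1-Lipschitz on the right half-plane, so the equilibrium
  inherits the constant M of its kernel. Fed into \<open>moment_bound\<close>, this gives moments
  uniform in s and \<epsilon>.\<close>

lemma norm_1_minus_fourier_equilibrium_le:
  fixes u J :: "'a::euclidean_space \<Rightarrow> real"
  assumes eq: "equilibrium J a \<epsilon> u" and J: "prob_density J"
    and M: "\<And>\<eta>. norm (1 - fourier J \<eta>) \<le> M * norm \<eta> powr a" and \<epsilon>: "\<epsilon> > 0" and a: "1 < a" "a \<le> 2"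
  shows "norm (1 - fourier u \<xi>) \<le> M * norm \<xi> powr a"
proof -
  have "norm (exp (- 0) - exp (- log_symbol J a \<epsilon> \<xi>)) \<le> exp (- 0) * norm (0 - log_symbol J a \<epsilon> \<xi>)"
    using Re_log_symbol_nonneg[OF J M \<epsilon> a] by (intro norm_exp_neg_diff_le) auto
  then have "norm (1 - fourier u \<xi>) \<le> norm (log_symbol J a \<epsilon> \<xi>)"
    by (simp add: fourier_equilibrium[OF eq J M \<epsilon> a(1)])
  also have "\<dots> \<le> M * norm \<xi> powr a" by (rule norm_log_symbol_le[OF J M \<epsilon> a])
  finally show ?thesis .
qed

definition symbols_close ::
  "('a::euclidean_space \<Rightarrow> real) \<Rightarrow> ('a \<Rightarrow> real) \<Rightarrow> real \<Rightarrow> real \<Rightarrow> real \<Rightarrow> bool" where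
  "symbols_close J J1 s \<delta> Q \<longleftrightarrow> (\<forall>\<xi>. \<xi> \<noteq> 0 \<longrightarrow>
     norm ((1 - fourier J \<xi>) / complex_of_real (norm \<xi> powr (2 * s)) - (1 - fourier J1 \<xi>) / complex_of_real ((norm \<xi>)\<^sup>2))
       \<le> Q * (1 - s) * norm \<xi> powr \<delta> * max 1 \<bar>ln (norm \<xi>)\<bar>)"

context
  fixes J J1 :: "'a::euclidean_space \<Rightarrow> real" and s \<delta> \<kappa> Q C0 D p :: real
  assumes J: "prob_density J" and J1: "prob_density J1" and s: "1/2 < s" "s < 1"
    and L: "low_freq J (2 * s) \<delta> C0" and L1: "low_freq J1 2 \<delta> C0" and pos: "0 < \<delta>" "0 < C0" "0 < \<kappa>" "0 < Q"
    and close: "symbols_close J J1 s \<delta> Q"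
  defines "D \<equiv> Q * (1 + 1/\<delta> + 1/\<kappa>) + 4 * (2 + C0) * (2 + 1/\<kappa>)" and "p \<equiv> 2 + \<delta> + \<kappa>"
begin

lemma difference_constant_pos: "0 < D"
  unfolding D_def using pos by (intro add_pos_pos mult_pos_pos) auto

lemma rate_difference:
  assumes "0 < \<epsilon>" "\<epsilon> \<le> 1" "0 < t" "norm \<eta> = \<epsilon> * t"
  shows "norm (complex_of_real (\<epsilon> powr (- (2 * s))) * (1 - fourier J \<eta>) - complex_of_real (\<epsilon> powr (- 2)) * (1 - fourier J1 \<eta>))
     \<le> D * (1 - s) * (t powr (1/2) + t powr p)"
  unfolding D_def p_def
proof (rule symbol_difference[OF assms pos(1) pos(3) s])
  have "norm (1 - fourier J1 \<eta>) \<le> (2 + C0) * norm \<eta> powr 2"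
    by (rule low_freq_global[OF J1 L1]) (use pos in auto)
  then show "norm (1 - fourier J1 \<eta>) \<le> (2 + C0) * (norm \<eta>)\<^sup>2" by (simp add: powr_numeral)
  have "\<eta> \<noteq> 0" using assms by auto
  then show "norm ((1 - fourier J \<eta>) / complex_of_real (norm \<eta> powr (2 * s)) - (1 - fourier J1 \<eta>) / complex_of_real ((norm \<eta>)\<^sup>2))
       \<le> Q * (1 - s) * norm \<eta> powr \<delta> * max 1 \<bar>ln (norm \<eta>)\<bar>"
    using close unfolding symbols_close_def by blast
qed (use pos in auto)

text \<open>\<open>rate_difference\<close> at \<epsilon> = 1 and t = |\<eta>|, with both powers
  absorbed into 1 + |\<eta>| ^ N, the form needed by \<open>slab_mass_transfer\<close>.\<close>

lemma fourier_kernel_difference: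
  assumes "p \<le> real N"
  shows "norm (fourier J \<eta> - fourier J1 \<eta>) \<le> (2 * D * (1 - s)) * (1 + norm \<eta> ^ N)"
proof (cases "\<eta> = 0")
  case True
  then show ?thesis using fourier_0[OF J] fourier_0[OF J1] difference_constant_pos s by simp
next
  case False
  have b: "norm \<eta> powr c \<le> 1 + norm \<eta> ^ N" if "0 \<le> c" "c \<le> real N" for c
    using powr_le_add_powr[of "norm \<eta>" 0 c "real N"] that False by (simp add: powr_realpow)
  have "norm (fourier J \<eta> - fourier J1 \<eta>) \<le> D * (1 - s) * (norm \<eta> powr (1/2) + norm \<eta> powr p)"
    using rate_difference[of 1 "norm \<eta>" \<eta>] False by (simp add: norm_minus_commute)
  also have "\<dots> \<le> D * (1 - s) * ((1 + norm \<eta> ^ N) + (1 + norm \<eta> ^ N))"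
    using assms pos s difference_constant_pos by (intro mult_left_mono add_mono b) (auto simp: p_def)
  also have "\<dots> = (2 * D * (1 - s)) * (1 + norm \<eta> ^ N)" by (simp add: algebra_simps)
  finally show ?thesis .
qed

text \<open>Integrate \<open>rate_difference\<close> with t = r |\<xi>| against dr / r: the power
  1/2 contributes 2 and the power p contributes 1 / p \<le> 1, whence the 3.\<close>

lemma log_symbol_difference:
  assumes \<epsilon>: "0 < \<epsilon>" "\<epsilon> \<le> 1"
  shows "norm (log_symbol J (2 * s) \<epsilon> \<xi> - log_symbol J1 2 \<epsilon> \<xi>) \<le> 3 * D * (1 - s) * (1 + norm \<xi>) powr p"
proof -
  have M: "norm (1 - fourier J \<eta>) \<le> (2 + C0) * norm \<eta> powr (2 * s)"
     and M1: "norm (1 - fourier J1 \<eta>) \<le> (2 + C0) * norm \<eta> powr 2" for \<eta>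
    by (rule low_freq_global[OF J L] low_freq_global[OF J1 L1]; use pos s in simp)+
  have a: "1 < 2 * s" "2 * s \<le> 2" "1 < (2::real)" "(2::real) \<le> 2" using s by auto
  note i = relax_rate_integrable[OF J M \<epsilon>(1) a(1,2), of \<xi>]
  note i1 = relax_rate_integrable[OF J1 M1 \<epsilon>(1) a(3,4), of \<xi>]
  define x where "x = norm \<xi>"
  have p: "p > 2" using pos by (simp add: p_def)
  have h1: "((\<lambda>r. r powr (- (1/2))) has_integral 1 powr (- (1/2) + 1) / (- (1/2) + 1)) {0..1::real}"
    by (intro has_integral_powr_from_0) auto
  have h2: "((\<lambda>r. r powr (p - 1)) has_integral 1 powr (p - 1 + 1) / (p - 1 + 1)) {0..1::real}"
    using p by (intro has_integral_powr_from_0) auto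
  let ?h = "\<lambda>r. D * (1 - s) * (x powr (1/2) * r powr (- (1/2)) + x powr p * r powr (p - 1))"
  have hi: "(?h has_integral D * (1 - s) * (x powr (1/2) * 2 + x powr p * (1 / p))) {0..1}"
    by (intro has_integral_mult_right has_integral_add) (use h1 h2 p in auto)
  have "norm (log_symbol J (2 * s) \<epsilon> \<xi> - log_symbol J1 2 \<epsilon> \<xi>)
     = norm (integral {0..1} (\<lambda>r. relax_rate J (2 * s) \<epsilon> \<xi> r - relax_rate J1 2 \<epsilon> \<xi> r))"
    unfolding log_symbol_def by (simp add: Henstock_Kurzweil_Integration.integral_diff[OF i i1])
  also have "\<dots> \<le> integral {0..1} ?h"
  proof (rule integral_norm_bound_integral[OF integrable_diff[OF i i1] has_integral_integrable[OF hi]])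
    fix r :: real assume r: "r \<in> {0..1}"
    show "norm (relax_rate J (2 * s) \<epsilon> \<xi> r - relax_rate J1 2 \<epsilon> \<xi> r) \<le> ?h r"
    proof (cases "r = 0 \<or> \<xi> = 0")
      case True
      then have "relax_rate J (2 * s) \<epsilon> \<xi> r = 0" "relax_rate J1 2 \<epsilon> \<xi> r = 0"
        using fourier_0[OF J] fourier_0[OF J1] by (auto simp: relax_rate_def)
      then show ?thesis using difference_constant_pos s by simp
    next
      case False
      then have r0: "r > 0" and x0: "x > 0" using r by (auto simp: x_def)
      let ?d = "complex_of_real (\<epsilon> powr (- (2 * s))) * (1 - fourier J ((\<epsilon> * r) *\<^sub>R \<xi>))
                - complex_of_real (\<epsilon> powr (- 2)) * (1 - fourier J1 ((\<epsilon> * r) *\<^sub>R \<xi>))"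
      have "relax_rate J (2 * s) \<epsilon> \<xi> r - relax_rate J1 2 \<epsilon> \<xi> r = complex_of_real (1 / r) * ?d"
        by (simp add: relax_rate_def diff_divide_distrib)
      then have "norm (relax_rate J (2 * s) \<epsilon> \<xi> r - relax_rate J1 2 \<epsilon> \<xi> r) = 1 / r * norm ?d"
        using r0 by (simp only: norm_mult norm_of_real) simp
      also have "\<dots> \<le> 1 / r * (D * (1 - s) * ((r * x) powr (1/2) + (r * x) powr p))"
        using r0 x0 \<epsilon> by (intro mult_left_mono rate_difference) (auto simp: x_def abs_mult)
      also have "\<dots> = ?h r"
      proof -
        have e: "1 / r * (r * x) powr c = x powr c * r powr (c - 1)" for c
          using r0 x0 by (simp add: powr_mult powr_diff)
        have "1 / r * (D * (1 - s) * ((r * x) powr (1/2) + (r * x) powr p))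
          = D * (1 - s) * (1 / r * (r * x) powr (1/2) + 1 / r * (r * x) powr p)"
          by (simp only: mult.left_commute[of "1 / r"] distrib_left)
        then show ?thesis unfolding e by simp
      qed
      finally show ?thesis .
    qed
  qed
  also have "\<dots> = D * (1 - s) * (x powr (1/2) * 2 + x powr p * (1 / p))" by (rule integral_unique[OF hi])
  also have "\<dots> \<le> D * (1 - s) * ((1 + x) powr p * 2 + (1 + x) powr p * 1)"
  proof (intro mult_left_mono add_mono mult_mono)
    have "x powr (1/2) \<le> (1 + x) powr (1/2)" by (intro powr_mono2) (auto simp: x_def)
    also have "\<dots> \<le> (1 + x) powr p" using p by (intro powr_mono) (auto simp: x_def)
    finally show "x powr (1/2) \<le> (1 + x) powr p" .
    show "x powr p \<le> (1 + x) powr p" using p by (intro powr_mono2) (auto simp: x_def)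
  qed (use difference_constant_pos s p in auto)
  also have "\<dots> = 3 * D * (1 - s) * (1 + norm \<xi>) powr p" by (simp add: x_def algebra_simps)
  finally show ?thesis .
qed

end

text \<open>A is fixed first, from J1 alone and with half of the allowed mass, because the bound on
  the transfer error contains A ^ N. That error is of order 1 - s, so for s close to 1 it fits into
  the other half.\<close>

lemma uniform_slab_mass:
  fixes J1 :: "'a::euclidean_space \<Rightarrow> real" and \<kappa>s \<kappa> \<delta> C0 Q :: real
  assumes "prob_density J1" and "0 < \<kappa>s" "0 < \<kappa>" "0 < \<delta>" "0 < C0" "0 < Q" "low_freq J1 2 \<delta> C0"
  shows "\<exists>A\<ge>1. \<exists>s0<1. \<forall>J s. 1/2 < s \<longrightarrow> s0 < s \<longrightarrow> s < 1 \<longrightarrow> prob_density J \<longrightarrow> low_freq J (2 * s) \<delta> C0 \<longrightarrow>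
     symbols_close J J1 s \<delta> Q \<longrightarrow>
     (\<forall>\<omega>. norm \<omega> = 1 \<longrightarrow> (LBINT x. J x * exp (- (A * (x \<bullet> \<omega>))\<^sup>2 / 2)) \<le> \<kappa>s \<and>
                        (LBINT x. J1 x * exp (- (A * (x \<bullet> \<omega>))\<^sup>2 / 2)) \<le> \<kappa>s)"
proof -
  obtain A where A: "A \<ge> 1" and slab: "\<And>\<omega>. norm \<omega> = 1 \<Longrightarrow> (LBINT x. J1 x * exp (- (A * (x \<bullet> \<omega>))\<^sup>2 / 2)) \<le> \<kappa>s / 2"
    using slab_mass_small[OF assms(1), of "\<kappa>s / 2"] assms by auto
  define D where "D = Q * (1 + 1/\<delta> + 1/\<kappa>) + 4 * (2 + C0) * (2 + 1/\<kappa>)"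
  define N where "N = nat \<lceil>2 + \<delta> + \<kappa>\<rceil>"
  have N: "2 + \<delta> + \<kappa> \<le> real N" unfolding N_def by linarith
  define I where "I = (LBINT t. std_normal_density t * (1 + A ^ N * \<bar>t\<bar> ^ N))"
  have I: "0 \<le> I" unfolding I_def using A by (intro integral_nonneg_AE AE_I2 mult_nonneg_nonneg) auto
  have D: "0 < D" unfolding D_def using assms by (intro add_pos_pos mult_pos_pos) auto
  \<comment> \<open>The summand 1 keeps c positive when only I \<ge> 0 is at hand.\<close>
  define c where "c = 2 * D * I + 1"
  have c: "c > 0" using D I by (simp add: c_def add_nonneg_pos)
  define s0 where "s0 = 1 - \<kappa>s / (2 * c)"
  have "s0 < 1" using c assms by (simp add: s0_def)
  moreover have "(LBINT x. J x * exp (- (A * (x \<bullet> \<omega>))\<^sup>2 / 2)) \<le> \<kappa>s \<and>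
                        (LBINT x. J1 x * exp (- (A * (x \<bullet> \<omega>))\<^sup>2 / 2)) \<le> \<kappa>s"
    if h: "1/2 < s" "s0 < s" "s < 1" "prob_density J" "low_freq J (2 * s) \<delta> C0" "symbols_close J J1 s \<delta> Q" "norm \<omega> = 1"
    for J s \<omega>
  proof -
    have i: "integrable lborel J" "integrable lborel J1" using h(4) assms(1) by (auto simp: prob_density_def)
    have "(LBINT x. J x * exp (- (A * (x \<bullet> \<omega>))\<^sup>2 / 2))
       \<le> (LBINT x. J1 x * exp (- (A * (x \<bullet> \<omega>))\<^sup>2 / 2)) + (2 * D * (1 - s)) * I"
      unfolding I_def D_def
      by (rule slab_mass_transfer[OF i h(7) _ fourier_kernel_difference[OF h(4) assms(1) h(1,3,5) assms(7,4,5,3,6) h(6) N]])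
         (use A in simp)
    also have "(2 * D * (1 - s)) * I \<le> \<kappa>s / 2"
    proof -
      have "(2 * D * (1 - s)) * I \<le> (1 - s) * c" using h by (simp add: c_def algebra_simps)
      also have "\<dots> \<le> \<kappa>s / (2 * c) * c" using h c by (intro mult_right_mono) (auto simp: s0_def)
      also have "\<dots> = \<kappa>s / 2" using c by simp
      finally show ?thesis .
    qed
    finally show ?thesis using slab[OF h(7)] assms(2) by simp
  qed
  ultimately show ?thesis using A by blast
qed

text \<open>The decay exponent \<open>\<gamma> = 2 + \<delta> + d / 2 - \<kappa>\<close> is what the range of \<open>\<epsilon>\<close> permits; the loss
  \<open>\<kappa>\<close> costs the factor \<open>1 - \<kappa>\<close> in the power of \<open>1 - s\<close>.\<close>

lemma fourier_L2_difference:
  fixes J1 :: "'a::euclidean_space \<Rightarrow> real" and \<kappa> \<delta> C0 Q :: real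
  assumes J1: "prob_density J1" and pos: "0 < \<kappa>" "\<kappa> < 1" "0 < \<delta>" "0 < C0" "0 < Q" and L1: "low_freq J1 2 \<delta> C0"
  shows "\<exists>C\<ge>0. \<exists>s0<1. \<forall>J s \<epsilon> F G. 1/2 < s \<longrightarrow> s0 < s \<longrightarrow> s < 1 \<longrightarrow> prob_density J \<longrightarrow> low_freq J (2 * s) \<delta> C0 \<longrightarrow>
     symbols_close J J1 s \<delta> Q \<longrightarrow> 0 < \<epsilon> \<longrightarrow> \<epsilon> < sqrt (2 / (4 + 2 * \<delta> + real DIM('a))) \<longrightarrow>
     equilibrium J (2 * s) \<epsilon> F \<longrightarrow> equilibrium J1 2 \<epsilon> G \<longrightarrow>
     (\<integral>\<^sup>+\<xi>. ennreal ((norm (fourier (\<lambda>x. F x - G x) \<xi>))\<^sup>2) \<partial>lborel) \<le> ennreal (C * ((1 - s) powr (1 - \<kappa>))\<^sup>2)"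
proof -
  \<comment> \<open>The range of \<epsilon> is exactly \<epsilon> powr (- 2) > \<gamma>0. Of the
    loss \<kappa> in the decay exponent, half goes to the rate (\<gamma>1 for \<gamma>0) and half to
    the slabs (2 \<kappa>s \<gamma>0 = \<kappa> / 2).\<close>
  define \<gamma>0 where "\<gamma>0 = 2 + \<delta> + real DIM('a) / 2"
  define \<kappa>s where "\<kappa>s = \<kappa> / (4 * \<gamma>0)"
  define \<gamma>1 where "\<gamma>1 = \<gamma>0 - \<kappa> / 2"
  define \<gamma> where "\<gamma> = \<gamma>0 - \<kappa>"
  define p where "p = 2 + \<delta> + \<kappa>"
  have \<gamma>0: "\<gamma>0 > 2" using pos by (simp add: \<gamma>0_def add_pos_pos)
  have \<gamma>: "0 < \<gamma>" using \<gamma>0 pos by (simp add: \<gamma>_def)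
  have \<kappa>s: "0 < \<kappa>s" "2 * \<kappa>s < 1" using \<gamma>0 pos by (auto simp: \<kappa>s_def field_simps)
  have g1: "\<gamma> \<le> \<gamma>1 * (1 - 2 * \<kappa>s)"
  proof -
    have "\<gamma>0 * \<kappa>s = \<kappa> / 4" using \<gamma>0 by (simp add: \<kappa>s_def)
    then have "\<gamma>1 * (1 - 2 * \<kappa>s) = \<gamma> + \<kappa> * \<kappa>s" by (simp add: \<gamma>1_def \<gamma>_def algebra_simps)
    then show ?thesis using pos \<kappa>s by simp
  qed
  obtain A s1 where A: "A \<ge> 1" "s1 < 1" and slab: "\<And>J s \<omega>. \<lbrakk>1/2 < s; s1 < s; s < 1; prob_density J; low_freq J (2 * s) \<delta> C0;
     symbols_close J J1 s \<delta> Q; norm \<omega> = 1\<rbrakk> \<Longrightarrow> (LBINT x. J x * exp (- (A * (x \<bullet> \<omega>))\<^sup>2 / 2)) \<le> \<kappa>s \<and>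
                        (LBINT x. J1 x * exp (- (A * (x \<bullet> \<omega>))\<^sup>2 / 2)) \<le> \<kappa>s"
    using uniform_slab_mass[OF J1 \<kappa>s(1) pos(1,3,4,5) L1] by blast
  obtain C1 where C1: "C1 > 0" and decay: "\<And>(J :: 'a \<Rightarrow> real) a \<epsilon> \<xi>. \<lbrakk>prob_density J; 1 < a; a \<le> 2;
     0 < \<epsilon>; \<epsilon> < 1; \<gamma>1 \<le> \<epsilon> powr (- a); low_freq J a \<delta> C0;
     \<forall>\<omega>. norm \<omega> = 1 \<longrightarrow> (LBINT x. J x * exp (- (A * (x \<bullet> \<omega>))\<^sup>2 / 2)) \<le> \<kappa>s\<rbrakk> \<Longrightarrow>
     exp (- Re (log_symbol J a \<epsilon> \<xi>)) \<le> C1 * (1 + norm \<xi>) powr (- \<gamma>)"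
    using fourier_decay[OF \<gamma> \<kappa>s(2) g1 A(1) pos(3,4), where 'a='a] by blast
  \<comment> \<open>The rate \<epsilon> powr (- 2s) is only known to be at least \<gamma>0 powr s,
    which is smaller than \<gamma>0; for s near 1 it still beats \<gamma>1.\<close>
  have "((\<lambda>s. \<gamma>0 powr s) \<longlongrightarrow> \<gamma>0 powr 1) (at_left 1)"
    using \<gamma>0 by (intro tendsto_intros) auto
  then have "\<forall>\<^sub>F s in at_left 1. \<gamma>1 < \<gamma>0 powr s"
    using \<gamma>0 pos by (intro order_tendstoD) (auto simp: \<gamma>1_def)
  then obtain s2 where s2: "s2 < 1" "\<And>s. s2 < s \<Longrightarrow> s < 1 \<Longrightarrow> \<gamma>1 < \<gamma>0 powr s"
    by (auto simp: eventually_at_left_field)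
  define D where "D = Q * (1 + 1/\<delta> + 1/\<kappa>) + 4 * (2 + C0) * (2 + 1/\<kappa>)"
  have D: "0 < D" unfolding D_def using pos by (intro add_pos_pos mult_pos_pos) auto
  \<comment> \<open>Decay 2 \<gamma> of the squared transforms minus growth 2 (1 - \<kappa>) p of
    the squared difference. The losses in \<gamma> and p are outweighed by \<kappa> p, so q exceeds
    the dimension by 2 \<kappa> \<delta> + 2 \<kappa>^2.\<close>
  define q where "q = 2 * \<gamma> - 2 * ((1 - \<kappa>) * p)"
  have "q = real DIM('a) + 2 * (\<kappa> * \<delta>) + 2 * \<kappa>\<^sup>2"
    by (simp add: q_def \<gamma>_def \<gamma>0_def p_def algebra_simps power2_eq_square)
  then have q: "real DIM('a) < q" using pos by (simp add: add_pos_pos)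
  obtain I where I: "0 \<le> I" "(\<integral>\<^sup>+x. ennreal ((1 + norm (x::'a)) powr (- q)) \<partial>lborel) = ennreal I"
    using nn_integral_power_decay_finite[OF q] by (metis ennreal_cases infinity_ennreal_def less_irrefl)
  define B where "B = (3 * D) powr (1 - \<kappa>) * (2 * C1)"
  have main: "(\<integral>\<^sup>+\<xi>. ennreal ((norm (fourier (\<lambda>x. F x - G x) \<xi>))\<^sup>2) \<partial>lborel) \<le> ennreal (B\<^sup>2 * I * ((1 - s) powr (1 - \<kappa>))\<^sup>2)"
    if h: "1/2 < s" "max s1 s2 < s" "s < 1" "prob_density J" "low_freq J (2 * s) \<delta> C0" "symbols_close J J1 s \<delta> Q"
      "0 < \<epsilon>" "\<epsilon> < sqrt (2 / (4 + 2 * \<delta> + real DIM('a)))" "equilibrium J (2 * s) \<epsilon> F" "equilibrium J1 2 \<epsilon> G"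
    for J s \<epsilon> F G
  proof -
    have e\<gamma>: "2 / (4 + 2 * \<delta> + real DIM('a)) = 1 / \<gamma>0" using pos by (simp add: \<gamma>0_def field_simps)
    then have "\<epsilon> < sqrt (1 / \<gamma>0)" using h(8) by simp
    then have "\<epsilon>\<^sup>2 < 1 / \<gamma>0" using h(7) \<gamma>0 by (metis less_imp_le real_less_rsqrt real_sqrt_less_iff real_sqrt_unique)
    then have \<epsilon>\<gamma>: "\<gamma>0 \<le> \<epsilon> powr (- 2)" using h(7) \<gamma>0 by (simp add: powr_minus powr_numeral field_simps)
    have \<epsilon>1: "\<epsilon> < 1"
    proof -
      have "sqrt (1 / \<gamma>0) < 1" using \<gamma>0 by (simp add: real_sqrt_lt_1_iff)
      then show ?thesis using \<open>\<epsilon> < sqrt (1 / \<gamma>0)\<close> by linarith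
    qed
    have "\<gamma>0 powr s \<le> (\<epsilon> powr (- 2)) powr s" using \<epsilon>\<gamma> \<gamma>0 h by (intro powr_mono2) auto
    then have ga: "\<gamma>1 \<le> \<epsilon> powr (- (2 * s))" using s2(2)[of s] h by (simp add: powr_powr)
    have gb: "\<gamma>1 \<le> \<epsilon> powr (- 2)" using \<epsilon>\<gamma> pos by (simp add: \<gamma>1_def)
    have M: "norm (1 - fourier J \<eta>) \<le> (2 + C0) * norm \<eta> powr (2 * s)"
     and M1: "norm (1 - fourier J1 \<eta>) \<le> (2 + C0) * norm \<eta> powr 2" for \<eta>
      by (rule low_freq_global[OF h(4,5)] low_freq_global[OF J1 L1]; use pos h in simp)+
    have FG: "integrable lborel F" "integrable lborel G" using h(9,10) by (auto simp: equilibrium_def prob_density_def)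
    have sl: "\<forall>\<omega>. norm \<omega> = 1 \<longrightarrow> (LBINT x. J x * exp (- (A * (x \<bullet> \<omega>))\<^sup>2 / 2)) \<le> \<kappa>s"
      "\<forall>\<omega>. norm \<omega> = 1 \<longrightarrow> (LBINT x. J1 x * exp (- (A * (x \<bullet> \<omega>))\<^sup>2 / 2)) \<le> \<kappa>s"
      using slab[OF h(1) _ h(3,4,5,6)] h(2) by auto
    have pw: "(norm (fourier (\<lambda>x. F x - G x) \<xi>))\<^sup>2 \<le> B\<^sup>2 * ((1 - s) powr (1 - \<kappa>))\<^sup>2 * (1 + norm \<xi>) powr (- q)" for \<xi>
    proof -
      define z where "z = log_symbol J (2 * s) \<epsilon> \<xi>"
      define w where "w = log_symbol J1 2 \<epsilon> \<xi>"
      define y where "y = 1 + norm \<xi>"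
      have y: "y > 0" by (simp add: y_def add_pos_nonneg)
      have "exp (- Re z) \<le> C1 * y powr (- \<gamma>)" unfolding z_def y_def
        by (rule decay) (use h \<epsilon>1 ga sl in auto)
      moreover have "exp (- Re w) \<le> C1 * y powr (- \<gamma>)" unfolding w_def y_def
        by (rule decay) (use h \<epsilon>1 gb sl J1 L1 in auto)
      ultimately have es: "exp (- Re z) + exp (- Re w) \<le> 2 * C1 * y powr (- \<gamma>)" by simp
      have zw: "norm (z - w) \<le> 3 * D * (1 - s) * y powr p"
        unfolding z_def w_def y_def D_def p_def
        by (rule log_symbol_difference[OF h(4) J1 h(1,3,5) L1 pos(3,4,1,5) h(6)]) (use h \<epsilon>1 in auto)
      have "norm (fourier (\<lambda>x. F x - G x) \<xi>) = norm (exp (- z) - exp (- w))"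
        unfolding fourier_diff[OF FG] z_def w_def
        using fourier_equilibrium[OF h(9,4) M h(7), of \<xi>] fourier_equilibrium[OF h(10) J1 M1 h(7), of \<xi>] h by simp
      also have "\<dots> \<le> norm (z - w) powr (1 - \<kappa>) * (exp (- Re z) + exp (- Re w))"
        by (rule norm_exp_neg_diff_powr_le) (use pos in auto)
      also have "\<dots> \<le> (3 * D * (1 - s) * y powr p) powr (1 - \<kappa>) * (2 * C1 * y powr (- \<gamma>))"
        by (intro mult_mono powr_mono2 zw es) (use pos in \<open>auto intro: add_nonneg_nonneg\<close>)
      also have "\<dots> = B * (1 - s) powr (1 - \<kappa>) * y powr (- (q / 2))"
      proof -
        have "(3 * D * (1 - s) * y powr p) powr (1 - \<kappa>) = (3 * D) powr (1 - \<kappa>) * (1 - s) powr (1 - \<kappa>) * y powr (p * (1 - \<kappa>))"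
          using D h y by (simp add: powr_mult powr_powr)
        moreover have "y powr (p * (1 - \<kappa>)) * y powr (- \<gamma>) = y powr (- (q / 2))"
        proof -
          have "p * (1 - \<kappa>) + - \<gamma> = - (q / 2)" by (simp add: q_def mult.commute diff_divide_distrib)
          then show ?thesis by (simp only: powr_add[symmetric])
        qed
        ultimately show ?thesis by (simp add: B_def mult_ac)
      qed
      finally have "(norm (fourier (\<lambda>x. F x - G x) \<xi>))\<^sup>2 \<le> (B * (1 - s) powr (1 - \<kappa>) * y powr (- (q / 2)))\<^sup>2"
        by (rule power_mono) simp
      also have "\<dots> = B\<^sup>2 * ((1 - s) powr (1 - \<kappa>))\<^sup>2 * y powr (- q)"
      proof -
        have "(y powr (- (q / 2)))\<^sup>2 = y powr (- q)" using y by (simp add: power2_eq_square powr_add[symmetric])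
        then show ?thesis by (simp add: power_mult_distrib)
      qed
      finally show ?thesis by (simp add: y_def)
    qed
    have "(\<integral>\<^sup>+\<xi>. ennreal ((norm (fourier (\<lambda>x. F x - G x) \<xi>))\<^sup>2) \<partial>lborel)
       \<le> (\<integral>\<^sup>+\<xi>. ennreal (B\<^sup>2 * ((1 - s) powr (1 - \<kappa>))\<^sup>2) * ennreal ((1 + norm (\<xi>::'a)) powr (- q)) \<partial>lborel)"
      using pw by (intro nn_integral_mono) (simp add: ennreal_mult[symmetric] ennreal_leI)
    also have "\<dots> = ennreal (B\<^sup>2 * ((1 - s) powr (1 - \<kappa>))\<^sup>2) * ennreal I"
      by (subst nn_integral_cmult) (simp_all add: I(2))
    also have "\<dots> = ennreal (B\<^sup>2 * I * ((1 - s) powr (1 - \<kappa>))\<^sup>2)"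
      using I by (simp add: ennreal_mult[symmetric] mult_ac)
    finally show ?thesis .
  qed
  show ?thesis
  proof (rule exI[of _ "B\<^sup>2 * I"], intro conjI)
    show "0 \<le> B\<^sup>2 * I" using I by simp
  next
    show "\<exists>s0<1. \<forall>J s \<epsilon> F G. 1/2 < s \<longrightarrow> s0 < s \<longrightarrow> s < 1 \<longrightarrow> prob_density J \<longrightarrow> low_freq J (2 * s) \<delta> C0 \<longrightarrow>
     symbols_close J J1 s \<delta> Q \<longrightarrow> 0 < \<epsilon> \<longrightarrow> \<epsilon> < sqrt (2 / (4 + 2 * \<delta> + real DIM('a))) \<longrightarrow>
     equilibrium J (2 * s) \<epsilon> F \<longrightarrow> equilibrium J1 2 \<epsilon> G \<longrightarrow>
     (\<integral>\<^sup>+\<xi>. ennreal ((norm (fourier (\<lambda>x. F x - G x) \<xi>))\<^sup>2) \<partial>lborel) \<le> ennreal (B\<^sup>2 * I * ((1 - s) powr (1 - \<kappa>))\<^sup>2)"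
      using main A(2) s2(1) by (intro exI[of _ "max s1 s2"]) auto
  qed
qed

text \<open>Split at radius R. On the ball, R \<ge> 1 and k \<le> 1 bound the weight by 2 R powr k;
  outside, \<open>jbr x\<close> exceeds R and the weight of order k is exchanged for order m at the
  price R powr (k - m). R stays free, to be balanced later.\<close>

lemma L1k_interpolation:
  fixes f :: "'a::euclidean_space \<Rightarrow> real"
  assumes f: "integrable lborel f" and k: "0 \<le> k" "k < m" "k \<le> 1" and R: "1 \<le> R"
    and X: "(LBINT x. indicator (cball 0 R) x * \<bar>f x\<bar>) \<le> X"
    and Y: "(\<integral>\<^sup>+x. ennreal (jbr x powr m * \<bar>f x\<bar>) \<partial>lborel) \<le> ennreal Y" "0 \<le> Y"
  shows "L1k_norm k f \<le> ennreal (2 * R powr k * X + R powr (k - m) * Y)"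
proof -
  have [measurable]: "f \<in> borel_measurable borel" using f by auto
  have jm [measurable]: "(jbr :: 'a \<Rightarrow> real) \<in> borel_measurable borel" unfolding jbr_def by measurable
  have X0: "0 \<le> X" by (rule order_trans[OF _ X]) (intro integral_nonneg_AE AE_I2, simp)
  have [measurable]: "(indicator (cball 0 R) :: 'a \<Rightarrow> real) \<in> borel_measurable borel"
    by (intro borel_measurable_indicator borel_closed) simp
  have ii: "integrable lborel (\<lambda>x. indicator (cball 0 R) x * \<bar>f x\<bar>)"
    by (rule Bochner_Integration.integrable_bound[OF f]) (auto simp: indicator_def)
  have pw: "jbr x powr k * \<bar>f x\<bar> \<le> 2 * R powr k * (indicator (cball 0 R) x * \<bar>f x\<bar>) + R powr (k - m) * (jbr x powr m * \<bar>f x\<bar>)" for x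
  proof -
    have jle: "jbr x \<le> 1 + norm x" unfolding jbr_def
      by (rule real_le_lsqrt) (auto simp: power2_eq_square algebra_simps)
    have jge: "norm x \<le> jbr x" unfolding jbr_def by (rule real_le_rsqrt) simp
    have j0: "0 \<le> jbr x" by (simp add: jbr_def)
    show ?thesis
    proof (cases "x \<in> cball 0 R")
      case True
      then have "jbr x \<le> 2 * R" using jle R by simp
      then have "jbr x powr k \<le> (2 * R) powr k" using j0 k by (intro powr_mono2) auto
      also have "\<dots> = 2 powr k * R powr k" using R by (simp add: powr_mult)
      also have "\<dots> \<le> 2 powr 1 * R powr k" using k by (intro mult_right_mono powr_mono) auto
      finally have "jbr x powr k * \<bar>f x\<bar> \<le> 2 * R powr k * \<bar>f x\<bar>" by (intro mult_right_mono) auto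
      then show ?thesis using True by (simp add: add_increasing2)
    next
      case False
      then have j: "R \<le> jbr x" using jge by simp
      then have "jbr x powr (k - m) \<le> R powr (k - m)" using R k by (intro powr_mono2') auto
      then have "jbr x powr (k - m) * jbr x powr m \<le> R powr (k - m) * jbr x powr m" by (intro mult_right_mono) auto
      then have "jbr x powr k \<le> R powr (k - m) * jbr x powr m" using j R by (simp add: powr_add[symmetric])
      then have "jbr x powr k * \<bar>f x\<bar> \<le> R powr (k - m) * jbr x powr m * \<bar>f x\<bar>" by (intro mult_right_mono) auto
      then show ?thesis using False by (simp add: mult_ac)
    qed
  qed
  have "L1k_norm k f \<le> (\<integral>\<^sup>+x. ennreal (2 * R powr k) * ennreal (indicator (cball 0 R) x * \<bar>f x\<bar>)
      + ennreal (R powr (k - m)) * ennreal (jbr x powr m * \<bar>f x\<bar>) \<partial>lborel)"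
    unfolding L1k_norm_def
    using pw by (intro nn_integral_mono) (simp add: ennreal_mult[symmetric] ennreal_plus[symmetric] ennreal_leI del: ennreal_plus)
  also have "\<dots> = ennreal (2 * R powr k) * (\<integral>\<^sup>+x. ennreal (indicator (cball 0 R) x * \<bar>f x\<bar>) \<partial>lborel)
      + ennreal (R powr (k - m)) * (\<integral>\<^sup>+x. ennreal (jbr x powr m * \<bar>f x\<bar>) \<partial>lborel)"
    by (simp add: nn_integral_add nn_integral_cmult)
  also have "(\<integral>\<^sup>+x. ennreal (indicator (cball 0 R) x * \<bar>f x\<bar>) \<partial>lborel) = ennreal (LBINT x. indicator (cball 0 R) x * \<bar>f x\<bar>)"
    by (rule nn_integral_eq_integral[OF ii]) simp
  also have "ennreal (2 * R powr k) * ennreal (LBINT x. indicator (cball 0 R) x * \<bar>f x\<bar>)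
      + ennreal (R powr (k - m)) * (\<integral>\<^sup>+x. ennreal (jbr x powr m * \<bar>f x\<bar>) \<partial>lborel)
     \<le> ennreal (2 * R powr k) * ennreal X + ennreal (R powr (k - m)) * ennreal Y"
    using X Y by (intro add_mono mult_left_mono ennreal_leI) auto
  also have "\<dots> = ennreal (2 * R powr k * X + R powr (k - m) * Y)"
    using X0 Y R by (simp add: ennreal_mult[symmetric] ennreal_plus[symmetric] del: ennreal_plus)
  finally show ?thesis .
qed

theorem theorem5p3:
  fixes J :: "real \<Rightarrow> 'a::euclidean_space \<Rightarrow> real"
    and J1 :: "'a \<Rightarrow> real"
    and \<delta> C\<^sub>0 k m :: real
  assumes "H1 J \<delta> C\<^sub>0"
    and "H2 J J1 \<delta> C\<^sub>0"
    and "0 \<le> k" and "k < m" and "m < 1"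
  shows "\<exists>C. \<forall>s\<in>{1/2<..<1}. \<forall>\<epsilon>\<in>{0<..<sqrt (2 / (4 + 2 * \<delta> + real DIM('a)))}.
           \<forall>F G. equilibrium (J s) (2 * s) \<epsilon> F \<and> equilibrium J1 2 \<epsilon> G \<longrightarrow>
             L1k_norm k (\<lambda>x. F x - G x)
               \<le> ennreal (C * (1 - s) powr ((m - k) / (m + real DIM('a) / 2))
                    * (1 + \<epsilon> powr (\<delta> * ((m - k) / (m + real DIM('a) / 2))) * \<bar>ln \<epsilon>\<bar>))"
proof -
  define d where "d = real DIM('a)"
  define \<theta> where "\<theta> = (m - k) / (m + d / 2)"
  \<comment> \<open>Order below 1 ensures a uniform moment; order above m makes
    \<open>\<theta>'\<close> larger than \<theta>.\<close>
  define m' where "m' = (m + 1) / 2"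
  define \<theta>' where "\<theta>' = (m' - k) / (m' + d / 2)"
  \<comment> \<open>Exactly the loss that the larger exponent affords: (1 - \<kappa>) \<theta>' =
    \<theta>.\<close>
  define \<kappa> where "\<kappa> = 1 - \<theta> / \<theta>'"
  have m': "m < m'" "m' < 1" "0 < m'" "k < m'" using assms by (auto simp: m'_def)
  have d: "0 < d" by (simp add: d_def)
  have pos: "0 < \<delta>" "0 < C\<^sub>0" using assms(1) by (auto simp: H1_def)
  have \<theta>: "0 < \<theta>" "\<theta> < \<theta>'"
  proof -
    show "0 < \<theta>" using assms d by (simp add: \<theta>_def)
    have "(m - k) * (m' + d / 2) < (m' - k) * (m + d / 2)"
    proof -
      have "(m' - k) * (m + d / 2) - (m - k) * (m' + d / 2) = (m' - m) * (k + d / 2)" by algebra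
      also have "\<dots> > 0" using m' assms d by (intro mult_pos_pos) auto
      finally show ?thesis by simp
    qed
    moreover have p: "0 < m + d / 2" "0 < m' + d / 2" using assms m' d by auto
    ultimately show "\<theta> < \<theta>'"
      unfolding \<theta>_def \<theta>'_def
      by (simp only: pos_divide_less_eq[OF p(1)] times_divide_eq_left pos_less_divide_eq[OF p(2)])
  qed
  have \<kappa>: "0 < \<kappa>" "\<kappa> < 1" "(1 - \<kappa>) * \<theta>' = \<theta>" using \<theta> by (auto simp: \<kappa>_def)
  have J: "prob_density (J s)" "low_freq (J s) (2 * s) \<delta> C\<^sub>0" if "s \<in> {1/2<..<1}" for s
    using assms(1) that by (auto simp: H1_def low_freq_def)
  have J1: "prob_density J1" "low_freq J1 2 \<delta> C\<^sub>0"
    using assms(2) by (auto simp: H2_def low_freq_def powr_numeral)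
  obtain Q where Q: "Q > 0" "\<And>s. s \<in> {1/2<..<1} \<Longrightarrow> symbols_close (J s) J1 s \<delta> Q"
    using assms(2) unfolding H2_def symbols_close_def by blast
  obtain C2 s0 where C2: "C2 \<ge> 0" "s0 < 1" and L2: "\<And>K s \<epsilon> F G. \<lbrakk>1/2 < s; s0 < s; s < 1; prob_density K; low_freq K (2 * s) \<delta> C\<^sub>0;
     symbols_close K J1 s \<delta> Q; 0 < \<epsilon>; \<epsilon> < sqrt (2 / (4 + 2 * \<delta> + real DIM('a)));
     equilibrium K (2 * s) \<epsilon> F; equilibrium J1 2 \<epsilon> G\<rbrakk> \<Longrightarrow>
     (\<integral>\<^sup>+\<xi>. ennreal ((norm (fourier (\<lambda>x. F x - G x) \<xi>))\<^sup>2) \<partial>lborel) \<le> ennreal (C2 * ((1 - s) powr (1 - \<kappa>))\<^sup>2)"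
    using fourier_L2_difference[OF J1(1) \<kappa>(1,2) pos Q(1) J1(2)] by blast
  obtain Cm where Cm: "Cm \<ge> 0" and mom: "\<And>(u :: 'a \<Rightarrow> real) a. \<lbrakk>prob_density u; 1 \<le> a; a \<le> 2;
      \<forall>\<xi>. norm (1 - fourier u \<xi>) \<le> (2 + C\<^sub>0) * norm \<xi> powr a\<rbrakk> \<Longrightarrow>
      (\<integral>\<^sup>+x. ennreal (jbr x powr m' * u x) \<partial>lborel) \<le> ennreal Cm"
    using moment_bound[of m' "2 + C\<^sub>0", where 'a='a] m' pos by auto
  define V where "V = sqrt (C2 * (unit_ball_vol d * 2 ^ DIM('a)))"
  define Ca where "Ca = 2 * V + 2 * Cm"
  \<comment> \<open>For s \<le> s0, (1 - s) powr \<theta> is at least (1 - s0) powr \<theta>, so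
    this constant turns the moment bound 2 Cm into the required form.\<close>
  define Cb where "Cb = 2 * Cm * (1 - s0) powr (- \<theta>)"
  have V: "V \<ge> 0" using C2 by (simp add: V_def d_def)
  have Cab: "Ca \<ge> 0" "Cb \<ge> 0" using V Cm by (auto simp: Ca_def Cb_def)
  have main: "L1k_norm k (\<lambda>x. F x - G x) \<le> ennreal ((Ca + Cb) * (1 - s) powr \<theta>)"
    if s: "s \<in> {1/2<..<1}" and \<epsilon>: "\<epsilon> \<in> {0<..<sqrt (2 / (4 + 2 * \<delta> + real DIM('a)))}"
      and F: "equilibrium (J s) (2 * s) \<epsilon> F" and G: "equilibrium J1 2 \<epsilon> G" for s \<epsilon> F G
  proof -
    have FG: "prob_density F" "prob_density G" using F G by (auto simp: equilibrium_def)
    have FGi: "integrable lborel F" "integrable lborel G" and FGn: "\<And>x. 0 \<le> F x" "\<And>x. 0 \<le> G x"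
      using FG by (auto simp: prob_density_def)
    have [measurable]: "F \<in> borel_measurable borel" "G \<in> borel_measurable borel" using FGi by auto
    have [measurable]: "(jbr :: 'a \<Rightarrow> real) \<in> borel_measurable borel" unfolding jbr_def by measurable
    have M: "norm (1 - fourier (J s) \<eta>) \<le> (2 + C\<^sub>0) * norm \<eta> powr (2 * s)"
     and M1: "norm (1 - fourier J1 \<eta>) \<le> (2 + C\<^sub>0) * norm \<eta> powr 2" for \<eta>
      by (rule low_freq_global[OF J[OF s]] low_freq_global[OF J1]; use pos s in simp)+
    have mF: "(\<integral>\<^sup>+x. ennreal (jbr x powr m' * F x) \<partial>lborel) \<le> ennreal Cm"
      by (rule mom[OF FG(1), of "2 * s"])
         (use s \<epsilon> norm_1_minus_fourier_equilibrium_le[OF F J(1)[OF s] M] in auto)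
    have mG: "(\<integral>\<^sup>+x. ennreal (jbr x powr m' * G x) \<partial>lborel) \<le> ennreal Cm"
      by (rule mom[OF FG(2), of 2])
         (use \<epsilon> norm_1_minus_fourier_equilibrium_le[OF G J1(1) M1] in auto)
    have Y: "(\<integral>\<^sup>+x. ennreal (jbr x powr m' * \<bar>F x - G x\<bar>) \<partial>lborel) \<le> ennreal (2 * Cm)"
    proof -
      have "(\<integral>\<^sup>+x. ennreal (jbr x powr m' * \<bar>F x - G x\<bar>) \<partial>lborel)
         \<le> (\<integral>\<^sup>+x. ennreal (jbr x powr m' * F x) + ennreal (jbr x powr m' * G x) \<partial>lborel)"
      proof (rule nn_integral_mono)
        fix x
        have "\<bar>F x - G x\<bar> \<le> F x + G x" using FGn[of x] by simp
        then have "jbr x powr m' * \<bar>F x - G x\<bar> \<le> jbr x powr m' * F x + jbr x powr m' * G x"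
          using mult_left_mono[of "\<bar>F x - G x\<bar>" "F x + G x" "jbr x powr m'"] by (simp add: distrib_left)
        then show "ennreal (jbr x powr m' * \<bar>F x - G x\<bar>) \<le> ennreal (jbr x powr m' * F x) + ennreal (jbr x powr m' * G x)"
          using FGn[of x] by (simp add: ennreal_plus[symmetric] ennreal_leI del: ennreal_plus)
      qed
      also have "\<dots> = (\<integral>\<^sup>+x. ennreal (jbr x powr m' * F x) \<partial>lborel) + (\<integral>\<^sup>+x. ennreal (jbr x powr m' * G x) \<partial>lborel)"
        by (rule nn_integral_add) measurable
      also have "\<dots> \<le> ennreal Cm + ennreal Cm" by (intro add_mono mF mG)
      also have "\<dots> = ennreal (2 * Cm)" using Cm by (simp add: ennreal_plus[symmetric] del: ennreal_plus)
      finally show ?thesis .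
    qed
    have fi: "integrable lborel (\<lambda>x. F x - G x)" using FGi by simp
    show ?thesis
    proof (cases "s0 < s")
      case True
      define h where "h = (1 - s) powr (1 - \<kappa>)"
      have h: "0 < h" "h \<le> 1" using s \<kappa> by (auto simp: h_def powr_le1)
      \<comment> \<open>Balances the two terms of \<open>L1k_interpolation\<close>: h R powr (k +
        d/2) and R powr (k - m') both equal h powr \<theta>'.\<close>
      define R where "R = h powr (- (1 / (m' + d / 2)))"
      have R: "1 \<le> R"
        unfolding R_def using powr_mono'[of "- (1 / (m' + d / 2))" 0 h] h m' d by simp
      have K: "(\<integral>\<^sup>+\<xi>. ennreal ((norm (fourier (\<lambda>x. F x - G x) \<xi>))\<^sup>2) \<partial>lborel) \<le> ennreal (C2 * h\<^sup>2)"
        unfolding h_def by (rule L2[OF _ True _ J[OF s] Q(2)[OF s] _ _ F G]) (use s \<epsilon> in auto)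
      have "(LBINT x. indicator (cball 0 R) x * \<bar>F x - G x\<bar>)\<^sup>2 \<le> C2 * h\<^sup>2 * (unit_ball_vol (DIM('a)) * (2 * R) ^ DIM('a))"
        by (rule L1_ball_le_fourier_L2[OF fi _ K]) (use R C2 in auto)
      also have "\<dots> = (V * h * R powr (d / 2))\<^sup>2"
      proof -
        have "(R powr (d / 2))\<^sup>2 = R ^ DIM('a)"
          using R by (simp add: d_def power2_eq_square powr_add[symmetric] powr_realpow)
        moreover have "V\<^sup>2 = C2 * (unit_ball_vol d * 2 ^ DIM('a))" using C2 by (simp add: V_def d_def)
        ultimately show ?thesis by (simp add: power_mult_distrib d_def mult_ac)
      qed
      finally have X: "(LBINT x. indicator (cball 0 R) x * \<bar>F x - G x\<bar>) \<le> V * h * R powr (d / 2)"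
        by (rule power2_le_imp_le) (intro mult_nonneg_nonneg V less_imp_le[OF h(1)] powr_ge_zero)
      have "L1k_norm k (\<lambda>x. F x - G x) \<le> ennreal (2 * R powr k * (V * h * R powr (d / 2)) + R powr (k - m') * (2 * Cm))"
        by (rule L1k_interpolation[OF fi assms(3) m'(4) _ R X Y]) (use assms Cm in auto)
      also have "2 * R powr k * (V * h * R powr (d / 2)) + R powr (k - m') * (2 * Cm) = Ca * (1 - s) powr \<theta>"
      proof -
        have md: "m' + d / 2 \<noteq> 0" using m' d by simp
        have hR: "h * (R powr k * R powr (d / 2)) = h powr \<theta>'"
        proof -
          have "h * (R powr k * R powr (d / 2)) = h powr 1 * R powr (k + d / 2)"
            using h by (simp add: powr_add)
          also have "R powr (k + d / 2) = h powr (- ((k + d / 2) / (m' + d / 2)))"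
            unfolding R_def powr_powr by (rule arg_cong[where f="(powr) h"]) simp
          also have "h powr 1 * h powr (- ((k + d / 2) / (m' + d / 2))) = h powr (1 - (k + d / 2) / (m' + d / 2))" by (simp only: powr_add[symmetric]) simp
          also have "1 - (k + d / 2) / (m' + d / 2) = \<theta>'" using md by (simp add: \<theta>'_def field_simps)
          finally show ?thesis .
        qed
        have Rk: "R powr (k - m') = h powr \<theta>'"
        proof -
          have "- (1 / c) * (k - m') = (m' - k) / c" for c
            by (simp add: diff_divide_distrib right_diff_distrib)
          then have "- (1 / (m' + d / 2)) * (k - m') = \<theta>'" unfolding \<theta>'_def .
          then show ?thesis by (simp only: R_def powr_powr)
        qed
        have ht: "h powr \<theta>' = (1 - s) powr \<theta>" by (simp only: h_def powr_powr \<kappa>(3))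
        have "2 * R powr k * (V * h * R powr (d / 2)) = 2 * V * (h * (R powr k * R powr (d / 2)))"
          by (simp only: mult_ac)
        then show ?thesis unfolding hR Rk ht by (simp add: Ca_def distrib_right)
      qed
      also have "ennreal (Ca * (1 - s) powr \<theta>) \<le> ennreal ((Ca + Cb) * (1 - s) powr \<theta>)"
        using Cab by (intro ennreal_leI mult_right_mono) auto
      finally show ?thesis .
    next
      case False
      have "L1k_norm k (\<lambda>x. F x - G x) \<le> (\<integral>\<^sup>+x. ennreal (jbr x powr m' * \<bar>F x - G x\<bar>) \<partial>lborel)"
        unfolding L1k_norm_def
        by (intro nn_integral_mono ennreal_leI mult_right_mono powr_mono) (use m' in \<open>auto simp: jbr_def\<close>)
      also have "\<dots> \<le> ennreal (2 * Cm)" by (rule Y)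
      also have "\<dots> \<le> ennreal (Cb * (1 - s) powr \<theta>)"
      proof (intro ennreal_leI)
        have "(1 - s0) powr \<theta> \<le> (1 - s) powr \<theta>" using False C2 \<theta> by (intro powr_mono2) auto
        then have "1 \<le> (1 - s0) powr (- \<theta>) * (1 - s) powr \<theta>"
          using C2 by (simp add: powr_minus_divide)
        then have "2 * Cm * 1 \<le> 2 * Cm * ((1 - s0) powr (- \<theta>) * (1 - s) powr \<theta>)"
          using Cm by (intro mult_left_mono) auto
        then show "2 * Cm \<le> Cb * (1 - s) powr \<theta>" by (simp add: Cb_def mult.assoc)
      qed
      also have "\<dots> \<le> ennreal ((Ca + Cb) * (1 - s) powr \<theta>)"
        using Cab by (intro ennreal_leI mult_right_mono) auto
      finally show ?thesis .
    qed
  qed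
  \<comment> \<open>\<open>main\<close> has the factor 1 where the claim has its
    \<epsilon>-dependent factor, which is at least 1.\<close>
  have le: "(Ca + Cb) * (1 - s) powr \<theta> \<le> (Ca + Cb) * (1 - s) powr \<theta> * (1 + \<epsilon> powr (\<delta> * \<theta>) * \<bar>ln \<epsilon>\<bar>)" for s \<epsilon>
    using Cab mult_left_mono[of 1 "1 + \<epsilon> powr (\<delta> * \<theta>) * \<bar>ln \<epsilon>\<bar>" "(Ca + Cb) * (1 - s) powr \<theta>"] by simp
  show ?thesis
    unfolding d_def[symmetric] \<theta>_def[symmetric]
    using main le unfolding d_def
    by (intro exI[of _ "Ca + Cb"] ballI allI impI) (blast intro: order_trans ennreal_leI)
qed

end
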